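(* Let $j\colon \Gamma_3\times\mathbb{R}\to\mathbb{R}$ satisfy: (a) $j(\cdot,r)$ is measurable on $\Gamma_3$ for all $r\in\mathbb{R}$; (b) $j(x,\cdot)$ is locally Lipschitz for a.e. $x\in\Gamma_3$; (c) there exist $c_0,c_1\ge 0$ such that $|\partial j(x,r)|\le c_0+c_1|r|$ for all $r\in\mathbb{R}$, a.e. $x\in\Gamma_3$; (d) $j^0(x,r;b-r)\le 0$ for all $r\in\mathbb{R}$, a.e. $x\in\Gamma_3$, with a constant $b\in\mathbb{R}$. Assume $b\ge 0$, $g\in L^2(\Omega)$ with $g\le 0$ in $\Omega$, and $q\in L^2(\Gamma_2)$ with $q\ge 0$ on $\Gamma_2$. Let $\alpha>0$, let $u_\alpha\in V_0$ be a solution of $$a(u_\alpha,v)+\alpha\int_{\Gamma_3} j^0(x,u_\alpha(x);v(x))\,d\Gamma\ \ge\ L(v)\quad\text{for all } v\in V_0,$$ and let $u_\infty\in K$ be the unique solution of $$a(u_\infty,v)=L(v)\quad\text{for all } v\in K_0 .$$ Then (a) $u_\alpha\le b$ in $\Omega$; (b) $u_\alpha\le u_\infty$ in $\Omega$.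
   Context: Setting: $\Omega\subset\mathbb{R}^d$ is a bounded domain with regular boundary $\Gamma$ (in particular Lipschitz, so that the trace operator $\gamma\colon H^1(\Omega)\to L^2(\Gamma)$ is defined, bounded and compact). $\Gamma$ is the union of three disjoint measurable portions $\Gamma_1,\Gamma_2,\Gamma_3$, each of positive $(d-1)$-dimensional Hausdorff measure. $V=H^1(\Omega)$, $V_0=\{v\in V: v=0 \text{ on }\Gamma_1\}$, $K=\{v\in V: v=0\text{ on }\Gamma_1,\ v=b\text{ on }\Gamma_3\}$ (with $b$ the constant from hypothesis (d)), $K_0=\{v\in V: v=0\text{ on }\Gamma_1\cup\Gamma_3\}$ (all in the trace sense). $a(u,v)=\int_\Omega \nabla u\cdot\nabla v\,dx$ and $L(v)=\int_\Omega g v\,dx-\int_{\Gamma_2} q v\,d\Gamma$. In boundary integrals a function of $V$ is identified with its trace. Inequalities between functions in $\Omega$ are understood a.e. Clarke calculus: for a locally Lipschitz $\varphi\colon\mathbb{R}\to\mathbb{R}$, $\varphi^0(r;s)=\limsup_{y\to r,\ \lambda\to0^+}\frac{\varphi(y+\lambda s)-\varphi(y)}{\lambda}$ and $\partial\varphi(r)=\{\zeta\in\mathbb{R}:\varphi^0(r;s)\ge\zeta s\ \text{for all } s\in\mathbb{R}\}$. For $j$ these are taken in the second variable, written $j^0(x,r;s)$ and $\partial j(x,r)$. The bound $|\partial j(x,r)|\le C$ means $|\zeta|\le C$ for every $\zeta\in\partial j(x,r)$. "For all $r\in\mathbb{R}$, a.e. $x\in\Gamma_3$" means: for a.e. $x\in\Gamma_3$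 the condition holds for all $r\in\mathbb{R}$. *)

theory Defs
  imports "HOL-Analysis.Analysis"
begin

section \<open>Hausdorff measure\<close>

text \<open>
  The weight of a single set of a \<open>\<delta>\<close>-cover.  Sets that are not admissible in a \<open>\<delta>\<close>-cover get
  weight \<open>\<infinity>\<close>, so that \<open>outer_measure UNIV\<close> (an infimum over countable disjoint covers by
  arbitrary sets) is the usual \<open>\<delta>\<close>-premeasure; since the weight is monotone, requiring
  disjointness does not change the infimum.  With \<open>0 ^ 0 = 1\<close> the case \<open>k = 0\<close> gives
  counting measure.
\<close>

definition hausdorff_weight :: "nat \<Rightarrow> real \<Rightarrow> 'a::metric_space set \<Rightarrow> ennreal" where
  "hausdorff_weight k \<delta> C =
     (if C = {} then 0
      else if bounded C \<and> diameter C \<le> \<delta>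
        then ennreal (unit_ball_vol (real k) * (diameter C / 2) ^ k)
      else \<infinity>)"

definition hausdorff_outer :: "nat \<Rightarrow> 'a::metric_space set \<Rightarrow> ennreal" where
  "hausdorff_outer k A = (SUP \<delta>\<in>{0<..}. outer_measure UNIV (hausdorff_weight k \<delta>) A)"

definition hausdorff_measure :: "nat \<Rightarrow> 'a::metric_space measure" where
  "hausdorff_measure k =
     measure_of UNIV (lambda_system UNIV UNIV (hausdorff_outer k)) (hausdorff_outer k)"

text \<open>
  \<^const>\<open>measure_of\<close> silently yields the zero measure if its argument is not countably additive;
  the following facts show that this does not happen here.
\<close>

lemma outer_measure_space_hausdorff_weight:
  "outer_measure_space UNIV (outer_measure UNIV (hausdorff_weight k \<delta>))"
proof -
  interpret ring_of_sets UNIV "UNIV :: 'a set set"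
    using ring_of_sets_Pow[of "UNIV :: 'a set"] by simp
  have "hausdorff_weight k \<delta> A \<le> hausdorff_weight k \<delta> B" if "A \<subseteq> B" for A B :: "'a set"
  proof (cases "A = {} \<or> \<not> (bounded B \<and> diameter B \<le> \<delta>)")
    case True
    then show ?thesis
      using that by (auto simp: hausdorff_weight_def)
  next
    case False
    then have "bounded A" "diameter A \<le> diameter B" "0 \<le> diameter A" "B \<noteq> {}"
      using that bounded_subset diameter_subset diameter_ge_0 by blast+
    then show ?thesis
      using False
      by (auto simp: hausdorff_weight_def intro!: ennreal_leI mult_left_mono power_mono)
  qed
  then have "increasing UNIV (hausdorff_weight k \<delta> :: 'a set \<Rightarrow> ennreal)"
    by (simp add: increasing_def)
  moreover have "positive UNIV (hausdorff_weight k \<delta> :: 'a set \<Rightarrow> ennreal)"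
    by (simp add: positive_def hausdorff_weight_def)
  ultimately show ?thesis
    using outer_measure_space_outer_measure by simp
qed

lemma outer_measure_space_hausdorff_outer:
  "outer_measure_space UNIV (hausdorff_outer k :: 'a::metric_space set \<Rightarrow> ennreal)"
proof -
  let ?O = "\<lambda>\<delta>. outer_measure UNIV (hausdorff_weight k \<delta>) :: 'a set \<Rightarrow> ennreal"
  have O: "positive UNIV (?O \<delta>)" "increasing UNIV (?O \<delta>)" "countably_subadditive UNIV (?O \<delta>)" for \<delta>
    using outer_measure_space_hausdorff_weight by (auto simp: outer_measure_space_def)
  have "positive UNIV (hausdorff_outer k :: 'a set \<Rightarrow> ennreal)"
    using O(1) by (simp add: positive_def hausdorff_outer_def)
  moreover have "increasing UNIV (hausdorff_outer k :: 'a set \<Rightarrow> ennreal)"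
    using O(2) by (auto simp: increasing_def hausdorff_outer_def intro!: SUP_mono)
  moreover have "countably_subadditive UNIV (hausdorff_outer k :: 'a set \<Rightarrow> ennreal)"
    unfolding countably_subadditive_def
  proof (intro allI impI)
    fix A :: "nat \<Rightarrow> 'a set"
    assume A: "disjoint_family A"
    show "hausdorff_outer k (\<Union>i. A i) \<le> (\<Sum>i. hausdorff_outer k (A i))"
      unfolding hausdorff_outer_def[of k "\<Union>i. A i"]
    proof (rule SUP_least)
      fix \<delta> :: real assume \<delta>: "\<delta> \<in> {0<..}"
      have "?O \<delta> (\<Union>i. A i) \<le> (\<Sum>i. ?O \<delta> (A i))"
        using O(3)[of \<delta>] A by (auto simp: countably_subadditive_def)
      also have "\<dots> \<le> (\<Sum>i. hausdorff_outer k (A i))"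
        using \<delta> by (intro suminf_le) (auto simp: hausdorff_outer_def intro!: SUP_upper)
      finally show "?O \<delta> (\<Union>i. A i) \<le> (\<Sum>i. hausdorff_outer k (A i))" .
    qed
  qed
  ultimately show ?thesis
    by (simp add: outer_measure_space_def)
qed

lemma measure_space_hausdorff_outer:
  "measure_space UNIV (lambda_system UNIV UNIV (hausdorff_outer k)) (hausdorff_outer k)"
proof -
  interpret sigma_algebra UNIV "UNIV :: 'a set set"
    using sigma_algebra_Pow[of "UNIV :: 'a set"] by simp
  show ?thesis
    by (rule caratheodory_lemma[OF outer_measure_space_hausdorff_outer])
qed

lemma space_hausdorff_measure [simp]: "space (hausdorff_measure k) = UNIV"
  by (simp add: hausdorff_measure_def space_measure_of_conv)

lemma sets_hausdorff_measure:
  "sets (hausdorff_measure k) = lambda_system UNIV UNIV (hausdorff_outer k)"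
  using measure_space_hausdorff_outer[of k] sigma_algebra.sets_measure_of_eq
  unfolding hausdorff_measure_def measure_space_def by blast

lemma emeasure_hausdorff_measure:
  fixes A :: "'a::metric_space set"
  assumes "A \<in> sets (hausdorff_measure k)"
  shows "emeasure (hausdorff_measure k) A = hausdorff_outer k A"
  unfolding hausdorff_measure_def
  using measure_space_hausdorff_outer[of k, where ?'a = 'a] assms
  by (intro emeasure_measure_of_sigma) (simp_all add: measure_space_def sets_hausdorff_measure)

abbreviation surface_on :: "'a::euclidean_space set \<Rightarrow> 'a measure" where
  "surface_on S \<equiv> restrict_space (hausdorff_measure (DIM('a) - 1)) S"


section \<open>Bounded Lipschitz domains\<close>

text \<open>
  Near every boundary point the set is, for a suitable unit direction \<open>e\<close>, the strict epigraph
  over the hyperplane \<open>e\<^sup>\<bottom>\<close> of a Lipschitz function; \<open>y - (y \<bullet> e) *\<^sub>R e\<close> is the orthogonal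
  projection of \<open>y\<close> onto this hyperplane.
\<close>

definition lipschitz_boundary :: "'a::euclidean_space set \<Rightarrow> bool" where
  "lipschitz_boundary \<Omega> \<longleftrightarrow>
     (\<forall>x\<in>frontier \<Omega>. \<exists>r>0. \<exists>e f L. norm e = 1 \<and> L-lipschitz_on {z. z \<bullet> e = 0} f \<and>
        (\<forall>y\<in>ball x r. y \<in> \<Omega> \<longleftrightarrow> f (y - (y \<bullet> e) *\<^sub>R e) < y \<bullet> e))"

definition bounded_lipschitz_domain :: "'a::euclidean_space set \<Rightarrow> bool" where
  "bounded_lipschitz_domain \<Omega> \<longleftrightarrow>
     \<Omega> \<noteq> {} \<and> open \<Omega> \<and> connected \<Omega> \<and> bounded \<Omega> \<and> lipschitz_boundary \<Omega>"


section \<open>Smooth functions and Sobolev space\<close>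

fun times_differentiable :: "nat \<Rightarrow> ('a::euclidean_space \<Rightarrow> real) \<Rightarrow> bool" where
  "times_differentiable 0 f \<longleftrightarrow> continuous_on UNIV f"
| "times_differentiable (Suc k) f \<longleftrightarrow>
     (\<forall>x. f differentiable at x) \<and>
     (\<forall>i\<in>Basis. times_differentiable k (\<lambda>x. frechet_derivative f (at x) i))"

definition smooth :: "('a::euclidean_space \<Rightarrow> real) \<Rightarrow> bool" where
  "smooth f \<longleftrightarrow> (\<forall>k. times_differentiable k f)"

definition test_functions :: "'a::euclidean_space set \<Rightarrow> ('a \<Rightarrow> real) set" where
  "test_functions \<Omega> =
     {\<phi>. smooth \<phi> \<and> compact (closure {x. \<phi> x \<noteq> 0}) \<and> closure {x. \<phi> x \<noteq> 0} \<subseteq> \<Omega>}"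

definition gradient :: "('a::euclidean_space \<Rightarrow> real) \<Rightarrow> 'a \<Rightarrow> 'a" where
  "gradient f x = (\<Sum>i\<in>Basis. frechet_derivative f (at x) i *\<^sub>R i)"

definition L2 :: "'a measure \<Rightarrow> ('a \<Rightarrow> 'b::euclidean_space) set" where
  "L2 M = {f \<in> borel_measurable M. integrable M (\<lambda>x. (norm (f x))\<^sup>2)}"

definition has_weak_gradient ::
    "'a::euclidean_space set \<Rightarrow> ('a \<Rightarrow> real) \<Rightarrow> ('a \<Rightarrow> 'a) \<Rightarrow> bool" where
  "has_weak_gradient \<Omega> u G \<longleftrightarrow>
     (\<forall>\<phi>\<in>test_functions \<Omega>. \<forall>i\<in>Basis.
        (\<integral>x. u x * frechet_derivative \<phi> (at x) i \<partial>lebesgue_on \<Omega>) =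
        - (\<integral>x. (G x \<bullet> i) * \<phi> x \<partial>lebesgue_on \<Omega>))"

definition H1 :: "'a::euclidean_space set \<Rightarrow> ('a \<Rightarrow> real) set" where
  "H1 \<Omega> = {u \<in> L2 (lebesgue_on \<Omega>). \<exists>G\<in>L2 (lebesgue_on \<Omega>). has_weak_gradient \<Omega> u G}"

text \<open>The weak gradient is determined up to a null set, which is immaterial under integrals.\<close>

definition weak_gradient :: "'a::euclidean_space set \<Rightarrow> ('a \<Rightarrow> real) \<Rightarrow> 'a \<Rightarrow> 'a" where
  "weak_gradient \<Omega> u = (SOME G. G \<in> L2 (lebesgue_on \<Omega>) \<and> has_weak_gradient \<Omega> u G)"


section \<open>Traces\<close>

text \<open>
  The trace operator \<open>H\<^sup>1(\<Omega>) \<rightarrow> L\<^sup>2(\<Gamma>)\<close> of a bounded Lipschitz domain is the continuous extension of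
  the restriction \<open>\<phi> \<mapsto> \<phi>|\<Gamma>\<close> from the dense subspace of (restrictions to \<open>\<Omega>\<close> of) smooth functions
  on the whole space.  \<open>has_trace \<Omega> u t\<close> is the graph of that extension: \<open>t\<close> is the limit in
  \<open>L\<^sup>2(\<Gamma>)\<close> of restrictions of smooth functions converging to \<open>u\<close> in \<open>H\<^sup>1(\<Omega>)\<close>.  Convergence is
  expressed by nonnegative integrals, so no integrability side conditions are hidden.
\<close>

definition has_trace ::
    "'a::euclidean_space set \<Rightarrow> ('a \<Rightarrow> real) \<Rightarrow> ('a \<Rightarrow> real) \<Rightarrow> bool" where
  "has_trace \<Omega> u t \<longleftrightarrow> u \<in> H1 \<Omega> \<and> t \<in> L2 (surface_on (frontier \<Omega>)) \<and>
     (\<exists>\<phi>. (\<forall>n. smooth (\<phi> n)) \<and>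
        (\<lambda>n. \<integral>\<^sup>+x. ennreal ((u x - \<phi> n x)\<^sup>2) \<partial>lebesgue_on \<Omega>) \<longlonglongrightarrow> 0 \<and>
        (\<lambda>n. \<integral>\<^sup>+x. ennreal ((norm (weak_gradient \<Omega> u x - gradient (\<phi> n) x))\<^sup>2) \<partial>lebesgue_on \<Omega>)
          \<longlonglongrightarrow> 0 \<and>
        (\<lambda>n. \<integral>\<^sup>+x. ennreal ((t x - \<phi> n x)\<^sup>2) \<partial>surface_on (frontier \<Omega>)) \<longlonglongrightarrow> 0)"

definition boundary_trace :: "'a::euclidean_space set \<Rightarrow> ('a \<Rightarrow> real) \<Rightarrow> 'a \<Rightarrow> real" where
  "boundary_trace \<Omega> u = (SOME t. has_trace \<Omega> u t)"

definition equals_on_boundary ::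
    "'a::euclidean_space set \<Rightarrow> 'a set \<Rightarrow> ('a \<Rightarrow> real) \<Rightarrow> real \<Rightarrow> bool" where
  "equals_on_boundary \<Omega> S u c \<longleftrightarrow> (\<exists>t. has_trace \<Omega> u t \<and> (AE x in surface_on S. t x = c))"


section \<open>Function spaces and forms of the boundary value problem\<close>

definition V0_space :: "'a::euclidean_space set \<Rightarrow> 'a set \<Rightarrow> ('a \<Rightarrow> real) set" where
  "V0_space \<Omega> \<Gamma>1 = {v \<in> H1 \<Omega>. equals_on_boundary \<Omega> \<Gamma>1 v 0}"

definition K_set :: "'a::euclidean_space set \<Rightarrow> 'a set \<Rightarrow> 'a set \<Rightarrow> real \<Rightarrow> ('a \<Rightarrow> real) set" where
  "K_set \<Omega> \<Gamma>1 \<Gamma>3 b =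
     {v \<in> H1 \<Omega>. equals_on_boundary \<Omega> \<Gamma>1 v 0 \<and> equals_on_boundary \<Omega> \<Gamma>3 v b}"

definition K0_space :: "'a::euclidean_space set \<Rightarrow> 'a set \<Rightarrow> 'a set \<Rightarrow> ('a \<Rightarrow> real) set" where
  "K0_space \<Omega> \<Gamma>1 \<Gamma>3 = {v \<in> H1 \<Omega>. equals_on_boundary \<Omega> (\<Gamma>1 \<union> \<Gamma>3) v 0}"

definition dirichlet_form ::
    "'a::euclidean_space set \<Rightarrow> ('a \<Rightarrow> real) \<Rightarrow> ('a \<Rightarrow> real) \<Rightarrow> real" where
  "dirichlet_form \<Omega> u v = (\<integral>x. weak_gradient \<Omega> u x \<bullet> weak_gradient \<Omega> v x \<partial>lebesgue_on \<Omega>)"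

definition load_functional ::
    "'a::euclidean_space set \<Rightarrow> 'a set \<Rightarrow> ('a \<Rightarrow> real) \<Rightarrow> ('a \<Rightarrow> real) \<Rightarrow> ('a \<Rightarrow> real) \<Rightarrow> real" where
  "load_functional \<Omega> \<Gamma>2 g q v =
     (\<integral>x. g x * v x \<partial>lebesgue_on \<Omega>) - (\<integral>x. q x * boundary_trace \<Omega> v x \<partial>surface_on \<Gamma>2)"


section \<open>Clarke calculus on the real line\<close>

definition locally_lipschitz :: "(real \<Rightarrow> real) \<Rightarrow> bool" where
  "locally_lipschitz \<phi> \<longleftrightarrow> (\<forall>r. \<exists>\<epsilon>>0. \<exists>L. L-lipschitz_on (ball r \<epsilon>) \<phi>)"

text \<open>For locally Lipschitz functions the upper limit is finite.\<close>

definition clarke_derivative :: "(real \<Rightarrow> real) \<Rightarrow> real \<Rightarrow> real \<Rightarrow> real" where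
  "clarke_derivative \<phi> r s =
     real_of_ereal (Limsup (nhds r \<times>\<^sub>F at_right 0)
       (\<lambda>(y, \<tau>). ereal ((\<phi> (y + \<tau> * s) - \<phi> y) / \<tau>)))"

definition clarke_subdifferential :: "(real \<Rightarrow> real) \<Rightarrow> real \<Rightarrow> real set" where
  "clarke_subdifferential \<phi> r = {\<zeta>. \<forall>s. clarke_derivative \<phi> r s \<ge> \<zeta> * s}"

end

theory Submission
  imports Defs "HOL-Computational_Algebra.Polynomial"
begin

text \<open>
  Testing the inequality for \<open>u\<^sub>\<alpha>\<close> with \<open>- (u\<^sub>\<alpha> - b)\<^sup>+\<close>, the sign conditions leave
  \<open>\<parallel>\<nabla>(u\<^sub>\<alpha> - b)\<^sup>+\<parallel>\<^sup>2 \<le> 0\<close>; a function with zero gradient is constant on the connected domain, and its trace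
  vanishes on \<open>\<Gamma>1\<close>. In particular \<open>u\<^sub>\<alpha> \<le> b\<close> holds on \<open>\<Gamma>3\<close> as well, so \<open>(u\<^sub>\<alpha> - u\<^sub>\<infinity>)\<^sup>+\<close>
  is admissible in both problems, and subtracting them gives \<open>\<parallel>\<nabla>(u\<^sub>\<alpha> - u\<^sub>\<infinity>)\<^sup>+\<parallel>\<^sup>2 \<le> 0\<close>.

  Positive parts inherit traces and gradients from the smooth functions \<open>\<phi> exp (- \<epsilon> / \<phi>)\<close>. Since traces are
  defined by approximation, their uniqueness needs the trace inequality. Near a boundary point, the surface and its
  translates into the domain are level sets of a Lipschitz function, so Eilenberg's inequality bounds the
  integral over these translates by a Lebesgue integral, and the fundamental theorem of calculus along the
  direction of translation does the rest.
\<close>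

section \<open>Borel sets are Hausdorff measurable\<close>

text \<open>The main obstacle is that \<open>weak_gradient\<close> and \<open>boundary_trace\<close>
  are arbitrary choices, about which nothing can be computed before gradient and trace are known to
  depend on \<open>u\<close> alone up to null sets. The calculus is therefore done with triples
  \<open>(u, G, t)\<close> under \<open>approx_trace\<close>, for which differences, limits and
  positive parts are explicit. One closability statement, \<open>approx_trace_zero\<close>, then
  ties the triples to the chosen objects. The surface measure is known only through coverings, and
  the trace inequality needs just one direction: surface integrals are bounded above by volume
  integrals. Coverings by cubes give this, and the same bound yields the finiteness of the surface
  measure that Fubini's theorem requires. The approximants of a positive part have to be infinitely
  differentiable, because the functions in the definition of a trace are. The factor
  \<open>exp (- \<epsilon> / s)\<close> achieves this while the derivative of the substitute stays
  between 0 and 1, so that all estimates are uniform in \<epsilon>.\<close>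

lemma hausdorff_weight_mono:
  assumes "A \<subseteq> B"
  shows "hausdorff_weight k \<delta> A \<le> hausdorff_weight k \<delta> B"
proof (cases "A = {} \<or> \<not> (bounded B \<and> diameter B \<le> \<delta>)")
  case True
  then show ?thesis
    using assms by (auto simp: hausdorff_weight_def)
next
  case False
  then have "bounded A" "diameter A \<le> diameter B" "0 \<le> diameter A" "B \<noteq> {}"
    using assms bounded_subset diameter_subset diameter_ge_0 by blast+
  then show ?thesis
    using False by (auto simp: hausdorff_weight_def intro!: ennreal_leI mult_left_mono power_mono)
qed

lemma hausdorff_weight_empty [simp]: "hausdorff_weight k \<delta> {} = 0"
  by (simp add: hausdorff_weight_def)

text \<open>\<open>outer_measure\<close> admits disjoint covers only. Making a cover disjoint
  shrinks its sets, which does not increase a monotone weight, so arbitrary covers may be used from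
  here on.\<close>

lemma outer_measure_hausdorff_weight_le:
  assumes "A \<subseteq> (\<Union>i. C i)"
  shows "outer_measure UNIV (hausdorff_weight k \<delta>) A \<le> (\<Sum>i. hausdorff_weight k \<delta> (C i))"
proof -
  have "outer_measure UNIV (hausdorff_weight k \<delta>) A \<le> (\<Sum>i. hausdorff_weight k \<delta> (disjointed C i))"
    unfolding outer_measure_def
    using assms by (intro INF_lower) (auto simp: UN_disjointed_eq disjoint_family_disjointed)
  also have "\<dots> \<le> (\<Sum>i. hausdorff_weight k \<delta> (C i))"
    by (intro suminf_le hausdorff_weight_mono) (auto simp: disjointed_subset)
  finally show ?thesis .
qed

lemma outer_measure_hausdorff_weight_antimono:
  assumes "\<delta> \<le> \<epsilon>"
  shows "outer_measure UNIV (hausdorff_weight k \<epsilon>) A \<le> outer_measure UNIV (hausdorff_weight k \<delta>) A"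
proof -
  have "hausdorff_weight k \<epsilon> C \<le> hausdorff_weight k \<delta> C" for C :: "'a set"
    using assms by (auto simp: hausdorff_weight_def)
  then show ?thesis
    unfolding outer_measure_def by (intro INF_mono) (auto intro!: suminf_le)
qed

lemma incseq_hausdorff_premeasure:
  "incseq (\<lambda>n. outer_measure UNIV (hausdorff_weight k (1 / real (Suc n))) A)"
  by (intro incseq_SucI outer_measure_hausdorff_weight_antimono) (simp add: frac_le)

text \<open>The premeasures increase as \<delta> decreases, so countably many scales suffice. The
  increasing sequence is what allows sums of suprema and Fatou's lemma later.\<close>

lemma hausdorff_outer_eq_SUP:
  "hausdorff_outer k A = (SUP n. outer_measure UNIV (hausdorff_weight k (1 / real (Suc n))) A)"
  unfolding hausdorff_outer_def
proof (rule antisym)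
  show "(SUP \<delta>\<in>{0<..}. outer_measure UNIV (hausdorff_weight k \<delta>) A)
      \<le> (SUP n. outer_measure UNIV (hausdorff_weight k (1 / real (Suc n))) A)"
  proof (rule SUP_mono)
    fix \<delta> :: real assume "\<delta> \<in> {0<..}"
    then have "0 < \<delta>" by simp
    then obtain n where "1 / real (Suc n) < \<delta>"
      by (rule nat_approx_posE)
    then show "\<exists>n\<in>UNIV. outer_measure UNIV (hausdorff_weight k \<delta>) A
        \<le> outer_measure UNIV (hausdorff_weight k (1 / real (Suc n))) A"
      using outer_measure_hausdorff_weight_antimono[of "1 / real (Suc n)" \<delta> k A] by auto
  qed
  show "(SUP n. outer_measure UNIV (hausdorff_weight k (1 / real (Suc n))) A)
      \<le> (SUP \<delta>\<in>{0<..}. outer_measure UNIV (hausdorff_weight k \<delta>) A)"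
    by (rule SUP_subset_mono[of "range (\<lambda>n. 1 / real (Suc n))", unfolded image_image]) auto
qed

lemma hausdorff_outer_mono:
  assumes "A \<subseteq> B"
  shows "hausdorff_outer k A \<le> hausdorff_outer k B"
  using assms outer_measure_space_hausdorff_outer[of k, where ?'a='a]
  by (auto simp: outer_measure_space_def increasing_def)

lemma hausdorff_outer_empty [simp]: "hausdorff_outer k {} = 0"
  using outer_measure_space_hausdorff_outer[of k, where ?'a='a]
  by (auto simp: outer_measure_space_def positive_def)

lemma hausdorff_outer_le_suminf:
  assumes "A \<subseteq> (\<Union>i. C i)"
  shows "hausdorff_outer k A \<le> (\<Sum>i. hausdorff_outer k (C i))"
proof -
  have "hausdorff_outer k A \<le> hausdorff_outer k (\<Union>i. disjointed C i)"
    using assms by (intro hausdorff_outer_mono) (simp add: UN_disjointed_eq)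
  also have "\<dots> \<le> (\<Sum>i. hausdorff_outer k (disjointed C i))"
    using outer_measure_space_hausdorff_outer[of k, where ?'a='a] disjoint_family_disjointed[of C]
    by (auto simp: outer_measure_space_def countably_subadditive_def)
  also have "\<dots> \<le> (\<Sum>i. hausdorff_outer k (C i))"
    by (intro suminf_le hausdorff_outer_mono) (auto simp: disjointed_subset)
  finally show ?thesis .
qed

lemma hausdorff_outer_Un_le: "hausdorff_outer k (A \<union> B) \<le> hausdorff_outer k A + hausdorff_outer k B"
proof -
  have "hausdorff_outer k (A \<union> B) \<le> (\<Sum>i. hausdorff_outer k (binaryset A B i))"
    by (intro hausdorff_outer_le_suminf) (simp add: UN_binaryset_eq)
  also have "\<dots> = hausdorff_outer k A + hausdorff_outer k B"
    by (rule suminf_binaryset_eq) simp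
  finally show ?thesis .
qed

text \<open>At a scale below \<open>d\<close>, an admissible set of a cover cannot meet both
  \<open>A\<close> and \<open>B\<close>, so every cover of the union splits into a cover of
  \<open>A\<close> and one of \<open>B\<close>.\<close>

lemma hausdorff_outer_separated:
  fixes A B :: "'a::metric_space set"
  assumes "d > 0" and sep: "\<And>x y. x \<in> A \<Longrightarrow> y \<in> B \<Longrightarrow> d \<le> dist x y"
  shows "hausdorff_outer k A + hausdorff_outer k B \<le> hausdorff_outer k (A \<union> B)"
proof -
  let ?O = "\<lambda>\<delta> A. outer_measure UNIV (hausdorff_weight k \<delta>) A"
  have small: "?O \<delta> A + ?O \<delta> B \<le> ?O \<delta> (A \<union> B)" if "\<delta> < d" for \<delta>
    unfolding outer_measure_def[of UNIV "hausdorff_weight k \<delta>" "A \<union> B"]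
  proof (rule INF_greatest)
    fix C :: "nat \<Rightarrow> 'a set"
    assume "C \<in> {C. range C \<subseteq> UNIV \<and> disjoint_family C \<and> A \<union> B \<subseteq> (\<Union>i. C i)}"
    then have C: "A \<subseteq> (\<Union>i. C i \<inter> A)" "B \<subseteq> (\<Union>i. C i \<inter> B)"
      by auto
    have split: "hausdorff_weight k \<delta> (D \<inter> A) + hausdorff_weight k \<delta> (D \<inter> B) \<le> hausdorff_weight k \<delta> D" for D
    proof (cases "bounded D \<and> diameter D \<le> \<delta>")
      case True
      have "D \<inter> A = {} \<or> D \<inter> B = {}"
      proof (rule ccontr)
        assume "\<not> ?thesis"
        then obtain x y where "x \<in> D" "x \<in> A" "y \<in> D" "y \<in> B" by auto
        then have "dist x y \<le> \<delta>" "d \<le> dist x y"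
          using True diameter_bounded_bound[of D x y] sep by auto
        with that show False by simp
      qed
      then show ?thesis
        using hausdorff_weight_mono[of "D \<inter> A" D] hausdorff_weight_mono[of "D \<inter> B" D] by auto
    qed (auto simp: hausdorff_weight_def)
    have "?O \<delta> A + ?O \<delta> B \<le> (\<Sum>i. hausdorff_weight k \<delta> (C i \<inter> A)) + (\<Sum>i. hausdorff_weight k \<delta> (C i \<inter> B))"
      by (intro add_mono outer_measure_hausdorff_weight_le C)
    also have "\<dots> = (\<Sum>i. hausdorff_weight k \<delta> (C i \<inter> A) + hausdorff_weight k \<delta> (C i \<inter> B))"
      by (rule suminf_add) auto
    also have "\<dots> \<le> (\<Sum>i. hausdorff_weight k \<delta> (C i))"
      by (intro suminf_le split) auto
    finally show "?O \<delta> A + ?O \<delta> B \<le> (\<Sum>i. hausdorff_weight k \<delta> (C i))" .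
  qed
  have "hausdorff_outer k A + hausdorff_outer k B
      = (SUP n. ?O (1 / real (Suc n)) A + ?O (1 / real (Suc n)) B)"
    unfolding hausdorff_outer_eq_SUP
    by (rule ennreal_SUP_add[symmetric]) (rule incseq_hausdorff_premeasure)+
  also have "\<dots> \<le> hausdorff_outer k (A \<union> B)"
  proof (rule SUP_least)
    fix n
    obtain m where "1 / real (Suc m) < d"
      using \<open>d > 0\<close> by (rule nat_approx_posE)
    then have m: "1 / real (Suc (max m n)) < d"
      by (smt (verit) frac_le max.cobounded1 of_nat_0_less_iff of_nat_le_iff Suc_le_mono zero_less_Suc)
    have "?O (1 / real (Suc n)) A + ?O (1 / real (Suc n)) B
        \<le> ?O (1 / real (Suc (max m n))) A + ?O (1 / real (Suc (max m n))) B"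
      by (intro add_mono incseqD[OF incseq_hausdorff_premeasure]) auto
    also have "\<dots> \<le> ?O (1 / real (Suc (max m n))) (A \<union> B)"
      by (rule small[OF m])
    also have "\<dots> \<le> hausdorff_outer k (A \<union> B)"
      unfolding hausdorff_outer_eq_SUP by (rule SUP_upper) simp
    finally show "?O (1 / real (Suc n)) A + ?O (1 / real (Suc n)) B \<le> hausdorff_outer k (A \<union> B)" .
  qed
  finally show ?thesis .
qed

lemma ennreal_suminf_tail_tendsto_0:
  fixes f :: "nat \<Rightarrow> ennreal"
  assumes "suminf f \<noteq> \<infinity>"
  shows "(\<lambda>n. \<Sum>k. f (k + n)) \<longlonglongrightarrow> 0"
proof -
  define a where "a k = enn2real (f k)" for k
  have "f k \<noteq> \<infinity>" for k
    using assms by (metis ennreal_suminf_lessD infinity_ennreal_def less_top)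
  then have f: "f k = ennreal (a k)" for k
    by (simp add: a_def less_top)
  have nonneg: "0 \<le> a k" for k
    by (simp add: a_def)
  have a: "summable a"
    using assms nonneg unfolding f by (intro summable_suminf_not_top) auto
  have "(\<lambda>n. \<Sum>k. a (k + n)) \<longlonglongrightarrow> 0"
    using suminf_exist_split2[OF a] by simp
  then have "(\<lambda>n. ennreal (\<Sum>k. a (k + n))) \<longlonglongrightarrow> ennreal 0"
    by (rule tendsto_ennrealI)
  moreover have "(\<Sum>k. f (k + n)) = ennreal (\<Sum>k. a (k + n))" for n
    unfolding f using nonneg a summable_iff_shift[of a n] by (intro suminf_ennreal2) auto
  ultimately show ?thesis by simp
qed

text \<open>Caratheodory's argument: the annuli \<open>R n\<close> around \<open>C\<close> with indices of equal parity are separated, so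
  their measures are summable.\<close>

lemma closed_in_sets_hausdorff_measure:
  fixes C :: "'a::metric_space set"
  assumes "closed C"
  shows "C \<in> sets (hausdorff_measure k)"
proof (cases "C = {}")
  case False
  let ?H = "hausdorff_outer k :: 'a set \<Rightarrow> ennreal"
  have main: "?H (C \<inter> E) + ?H (E - C) \<le> ?H E" for E
  proof (cases "?H E = \<infinity>")
    case fin: False
    define F where "F n = {x\<in>E. 1 / real (n + 1) < infdist x C}" for n
    define R where "R n = {x\<in>E. 1 / real (n + 2) < infdist x C \<and> infdist x C \<le> 1 / real (n + 1)}" for n
    have sepF: "?H (C \<inter> E) + ?H (F n) \<le> ?H E" for n
    proof -
      have "1 / real (n + 1) \<le> dist x y" if "x \<in> C \<inter> E" "y \<in> F n" for x y
        using that infdist_le[of x C y] by (auto simp: F_def dist_commute)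
      then have "?H (C \<inter> E) + ?H (F n) \<le> ?H (C \<inter> E \<union> F n)"
        by (intro hausdorff_outer_separated[of "1 / real (n + 1)"]) auto
      also have "\<dots> \<le> ?H E"
        by (intro hausdorff_outer_mono) (auto simp: F_def)
      finally show ?thesis .
    qed
    have parity: "(\<Sum>k<n. ?H (R (2 * k + p))) \<le> ?H (\<Union>k<n. R (2 * k + p))" for n p
    proof (induction n)
      case (Suc n)
      \<comment> \<open>The gap is the width of the skipped annulus
        \<open>R (2 * n + p - 1)\<close>. For \<open>n = 0\<close> the union is empty and there is
        nothing to separate.\<close>
      have "1 / real (2 * n + p) - 1 / real (2 * n + p + 1) \<le> dist x y"
        if x: "x \<in> (\<Union>k<n. R (2 * k + p))" and "y \<in> R (2 * n + p)" for x y
      proof -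
        obtain l where l: "l < n" "x \<in> R (2 * l + p)"
          using x unfolding UN_iff lessThan_iff by blast
        then have "1 / real (2 * n + p) \<le> 1 / real (2 * l + p + 2)"
          by (intro frac_le) auto
        moreover have "1 / real (2 * l + p + 2) < infdist x C" "infdist y C \<le> 1 / real (2 * n + p + 1)"
          using l that by (auto simp: R_def)
        ultimately show ?thesis
          using infdist_triangle[of x C y] by simp
      qed
      moreover have "1 / real (2 * n + p) - 1 / real (2 * n + p + 1) > 0" if "n > 0"
        using that by (simp add: frac_less2)
      ultimately have "?H (\<Union>k<n. R (2 * k + p)) + ?H (R (2 * n + p))
          \<le> ?H ((\<Union>k<n. R (2 * k + p)) \<union> R (2 * n + p))"
        by (cases "n = 0") (auto intro!: hausdorff_outer_separated)
      moreover have "(\<Union>k<Suc n. R (2 * k + p)) = (\<Union>k<n. R (2 * k + p)) \<union> R (2 * n + p)"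
        by (auto simp: lessThan_Suc)
      ultimately show ?case
        using Suc.IH by (auto intro: order_trans add_right_mono)
    qed simp
    have half: "(\<Sum>k<n. ?H (R (2 * k + p))) \<le> ?H E" for n p
      by (rule order_trans[OF parity hausdorff_outer_mono]) (auto simp: R_def)
    have even_odd: "(\<Sum>k<2 * n. ?H (R k)) = (\<Sum>k<n. ?H (R (2 * k + 0))) + (\<Sum>k<n. ?H (R (2 * k + 1)))" for n
      by (induction n) (auto simp: algebra_simps)
    have "(\<Sum>k<n. ?H (R k)) \<le> ?H E + ?H E" for n
    proof -
      have "(\<Sum>k<n. ?H (R k)) \<le> (\<Sum>k<2 * n. ?H (R k))"
        by (intro sum_mono2) auto
      also have "\<dots> \<le> ?H E + ?H E"
        unfolding even_odd by (intro add_mono half)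
      finally show ?thesis .
    qed
    then have "(\<Sum>k. ?H (R k)) \<le> ?H E + ?H E"
      by (intro suminf_le_const) auto
    also have "\<dots> < \<infinity>"
      using fin by (simp add: less_top)
    finally have tail: "(\<lambda>n. \<Sum>k. ?H (R (k + n))) \<longlonglongrightarrow> 0"
      by (intro ennreal_suminf_tail_tendsto_0) auto
    have bound: "?H (C \<inter> E) + ?H (E - C) \<le> ?H E + (\<Sum>k. ?H (R (k + n)))" for n
    proof -
      have "E - C \<subseteq> F n \<union> (\<Union>k. R (k + n))"
      proof
        fix x assume x: "x \<in> E - C"
        then have pos: "0 < infdist x C"
          using assms False by (metis DiffD2 in_closed_iff_infdist_zero infdist_nonneg less_eq_real_def)
        show "x \<in> F n \<union> (\<Union>k. R (k + n))"
        proof (cases "x \<in> F n")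
          case nF: False
          obtain m0 where "1 / real (Suc m0) < infdist x C"
            using pos by (rule nat_approx_posE)
          then have ex: "\<exists>m. 1 / real (m + 1) < infdist x C"
            by (auto intro!: exI[of _ m0])
          \<comment> \<open>The first threshold below the distance of \<open>x\<close> locates its
            annulus, which is \<open>R (m - 1)\<close>; since \<open>x\<close> is outside
            \<open>F n\<close>, its index is at least \<open>n\<close>.\<close>
          define m where "m = (LEAST m. 1 / real (m + 1) < infdist x C)"
          have m: "1 / real (m + 1) < infdist x C"
            unfolding m_def by (rule LeastI_ex[OF ex])
          have "n < m"
          proof (rule ccontr)
            assume "\<not> n < m"
            then have "1 / real (n + 1) \<le> 1 / real (m + 1)" by (intro frac_le) auto
            then show False using nF m x by (auto simp: F_def)
          qed
          then have "\<not> 1 / real ((m - 1) + 1) < infdist x C"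
            unfolding m_def by (intro not_less_Least) auto
          then have "x \<in> R ((m - 1 - n) + n)"
            using \<open>n < m\<close> m x by (auto simp: R_def)
          then show ?thesis by blast
        qed auto
      qed
      then have "?H (E - C) \<le> ?H (F n) + ?H (\<Union>k. R (k + n))"
        using hausdorff_outer_mono hausdorff_outer_Un_le order_trans by blast
      also have "\<dots> \<le> ?H (F n) + (\<Sum>k. ?H (R (k + n)))"
        by (intro add_left_mono hausdorff_outer_le_suminf) auto
      finally have "?H (C \<inter> E) + ?H (E - C) \<le> ?H (C \<inter> E) + ?H (F n) + (\<Sum>k. ?H (R (k + n)))"
        by (simp add: add.assoc add_left_mono)
      also have "\<dots> \<le> ?H E + (\<Sum>k. ?H (R (k + n)))"
        by (intro add_right_mono sepF)
      finally show ?thesis .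
    qed
    have "(\<lambda>n. ?H E + (\<Sum>k. ?H (R (k + n)))) \<longlonglongrightarrow> ?H E + 0"
      by (intro tendsto_add tail) auto
    then show ?thesis
      using bound by (intro LIMSEQ_le_const[of _ "?H E"]) auto
  qed simp
  have "?H (C \<inter> E) + ?H ((UNIV - C) \<inter> E) = ?H E" for E
  proof (rule antisym)
    have "(UNIV - C) \<inter> E = E - C" by auto
    then show "?H (C \<inter> E) + ?H ((UNIV - C) \<inter> E) \<le> ?H E"
      using main by simp
    have "E = (C \<inter> E) \<union> ((UNIV - C) \<inter> E)" by auto
    then show "?H E \<le> ?H (C \<inter> E) + ?H ((UNIV - C) \<inter> E)"
      using hausdorff_outer_Un_le by metis
  qed
  then show ?thesis
    by (auto simp: sets_hausdorff_measure lambda_system_def)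
qed simp

lemma sets_borel_subset_hausdorff_measure:
  "sets (borel :: 'a::metric_space measure) \<subseteq> sets (hausdorff_measure k)"
proof -
  have "sets (borel :: 'a measure) = sigma_sets UNIV (Collect closed)"
    unfolding borel_eq_closed by simp
  also have "\<dots> \<subseteq> sets (hausdorff_measure k)"
    using closed_in_sets_hausdorff_measure
    by (intro sets.sigma_sets_subset[of _ "hausdorff_measure k", simplified]) auto
  finally show ?thesis .
qed

lemma measurable_hausdorff_measure_borel:
  assumes "f \<in> measurable borel N"
  shows "f \<in> measurable (hausdorff_measure k) N"
  using assms sets_borel_subset_hausdorff_measure[of k, where ?'a='a]
  by (auto simp: measurable_def)

text \<open>Translating a cover changes neither boundedness nor diameters. The reverse inequality is
  the same statement for \<open>- v\<close>.\<close>

lemma hausdorff_outer_translation_le: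
  fixes A :: "'a::real_normed_vector set"
  shows "hausdorff_outer k ((+) v ` A) \<le> hausdorff_outer k A"
  unfolding hausdorff_outer_def
proof (rule SUP_mono)
  fix \<delta> :: real assume \<delta>: "\<delta> \<in> {0<..}"
  have w: "hausdorff_weight k \<delta> ((+) v ` C) = hausdorff_weight k \<delta> C" for C :: "'a set"
  proof -
    have "bounded ((+) v ` C) \<longleftrightarrow> bounded C"
      using bounded_translation[of C v] bounded_translation[of "(+) v ` C" "- v"]
      by (auto simp: image_image)
    moreover have "diameter ((+) v ` C) = diameter C"
    proof -
      have "(\<lambda>(x, y). dist x y) ` ((+) v ` C \<times> (+) v ` C) = (\<lambda>(x, y). dist x y) ` (C \<times> C)"
        unfolding map_prod_image[of "(+) v" "(+) v" C C, symmetric]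
        by (simp only: image_image) (simp add: split_beta)
      then show ?thesis
        by (simp add: diameter_def)
    qed
    ultimately show ?thesis
      by (simp add: hausdorff_weight_def)
  qed
  have "outer_measure UNIV (hausdorff_weight k \<delta>) ((+) v ` A) \<le> outer_measure UNIV (hausdorff_weight k \<delta>) A"
    unfolding outer_measure_def[of _ _ A]
  proof (rule INF_greatest)
    fix C :: "nat \<Rightarrow> 'a set"
    assume "C \<in> {C. range C \<subseteq> UNIV \<and> disjoint_family C \<and> A \<subseteq> (\<Union>i. C i)}"
    then have "(+) v ` A \<subseteq> (\<Union>i. (+) v ` C i)"
      unfolding image_UN[symmetric] by (intro image_mono) simp
    from outer_measure_hausdorff_weight_le[OF this, of k \<delta>]
    show "outer_measure UNIV (hausdorff_weight k \<delta>) ((+) v ` A) \<le> (\<Sum>i. hausdorff_weight k \<delta> (C i))"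
      by (simp only: w)
  qed
  then show "\<exists>\<epsilon>\<in>{0<..}. outer_measure UNIV (hausdorff_weight k \<delta>) ((+) v ` A)
      \<le> outer_measure UNIV (hausdorff_weight k \<epsilon>) A"
    using \<delta> by blast
qed

section \<open>Eilenberg's inequality\<close>

text \<open>Cubes are essential: for a cube the power \<open>DIM('a)\<close> of the diameter is a
  fixed multiple of the volume, whereas thin boxes have large diameter and little volume. The cubes
  come from dyadic subdivision and do not overlap, so their total volume is at most that of an open
  set slightly larger than \<open>A\<close>.\<close>

lemma cube_cover:
  fixes A :: "'a::euclidean_space set"
  assumes A: "A \<in> sets borel" "bounded A" and "\<delta> > 0" "\<epsilon> > 0"
  obtains C :: "nat \<Rightarrow> 'a set" where "A \<subseteq> (\<Union>i. C i)"
    "\<And>i. C i = {} \<or> (\<exists>u h. h > 0 \<and> C i = cbox u (u + h *\<^sub>R One) \<and> diameter (C i) \<le> \<delta>)"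
    "(\<Sum>i. emeasure lborel (C i)) \<le> emeasure lborel A + ennreal \<epsilon>"
proof -
  obtain U where U: "open U" "A \<subseteq> U" "emeasure lborel (U - A) < \<epsilon>"
    using outer_regular_lborel[OF A(1) \<open>\<epsilon> > 0\<close>] by auto
  obtain R where R: "R > 0" "\<And>x. x \<in> A \<Longrightarrow> norm x \<le> R"
    using A(2) unfolding bounded_pos by blast
  \<comment> \<open>The ball bounds the diameters by \<delta>, and \<open>U\<close> keeps the cubes
    inside the open superset. A gauge must be open around every point, hence \<open>UNIV\<close> for
    points outside \<open>U\<close>.\<close>
  let ?g = "\<lambda>x. ball x (\<delta> / 2) \<inter> (if x \<in> U then U else UNIV)"
  have "A \<subseteq> cbox (- R *\<^sub>R One) (R *\<^sub>R One)"
  proof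
    fix x assume "x \<in> A"
    then have "\<bar>x \<bullet> i\<bar> \<le> R" if "i \<in> Basis" for i
      using R(2)[of x] Basis_le_norm[OF that, of x] by linarith
    then show "x \<in> cbox (- R *\<^sub>R One) (R *\<^sub>R One)"
      by (auto simp: mem_box abs_le_iff minus_le_iff)
  qed
  moreover have "box (- R *\<^sub>R One) (R *\<^sub>R One :: 'a) \<noteq> {}"
    using R(1) by (auto simp: box_ne_empty)
  moreover have "gauge ?g"
    using \<open>\<delta> > 0\<close> U(1) by (auto simp: gauge_def)
  ultimately obtain \<D> where D: "countable \<D>" "\<Union>\<D> \<subseteq> cbox (- R *\<^sub>R One) (R *\<^sub>R One)"
      "\<And>K. K \<in> \<D> \<Longrightarrow> interior K \<noteq> {} \<and> (\<exists>c d. K = cbox c d)"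
      "pairwise (\<lambda>A B. interior A \<inter> interior B = {}) \<D>"
      "\<And>K. K \<in> \<D> \<Longrightarrow> \<exists>x \<in> A \<inter> K. K \<subseteq> ?g x"
      "\<And>u v. cbox u v \<in> \<D> \<Longrightarrow> \<exists>n. \<forall>i \<in> Basis. v \<bullet> i - u \<bullet> i = (R *\<^sub>R One \<bullet> i - (- R *\<^sub>R One) \<bullet> i) / 2^n"
      "A \<subseteq> \<Union>\<D>"
    by (rule covering_lemma) (rule that)
  \<comment> \<open>The family may be finite, so the enumeration is padded with the empty
    set.\<close>
  define C where "C i = (if i \<in> to_nat_on \<D> ` \<D> then from_nat_into \<D> i else {})" for i
  have C_to_nat: "C (to_nat_on \<D> K) = K" if "K \<in> \<D>" for K
    using that D(1) unfolding C_def by simp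
  have C_cases: "\<exists>K\<in>\<D>. i = to_nat_on \<D> K" if "C i \<noteq> {}" for i
    using that unfolding C_def by (metis imageE)
  have C_D: "C i \<in> \<D>" if "C i \<noteq> {}" for i
    using C_cases[OF that] C_to_nat by metis
  have "K \<in> range C" if "K \<in> \<D>" for K
    using C_to_nat[OF that] by (metis rangeI)
  then have cover: "A \<subseteq> (\<Union>i. C i)"
    using D(7) by (metis Union_mono subsetI subset_trans)
  have cube: "\<exists>u h. h > 0 \<and> C i = cbox u (u + h *\<^sub>R One) \<and> diameter (C i) \<le> \<delta>" if ne: "C i \<noteq> {}" for i
  proof -
    obtain u v where uv: "C i = cbox u v"
      using D(3)[OF C_D[OF ne]] by auto
    obtain n where n: "\<And>j. j \<in> Basis \<Longrightarrow> v \<bullet> j - u \<bullet> j = (R *\<^sub>R One \<bullet> j - (- R *\<^sub>R One) \<bullet> j) / 2^n"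
      using D(6) C_D[OF ne] uv by metis
    have "v = u + (2 * R / 2 ^ n) *\<^sub>R One"
      by (rule euclidean_eqI) (use n in \<open>auto simp: algebra_simps\<close>)
    moreover obtain x where "C i \<subseteq> ball x (\<delta> / 2)"
      using D(5)[OF C_D[OF ne]] by auto
    then have "diameter (C i) \<le> diameter (ball x (\<delta> / 2))"
      by (intro diameter_subset) auto
    then have "diameter (C i) \<le> \<delta>"
      using \<open>\<delta> > 0\<close> by simp
    ultimately show ?thesis
      using R(1) uv by (intro exI[of _ u] exI[of _ "2 * R / 2 ^ n"]) auto
  qed
  \<comment> \<open>Faces have volume zero, and unlike the cubes their interiors are disjoint, so
    countable additivity applies to the interiors.\<close>
  have "C i = cbox c d \<Longrightarrow> emeasure lborel (C i) = emeasure lborel (interior (C i))" for c d i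
    by (simp add: emeasure_lborel_cbox_eq emeasure_lborel_box_eq)
  then have "emeasure lborel (C i) = emeasure lborel (interior (C i))" for i
    using cube[of i] by (cases "C i = {}") auto
  then have "(\<Sum>i. emeasure lborel (C i)) = (\<Sum>i. emeasure lborel (interior (C i)))"
    by simp
  also have "\<dots> = emeasure lborel (\<Union>i. interior (C i))"
  proof (rule suminf_emeasure)
    have "interior (C i) \<inter> interior (C j) = {}" if "i \<noteq> j" for i j
    proof (cases "C i = {} \<or> C j = {}")
      case False
      then have "C i \<noteq> C j"
        using that C_cases C_to_nat by metis
      with False show ?thesis
        using D(4) C_D by (simp add: pairwise_def)
    qed auto
    then show "disjoint_family (\<lambda>i. interior (C i))"
      by (auto simp: disjoint_family_on_def)
  qed auto
  also have "\<dots> \<le> emeasure lborel U"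
  proof (rule emeasure_mono)
    have "C i \<subseteq> U" for i
    proof (cases "C i = {}")
      case False
      then obtain x where "x \<in> A" "C i \<subseteq> ?g x"
        using D(5)[OF C_D] by blast
      then show ?thesis using U(2) by (auto split: if_splits)
    qed auto
    then show "(\<Union>i. interior (C i)) \<subseteq> U"
      using interior_subset by blast
  qed (use U in auto)
  also have "\<dots> = emeasure lborel A + emeasure lborel (U - A)"
    using U A(1) by (subst plus_emeasure) (auto intro!: arg_cong[where f="emeasure lborel"])
  also have "\<dots> \<le> emeasure lborel A + ennreal \<epsilon>"
    using U(3) by (intro add_left_mono) auto
  finally show ?thesis
    using that cover cube by metis
qed

text \<open>Eilenberg's inequality: the level sets are covered by the cubes of a cover of \<open>A\<close>, and a cube
  \<open>K\<close> meets the level \<open>s\<close> only for \<open>s\<close> in an interval of length at most \<open>2 * M * diameter K\<close>.\<close>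

lemma eilenberg_inequality:
  fixes \<psi> :: "'a::euclidean_space \<Rightarrow> real"
  assumes lip: "M-lipschitz_on UNIV \<psi>"
  shows "\<exists>c\<ge>0. \<forall>A\<in>sets borel. bounded A \<longrightarrow>
    (\<integral>\<^sup>+s. hausdorff_outer (DIM('a) - 1) (A \<inter> \<psi> -` {s}) \<partial>lborel) \<le> ennreal c * emeasure lborel A"
proof -
  let ?k = "DIM('a) - 1"
  define D0 where "D0 = norm (One :: 'a)"
  \<comment> \<open>A cube of edge \<open>h\<close> has diameter \<open>h * D0\<close>. Its weight
    contains \<open>h ^ (DIM('a) - 1)\<close> and the interval of levels it may meet has length
    \<open>2 * M * (h * D0)\<close>; the product is \<open>c\<close> times the volume
    \<open>h ^ DIM('a)\<close>.\<close>
  define c where "c = unit_ball_vol (real ?k) * (D0 / 2) ^ ?k * (2 * M * D0)"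
  have M: "M \<ge> 0" using lip by (rule lipschitz_on_nonneg)
  have D0: "D0 \<ge> 0" by (simp add: D0_def)
  have c: "c \<ge> 0" using M D0 by (simp add: c_def)
  have bound: "(\<integral>\<^sup>+s. hausdorff_outer ?k (A \<inter> \<psi> -` {s}) \<partial>lborel) \<le> ennreal c * emeasure lborel A"
    if A: "A \<in> sets borel" "bounded A" for A
  proof -
    let ?cubes = "\<lambda>n (C :: nat \<Rightarrow> 'a set). A \<subseteq> (\<Union>i. C i) \<and>
      (\<forall>i. C i = {} \<or> (\<exists>u h. h > 0 \<and> C i = cbox u (u + h *\<^sub>R One) \<and> diameter (C i) \<le> 1 / real (Suc n))) \<and>
      (\<Sum>i. emeasure lborel (C i)) \<le> emeasure lborel A + ennreal (1 / real (Suc n))"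
    have "\<exists>C. ?cubes n C" for n
    proof -
      have p: "1 / real (Suc n) > 0" by simp
      show ?thesis
        by (rule cube_cover[OF A p p]) blast
    qed
    then obtain C :: "nat \<Rightarrow> nat \<Rightarrow> 'a set" where cover: "\<And>n. A \<subseteq> (\<Union>i. C n i)"
      and cube: "\<And>n i. C n i = {} \<or> (\<exists>u h. h > 0 \<and> C n i = cbox u (u + h *\<^sub>R One) \<and> diameter (C n i) \<le> 1 / real (Suc n))"
      and total: "\<And>n. (\<Sum>i. emeasure lborel (C n i)) \<le> emeasure lborel A + ennreal (1 / real (Suc n))"
      by metis
    let ?w = "\<lambda>n i. hausdorff_weight ?k (1 / real (Suc n)) (C n i)"
    define p where "p n i = (SOME x. x \<in> C n i)" for n i
    define J where "J n i = {\<psi> (p n i) - M * diameter (C n i) .. \<psi> (p n i) + M * diameter (C n i)}" for n i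
    \<comment> \<open>The measure of a level set is not known to be measurable in \<open>s\<close>.
      Each \<open>G n\<close> is a measurable majorant of the premeasure at scale
      \<open>1 / (n + 1)\<close>, so Fatou's lemma is applied to \<open>G n\<close> and the level
      sets enter only through monotonicity.\<close>
    define G where "G n s = (\<Sum>i. ?w n i * indicator (J n i) s)" for n s
    have bnd: "bounded (C n i)" for n i
      using cube[of n i] by auto
    have inJ: "\<psi> x \<in> J n i" if "x \<in> C n i" for x n i
    proof -
      have "p n i \<in> C n i" unfolding p_def using that by (rule someI)
      then have "dist (p n i) x \<le> diameter (C n i)"
        using that bnd by (simp add: diameter_bounded_bound)
      moreover have "dist (\<psi> (p n i)) (\<psi> x) \<le> M * dist (p n i) x"
        by (rule lipschitz_onD[OF lip]) auto
      ultimately have "dist (\<psi> (p n i)) (\<psi> x) \<le> M * diameter (C n i)"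
        using M by (meson mult_left_mono order_trans)
      then show ?thesis by (auto simp: J_def dist_real_def)
    qed
    have G_upper: "outer_measure UNIV (hausdorff_weight ?k (1 / real (Suc n))) (A \<inter> \<psi> -` {s}) \<le> G n s" for n s
    proof -
      have "A \<inter> \<psi> -` {s} \<subseteq> (\<Union>i. if s \<in> J n i then C n i else {})"
        using cover[of n] inJ[of _ n] by (auto split: if_splits) blast
      from outer_measure_hausdorff_weight_le[OF this, of ?k "1 / real (Suc n)"]
      show ?thesis
        unfolding G_def by (rule order_trans) (auto intro!: suminf_le)
    qed
    have cube_weight: "?w n i * emeasure lborel (J n i) \<le> ennreal c * emeasure lborel (C n i)" for n i
    proof (cases "C n i = {}")
      case False
      then obtain u h where h: "h > 0" "C n i = cbox u (u + h *\<^sub>R One)" "diameter (C n i) \<le> 1 / real (Suc n)"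
        using cube[of n i] by blast
      have diam: "diameter (C n i) = h * D0"
        using h(1) unfolding h(2) by (subst diameter_cbox) (auto simp: D0_def dist_norm algebra_simps)
      have "emeasure lborel (C n i) = ennreal (h ^ DIM('a))"
        using h(1) unfolding h(2) by (subst emeasure_lborel_cbox) (auto simp: algebra_simps)
      moreover have "?w n i = ennreal (unit_ball_vol (real ?k) * (h * D0 / 2) ^ ?k)"
        using False bnd h(3) by (simp add: hausdorff_weight_def diam)
      moreover have "emeasure lborel (J n i) = ennreal (2 * M * (h * D0))"
        using M h(1) D0 unfolding J_def diam by (subst emeasure_lborel_Icc) (auto simp: algebra_simps)
      moreover have "unit_ball_vol (real ?k) * (h * D0 / 2) ^ ?k * (2 * M * (h * D0)) = c * h ^ DIM('a)"
      proof -
        have "h ^ DIM('a) = h ^ ?k * h"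
          by (metis DIM_positive Suc_diff_1 power_Suc2)
        then show ?thesis
          by (simp add: c_def power_mult_distrib power_divide)
      qed
      ultimately show ?thesis
        using M h(1) D0 c by (simp add: ennreal_mult[symmetric])
    qed simp
    have "(\<integral>\<^sup>+s. G n s \<partial>lborel) \<le> ennreal c * (emeasure lborel A + ennreal (1 / real (Suc n)))" for n
    proof -
      have "(\<integral>\<^sup>+s. G n s \<partial>lborel) = (\<Sum>i. \<integral>\<^sup>+s. ?w n i * indicator (J n i) s \<partial>lborel)"
        unfolding G_def by (intro nn_integral_suminf) (auto simp: J_def)
      also have "\<dots> = (\<Sum>i. ?w n i * emeasure lborel (J n i))"
        by (intro suminf_cong nn_integral_cmult_indicator) (auto simp: J_def)
      also have "\<dots> \<le> (\<Sum>i. ennreal c * emeasure lborel (C n i))"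
        by (intro suminf_le cube_weight) auto
      also have "\<dots> \<le> ennreal c * (emeasure lborel A + ennreal (1 / real (Suc n)))"
        unfolding ennreal_suminf_cmult by (intro mult_left_mono total) auto
      finally show ?thesis .
    qed
    then have G_int: "liminf (\<lambda>n. \<integral>\<^sup>+s. G n s \<partial>lborel)
        \<le> liminf (\<lambda>n. ennreal c * (emeasure lborel A + ennreal (1 / real (Suc n))))"
      by (intro Liminf_mono) auto
    have "(\<lambda>n. ennreal (1 / real (Suc n))) \<longlonglongrightarrow> ennreal 0"
      using LIMSEQ_inverse_real_of_nat by (intro tendsto_ennrealI) (simp add: inverse_eq_divide)
    then have "(\<lambda>n. ennreal c * (emeasure lborel A + ennreal (1 / real (Suc n))))
        \<longlonglongrightarrow> ennreal c * (emeasure lborel A + ennreal 0)"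
      by (intro ennreal_tendsto_cmult tendsto_add tendsto_const) simp_all
    then have lim: "liminf (\<lambda>n. ennreal c * (emeasure lborel A + ennreal (1 / real (Suc n)))) = ennreal c * emeasure lborel A"
      by (subst lim_imp_Liminf) auto
    have "hausdorff_outer ?k (A \<inter> \<psi> -` {s}) \<le> liminf (\<lambda>n. G n s)" for s
    proof -
      have "(\<lambda>n. outer_measure UNIV (hausdorff_weight ?k (1 / real (Suc n))) (A \<inter> \<psi> -` {s}))
          \<longlonglongrightarrow> hausdorff_outer ?k (A \<inter> \<psi> -` {s})"
        unfolding hausdorff_outer_eq_SUP by (intro LIMSEQ_SUP incseq_hausdorff_premeasure)
      then have "hausdorff_outer ?k (A \<inter> \<psi> -` {s})
          = liminf (\<lambda>n. outer_measure UNIV (hausdorff_weight ?k (1 / real (Suc n))) (A \<inter> \<psi> -` {s}))"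
        by (simp add: lim_imp_Liminf)
      also have "\<dots> \<le> liminf (\<lambda>n. G n s)"
        by (intro Liminf_mono always_eventually allI G_upper)
      finally show ?thesis .
    qed
    then have "(\<integral>\<^sup>+s. hausdorff_outer ?k (A \<inter> \<psi> -` {s}) \<partial>lborel) \<le> (\<integral>\<^sup>+s. liminf (\<lambda>n. G n s) \<partial>lborel)"
      by (intro nn_integral_mono) auto
    also have "\<dots> \<le> liminf (\<lambda>n. \<integral>\<^sup>+s. G n s \<partial>lborel)"
      unfolding G_def by (intro nn_integral_liminf) (auto simp: J_def)
    also have "\<dots> \<le> ennreal c * emeasure lborel A"
      using G_int lim by simp
    finally show ?thesis .
  qed
  show ?thesis
    by (intro exI[of _ c] conjI ballI impI c bound)
qed

section \<open>Smooth functions\<close>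

lemma frechet_derivative_eq:
  assumes "(f has_derivative f') (at x)"
  shows "frechet_derivative f (at x) = f'"
  using frechet_derivative_at[OF assms] by simp

lemma times_differentiable_SucD: "times_differentiable (Suc k) f \<Longrightarrow> times_differentiable k f"
proof (induction k arbitrary: f)
  case 0
  then show ?case
    by (auto intro!: continuous_at_imp_continuous_on differentiable_imp_continuous_within)
next
  case (Suc k)
  then show ?case by (metis times_differentiable.simps(2))
qed

lemma times_differentiable_const: "times_differentiable k (\<lambda>x. c)"
  by (induction k arbitrary: c) auto

lemma times_differentiable_add:
  "times_differentiable k f \<Longrightarrow> times_differentiable k g \<Longrightarrow> times_differentiable k (\<lambda>x. f x + g x)"
proof (induction k arbitrary: f g)
  case 0
  then show ?case by (auto intro: continuous_intros)
next
  case (Suc k)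
  have diff: "f differentiable (at x)" "g differentiable (at x)" for x
    using Suc.prems by auto
  then have "(f has_derivative frechet_derivative f (at x)) (at x)"
    "(g has_derivative frechet_derivative g (at x)) (at x)" for x
    using frechet_derivative_works by blast+
  note frechet_derivative_eq[OF has_derivative_add[OF this]]
  then show ?case
    using Suc diff by (auto intro: differentiable_add)
qed

lemma times_differentiable_mult:
  "times_differentiable k f \<Longrightarrow> times_differentiable k g \<Longrightarrow> times_differentiable k (\<lambda>x. f x * g x)"
proof (induction k arbitrary: f g)
  case 0
  then show ?case by (auto intro: continuous_intros)
next
  case (Suc k)
  have diff: "f differentiable (at x)" "g differentiable (at x)" for x
    using Suc.prems by auto
  then have "(f has_derivative frechet_derivative f (at x)) (at x)"
    "(g has_derivative frechet_derivative g (at x)) (at x)" for x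
    using frechet_derivative_works by blast+
  note frechet_derivative_eq[OF has_derivative_mult[OF this]]
  moreover have "times_differentiable k f" "times_differentiable k g"
    using Suc.prems by (blast intro: times_differentiable_SucD)+
  ultimately show ?case
    using Suc diff by (auto intro!: differentiable_mult times_differentiable_add)
qed

text \<open>\<open>h\<close> is a whole chain of successive derivatives, because the derivative of
  \<open>h n\<close> after \<phi> involves \<open>h (Suc n)\<close>; the induction on
  \<open>k\<close> has to cover all \<open>n\<close> at once.\<close>

lemma times_differentiable_compose:
  fixes h :: "nat \<Rightarrow> real \<Rightarrow> real"
  assumes h: "\<And>n s. (h n has_real_derivative h (Suc n) s) (at s)"
    and \<phi>: "times_differentiable k \<phi>"
  shows "times_differentiable k (\<lambda>x. h n (\<phi> x))"
  using \<phi>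
proof (induction k arbitrary: n)
  case 0
  have "continuous_on UNIV (h n)"
    using h DERIV_isCont continuous_at_imp_continuous_on by blast
  then show ?case
    using 0 by (auto intro: continuous_on_compose2)
next
  case (Suc k)
  have der: "((\<lambda>x. h n (\<phi> x)) has_derivative (\<lambda>v. h (Suc n) (\<phi> x) * frechet_derivative \<phi> (at x) v)) (at x)" for x
  proof -
    have "(\<phi> has_derivative frechet_derivative \<phi> (at x)) (at x)"
      using Suc.prems frechet_derivative_works by auto
    then show ?thesis
      using has_derivative_compose h[unfolded has_field_derivative_def] by blast
  qed
  have "times_differentiable k \<phi>"
    using Suc.prems by (rule times_differentiable_SucD)
  then show ?case
    using Suc der by (auto simp: frechet_derivative_eq[OF der] differentiable_def intro!: times_differentiable_mult)
qed

lemma smooth_const [simp]: "smooth (\<lambda>x. c)"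
  by (simp add: smooth_def times_differentiable_const)

lemma smooth_add: "smooth f \<Longrightarrow> smooth g \<Longrightarrow> smooth (\<lambda>x. f x + g x)"
  by (simp add: smooth_def times_differentiable_add)

lemma smooth_mult: "smooth f \<Longrightarrow> smooth g \<Longrightarrow> smooth (\<lambda>x. f x * g x)"
  by (simp add: smooth_def times_differentiable_mult)

lemma smooth_diff: "smooth f \<Longrightarrow> smooth g \<Longrightarrow> smooth (\<lambda>x. f x - g x)"
  using smooth_add[of f "\<lambda>x. - 1 * g x"] smooth_mult[of "\<lambda>x. - 1" g] by simp

lemma smooth_prod: "(\<And>i. i \<in> I \<Longrightarrow> smooth (f i)) \<Longrightarrow> smooth (\<lambda>x. \<Prod>i\<in>I. f i x)"
  by (induction I rule: infinite_finite_induct) (auto intro: smooth_mult)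

lemma smooth_compose:
  assumes "\<And>n s. (h n has_real_derivative h (Suc n) s) (at s)" "smooth \<phi>"
  shows "smooth (\<lambda>x. h n (\<phi> x))"
  using assms by (auto simp: smooth_def intro: times_differentiable_compose)

lemma smooth_inner_const: "smooth (\<lambda>x. x \<bullet> c)"
proof -
  have "((\<lambda>x. x \<bullet> c) has_derivative (\<lambda>v. v \<bullet> c)) (at x)" for x :: 'a
    by (rule has_derivative_inner_left) (rule has_derivative_ident)
  then have "frechet_derivative (\<lambda>x. x \<bullet> c) (at x) = (\<lambda>v. v \<bullet> c)" and "(\<lambda>x. x \<bullet> c) differentiable (at x)" for x :: 'a
    by (auto intro: frechet_derivative_eq differentiableI)
  then have "times_differentiable k (\<lambda>x::'a. x \<bullet> c)" for k
    by (cases k) (auto intro: continuous_intros times_differentiable_const)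
  then show ?thesis by (simp add: smooth_def)
qed

section \<open>Derivatives and gradients of smooth functions\<close>

lemma smooth_has_derivative:
  assumes "smooth f"
  shows "(f has_derivative frechet_derivative f (at x)) (at x)"
  using assms frechet_derivative_works times_differentiable.simps(2)[of 0 f] unfolding smooth_def by metis

lemma smooth_partial:
  assumes "smooth f" "i \<in> Basis"
  shows "smooth (\<lambda>x. frechet_derivative f (at x) i)"
  using assms unfolding smooth_def by (metis times_differentiable.simps(2))

lemma smooth_continuous_on: "smooth f \<Longrightarrow> continuous_on S f"
  unfolding smooth_def by (metis times_differentiable.simps(1) continuous_on_subset subset_UNIV)

lemma smooth_borel_measurable: "smooth f \<Longrightarrow> f \<in> borel_measurable borel"
  by (intro borel_measurable_continuous_onI smooth_continuous_on)

lemma gradient_inner: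
  assumes "smooth f"
  shows "gradient f x \<bullet> v = frechet_derivative f (at x) v"
proof -
  interpret bounded_linear "frechet_derivative f (at x)"
    using smooth_has_derivative[OF assms] has_derivative_bounded_linear by blast
  have "frechet_derivative f (at x) v = frechet_derivative f (at x) (\<Sum>i\<in>Basis. (v \<bullet> i) *\<^sub>R i)"
    by (simp add: euclidean_representation)
  also have "\<dots> = gradient f x \<bullet> v"
    by (simp add: sum scaleR gradient_def inner_sum_left inner_commute[of v] mult.commute)
  finally show ?thesis by simp
qed

lemma gradient_has_derivative:
  assumes "smooth f"
  shows "(f has_derivative (\<lambda>v. gradient f x \<bullet> v)) (at x)"
  using smooth_has_derivative[OF assms] by (simp add: gradient_inner[OF assms] eta_contract_eq)

lemma gradient_eqI:
  assumes "(f has_derivative (\<lambda>v. w \<bullet> v)) (at x)"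
  shows "gradient f x = w"
  by (simp add: gradient_def frechet_derivative_eq[OF assms] euclidean_representation)

lemma continuous_on_gradient: "smooth f \<Longrightarrow> continuous_on S (gradient f)"
  unfolding gradient_def
  by (intro continuous_intros smooth_continuous_on smooth_partial)

lemma borel_measurable_gradient: "smooth f \<Longrightarrow> gradient f \<in> borel_measurable borel"
  by (intro borel_measurable_continuous_onI continuous_on_gradient)

lemma gradient_const: "gradient (\<lambda>x. c) x = 0"
  by (rule gradient_eqI) (auto intro!: derivative_eq_intros)

lemma gradient_diff:
  assumes "smooth f" "smooth g"
  shows "gradient (\<lambda>x. f x - g x) x = gradient f x - gradient g x"
  by (rule gradient_eqI) (auto simp: inner_diff_left intro: has_derivative_diff gradient_has_derivative assms)

lemma gradient_compose:
  assumes "(h has_real_derivative h') (at (\<phi> x))" "smooth \<phi>"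
  shows "gradient (\<lambda>x. h (\<phi> x)) x = h' *\<^sub>R gradient \<phi> x"
  using has_derivative_compose[OF gradient_has_derivative[OF assms(2)] assms(1)[unfolded has_field_derivative_def]]
  by (intro gradient_eqI) simp

lemma smooth_has_real_derivative_line:
  assumes "smooth f"
  shows "((\<lambda>t. f (x + t *\<^sub>R v)) has_real_derivative gradient f (x + t *\<^sub>R v) \<bullet> v) (at t)"
proof -
  have "((\<lambda>t. x + t *\<^sub>R v) has_derivative (\<lambda>h. h *\<^sub>R v)) (at t)"
    by (auto intro!: derivative_eq_intros)
  from has_derivative_compose[OF this gradient_has_derivative[OF assms]]
  show ?thesis
    by (simp add: has_field_derivative_def mult_commute_abs)
qed

text \<open>The functions \<open>p(1/s) exp(- \<epsilon>/s)\<close>, extended by zero, form a class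
  closed under differentiation. With \<open>p = 1\<close> this is the classical smooth function that
  is flat at the origin; it serves both for bump functions and for positive parts.\<close>

definition flat :: "real \<Rightarrow> real poly \<Rightarrow> real \<Rightarrow> real" where
  "flat \<epsilon> p s = (if s > 0 then poly p (1 / s) * exp (- \<epsilon> / s) else 0)"

text \<open>Each factor \<open>y\<close> is absorbed by one half of the exponential and the
  induction hypothesis is used with the other half, which is why \<epsilon> is arbitrary in the
  induction.\<close>

lemma poly_times_exp_tendsto_0:
  fixes \<epsilon> :: real
  assumes "\<epsilon> > 0"
  shows "((\<lambda>y. poly p y * exp (- \<epsilon> * y)) \<longlongrightarrow> 0) at_top"
  using assms
proof (induction p arbitrary: \<epsilon>)
  case (pCons a p)
  have scaled: "((\<lambda>y. (c * y) ^ k / exp (c * y)) \<longlongrightarrow> 0) at_top" if "c > 0" for c :: real and k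
    using that by (intro filterlim_compose[OF tendsto_power_div_exp_0]
        filterlim_tendsto_pos_mult_at_top[OF tendsto_const] filterlim_ident)
  have "((\<lambda>y. a * ((\<epsilon> * y) ^ 0 / exp (\<epsilon> * y))
      + 2 / \<epsilon> * ((\<epsilon> / 2 * y) ^ 1 / exp (\<epsilon> / 2 * y)) * (poly p y * exp (- (\<epsilon> / 2) * y))) \<longlongrightarrow> a * 0 + 2 / \<epsilon> * 0 * 0) at_top"
    by (intro tendsto_intros scaled pCons.IH) (use pCons.prems in auto)
  moreover have "a * ((\<epsilon> * y) ^ 0 / exp (\<epsilon> * y))
      + 2 / \<epsilon> * ((\<epsilon> / 2 * y) ^ 1 / exp (\<epsilon> / 2 * y)) * (poly p y * exp (- (\<epsilon> / 2) * y))
      = poly (pCons a p) y * exp (- \<epsilon> * y)" for y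
  proof -
    have "exp (- \<epsilon> * y) = exp (- (\<epsilon> / 2) * y) * exp (- (\<epsilon> / 2) * y)"
      by (simp flip: exp_add)
    then show ?thesis
      using pCons.prems by (simp add: exp_minus field_simps)
  qed
  ultimately show ?case by simp
qed simp

lemma flat_tendsto_0:
  assumes "\<epsilon> > 0"
  shows "(flat \<epsilon> p \<longlongrightarrow> 0) (at 0)"
proof -
  have "((\<lambda>s. poly p (inverse s) * exp (- \<epsilon> * inverse s)) \<longlongrightarrow> 0) (at_right 0)"
    by (rule filterlim_compose[OF poly_times_exp_tendsto_0[OF assms] filterlim_inverse_at_top_right])
  then have "(flat \<epsilon> p \<longlongrightarrow> 0) (at_right 0)"
    by (rule Lim_transform_eventually)
      (auto simp: flat_def field_simps eventually_at_filter)
  moreover have "(flat \<epsilon> p \<longlongrightarrow> 0) (at_left 0)"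
    by (rule tendsto_eventually) (auto simp: flat_def eventually_at_filter)
  ultimately show ?thesis
    by (simp add: filterlim_split_at)
qed

text \<open>Differentiating \<open>1/s\<close> and \<open>- \<epsilon>/s\<close> produces the common
  factor \<open>1/s^2\<close>, encoded by the polynomial \<open>[:0, 0, 1:]\<close> in the variable
  \<open>1/s\<close>.\<close>

lemma flat_has_real_derivative:
  assumes "\<epsilon> > 0"
  shows "(flat \<epsilon> p has_real_derivative flat \<epsilon> ([:0, 0, 1:] * (smult \<epsilon> p - pderiv p)) s) (at s)"
proof -
  consider "s < 0" | "s = 0" | "s > 0" by linarith
  then show ?thesis
  proof cases
    case 1
    have "((\<lambda>s. 0) has_real_derivative 0) (at s)" by simp
    then have "(flat \<epsilon> p has_real_derivative 0) (at s)"
      by (rule has_field_derivative_transform_within_open[of _ _ _ "{..<0}"]) (use 1 in \<open>auto simp: flat_def\<close>)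
    with 1 show ?thesis by (simp add: flat_def)
  next
    case 2
    \<comment> \<open>The difference quotient at the origin is again a flat function: dividing by
      \<open>h\<close> multiplies the polynomial by its variable.\<close>
    have "((\<lambda>h. flat \<epsilon> (pCons 0 p) h) \<longlongrightarrow> 0) (at 0)"
      by (rule flat_tendsto_0[OF assms])
    then have "((\<lambda>h. (flat \<epsilon> p (0 + h) - flat \<epsilon> p 0) / h) \<longlongrightarrow> 0) (at 0)"
      by (rule Lim_transform_eventually) (auto simp: flat_def)
    with 2 show ?thesis
      by (simp add: DERIV_def flat_def)
  next
    case 3
    have "((\<lambda>s. poly p (1 / s) * exp (- \<epsilon> / s)) has_real_derivative
        poly p (1 / s) * (exp (- \<epsilon> / s) * (\<epsilon> / s\<^sup>2)) + poly (pderiv p) (1 / s) * (- (1 / s\<^sup>2)) * exp (- \<epsilon> / s)) (at s)"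
      using 3 by (auto intro!: derivative_eq_intros DERIV_chain2[OF poly_DERIV] simp: power2_eq_square)
    then have "(flat \<epsilon> p has_real_derivative
        poly p (1 / s) * (exp (- \<epsilon> / s) * (\<epsilon> / s\<^sup>2)) + poly (pderiv p) (1 / s) * (- (1 / s\<^sup>2)) * exp (- \<epsilon> / s)) (at s)"
      by (rule has_field_derivative_transform_within_open[of _ _ _ "{0<..}"]) (use 3 in \<open>auto simp: flat_def\<close>)
    moreover have "poly p (1 / s) * (exp (- \<epsilon> / s) * (\<epsilon> / s\<^sup>2)) + poly (pderiv p) (1 / s) * (- (1 / s\<^sup>2)) * exp (- \<epsilon> / s)
        = flat \<epsilon> ([:0, 0, 1:] * (smult \<epsilon> p - pderiv p)) s"
      using 3 by (simp add: flat_def field_simps power2_eq_square)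
    ultimately show ?thesis by simp
  qed
qed

lemma smooth_flat:
  assumes "\<epsilon> > 0" "smooth \<phi>"
  shows "smooth (\<lambda>x. flat \<epsilon> p (\<phi> x))"
proof -
  define q where "q n = ((\<lambda>p. [:0, 0, 1:] * (smult \<epsilon> p - pderiv p)) ^^ n) p" for n
  have "(flat \<epsilon> (q n) has_real_derivative flat \<epsilon> (q (Suc n)) s) (at s)" for n s
    using flat_has_real_derivative[OF assms(1), of "q n" s] by (simp add: q_def)
  from smooth_compose[of "\<lambda>n. flat \<epsilon> (q n)", OF this assms(2), of 0]
  show ?thesis by (simp add: q_def)
qed

lemma flat_1_bounds: "\<epsilon> > 0 \<Longrightarrow> 0 \<le> flat \<epsilon> 1 s" "\<epsilon> > 0 \<Longrightarrow> flat \<epsilon> 1 s \<le> 1"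
  by (auto simp: flat_def)

lemma flat_1_tendsto: "(\<lambda>n. flat (1 / real (Suc n)) 1 s) \<longlonglongrightarrow> indicator {0<..} s"
proof (cases "s > 0")
  case True
  have "(\<lambda>n. exp (- (1 / real (Suc n)) / s)) \<longlonglongrightarrow> exp (- 0 / s)"
    using LIMSEQ_inverse_real_of_nat True by (intro tendsto_intros) (auto simp: inverse_eq_divide)
  then show ?thesis using True by (simp add: flat_def)
qed (simp add: flat_def)

section \<open>Weak gradients\<close>

lemma gradient_eq_0_outside:
  assumes "closed K" "\<And>x. x \<notin> K \<Longrightarrow> f x = 0" "x \<notin> K"
  shows "gradient f x = 0"
proof (rule gradient_eqI)
  have "((\<lambda>x. 0) has_derivative (\<lambda>v. 0 \<bullet> v)) (at x)" by simp
  then show "(f has_derivative (\<lambda>v. 0 \<bullet> v)) (at x)"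
    by (rule has_derivative_transform_within_open[of _ _ _ _ "- K"]) (use assms in auto)
qed

section \<open>Integration by parts against test functions\<close>

lemma integrable_lborel_compact_support:
  fixes f :: "'a::euclidean_space \<Rightarrow> real"
  assumes "continuous_on UNIV f" "compact K" "\<And>x. x \<notin> K \<Longrightarrow> f x = 0"
  shows "integrable lborel f"
proof -
  have "integrable lborel (\<lambda>x. indicator K x *\<^sub>R f x)"
    using assms by (intro borel_integrable_compact) (auto intro: continuous_on_subset)
  moreover have "(\<lambda>x. indicator K x *\<^sub>R f x) = f"
    using assms(3) by (auto simp: fun_eq_iff indicator_def)
  ultimately show ?thesis by simp
qed

lemma bounded_compact_support:
  fixes f :: "'a::euclidean_space \<Rightarrow> real"
  assumes "continuous_on UNIV f" "compact K" "\<And>x. x \<notin> K \<Longrightarrow> f x = 0"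
  obtains B where "B \<ge> 0" "\<And>x. \<bar>f x\<bar> \<le> B"
proof -
  have "bounded (f ` K)"
    using assms by (intro compact_imp_bounded compact_continuous_image) (auto intro: continuous_on_subset)
  then obtain B where B: "B > 0" "\<And>x. x \<in> K \<Longrightarrow> \<bar>f x\<bar> \<le> B"
    unfolding bounded_pos by auto
  have "\<bar>f x\<bar> \<le> B" for x
    using B assms(3)[of x] by (cases "x \<in> K") auto
  with B(1) show thesis by (intro that[of B]) auto
qed

text \<open>The translation invariance of Lebesgue measure makes the integrals of the difference quotients vanish.\<close>

lemma integral_directional_derivative_zero:
  fixes F :: "'a::euclidean_space \<Rightarrow> real"
  assumes F: "smooth F" and K: "compact K" and supp: "\<And>x. x \<notin> K \<Longrightarrow> F x = 0"
  shows "(\<integral>x. gradient F x \<bullet> e \<partial>lborel) = 0"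
proof -
  have grad0: "gradient F x \<bullet> e = 0" if "x \<notin> K" for x
    using gradient_eq_0_outside[OF compact_imp_closed[OF K] supp that] by simp
  have "continuous_on UNIV (\<lambda>x. gradient F x \<bullet> e)"
    using continuous_on_gradient[OF F] by (intro continuous_intros)
  then obtain B where B: "B \<ge> 0" "\<And>x. \<bar>gradient F x \<bullet> e\<bar> \<le> B"
    using K grad0 by (rule bounded_compact_support) (assumption, rule that)
  define t where "t n = 1 / real (Suc n)" for n
  have t: "0 < t n" "t n \<le> 1" for n
    by (auto simp: t_def)
  have t0: "filterlim t (at 0) sequentially"
    using LIMSEQ_inverse_real_of_nat unfolding filterlim_at t_def by (auto simp: inverse_eq_divide)
  define s where "s n x = (F (x + t n *\<^sub>R e) - F x) / t n" for n x
  \<comment> \<open>The steps \<open>t n\<close> lie between 0 and 1, so this compact set, swept out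
    by \<open>K\<close> moving along \<open>- e\<close>, contains the supports of all difference
    quotients; \<open>B\<close> on it is an integrable majorant.\<close>
  define K' where "K' = (\<lambda>(x, t). x - t *\<^sub>R e) ` (K \<times> {0..1})"
  have K': "compact K'"
    unfolding K'_def split_beta
    by (intro compact_continuous_image compact_Times K continuous_intros) auto
  have int_F: "integrable lborel F"
    using F K supp by (intro integrable_lborel_compact_support smooth_continuous_on)
  have trans_int: "integrable lborel (\<lambda>x. F (x + c))" and trans: "(\<integral>x. F (x + c) \<partial>lborel) = (\<integral>x. F x \<partial>lborel)" for c
  proof -
    have "integrable (distr lborel borel ((+) c)) F"
      by (simp add: lborel_distr_plus int_F)
    then show "integrable lborel (\<lambda>x. F (x + c))"
      by (subst (asm) integrable_distr_eq) (auto simp: smooth_borel_measurable[OF F] add.commute)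
    have "(\<integral>x. F x \<partial>distr lborel borel ((+) c)) = (\<integral>x. F (c + x) \<partial>lborel)"
      by (rule integral_distr) (auto simp: smooth_borel_measurable[OF F])
    then show "(\<integral>x. F (x + c) \<partial>lborel) = (\<integral>x. F x \<partial>lborel)"
      by (simp add: lborel_distr_plus add.commute)
  qed
  have line: "((\<lambda>t. F (x + t *\<^sub>R e)) has_real_derivative gradient F (x + t *\<^sub>R e) \<bullet> e) (at t)" for x t
    by (rule smooth_has_real_derivative_line[OF F])
  have "(\<integral>x. s n x \<partial>lborel) = 0" for n
    using trans_int int_F by (simp add: s_def trans)
  moreover have "(\<lambda>n. \<integral>x. s n x \<partial>lborel) \<longlonglongrightarrow> (\<integral>x. gradient F x \<bullet> e \<partial>lborel)"
  proof (rule integral_dominated_convergence)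
    show "(\<lambda>x. gradient F x \<bullet> e) \<in> borel_measurable lborel"
      using borel_measurable_gradient[OF F] by simp
    show "s n \<in> borel_measurable lborel" for n
      unfolding s_def using borel_measurable_integrable[OF trans_int[of "t n *\<^sub>R e"]]
        smooth_borel_measurable[OF F] by simp
    show "integrable lborel (\<lambda>x. indicator K' x *\<^sub>R B)"
      by (rule borel_integrable_compact[OF K']) simp
    show "AE x in lborel. (\<lambda>n. s n x) \<longlonglongrightarrow> gradient F x \<bullet> e"
    proof (rule AE_I2)
      fix x
      have "((\<lambda>h. (F (x + (0 + h) *\<^sub>R e) - F (x + 0 *\<^sub>R e)) / h) \<longlongrightarrow> gradient F (x + 0 *\<^sub>R e) \<bullet> e) (at 0)"
        using line[of x 0] by (simp only: DERIV_def)
      from filterlim_compose[OF this t0]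
      show "(\<lambda>n. s n x) \<longlonglongrightarrow> gradient F x \<bullet> e"
        by (simp add: s_def)
    qed
    show "AE x in lborel. norm (s n x) \<le> indicator K' x *\<^sub>R B" for n
    proof (rule AE_I2)
      fix x
      obtain z where "F (x + t n *\<^sub>R e) - F (x + 0 *\<^sub>R e) = (t n - 0) * (gradient F (x + z *\<^sub>R e) \<bullet> e)"
        using MVT2[OF t(1)[of n] line[of x]] by blast
      then have "\<bar>F (x + t n *\<^sub>R e) - F x\<bar> \<le> t n * B"
        using t(1)[of n] B(2)[of "x + z *\<^sub>R e"] by (simp add: abs_mult)
      then have "\<bar>s n x\<bar> \<le> B"
        using t(1)[of n] by (simp add: s_def field_simps)
      moreover have "s n x = 0" if "x \<notin> K'"
      proof -
        have "x \<notin> K"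
        proof
          assume "x \<in> K"
          then have "x \<in> K'"
            unfolding K'_def by (intro image_eqI[of _ _ "(x, 0)"]) auto
          with that show False by simp
        qed
        moreover have "x + t n *\<^sub>R e \<notin> K"
        proof
          assume "x + t n *\<^sub>R e \<in> K"
          then have "x \<in> K'"
            using t[of n] unfolding K'_def
            by (intro image_eqI[of _ _ "(x + t n *\<^sub>R e, t n)"]) auto
          with that show False by simp
        qed
        ultimately show ?thesis by (simp add: s_def supp)
      qed
      ultimately show "norm (s n x) \<le> indicator K' x *\<^sub>R B"
        using B(1) by (auto simp: indicator_def)
    qed
  qed
  ultimately show ?thesis
    by (simp add: LIMSEQ_const_iff)
qed

lemma integral_lebesgue_on_support:
  fixes f :: "'a::euclidean_space \<Rightarrow> real"
  assumes "f \<in> borel_measurable borel" "\<Omega> \<in> sets lebesgue" "\<And>x. x \<notin> \<Omega> \<Longrightarrow> f x = 0"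
  shows "(\<integral>x. f x \<partial>lebesgue_on \<Omega>) = (\<integral>x. f x \<partial>lborel)"
proof -
  have "(\<integral>x. f x \<partial>lebesgue_on \<Omega>) = (\<integral>x. indicator \<Omega> x *\<^sub>R f x \<partial>lebesgue)"
    using assms(2) by (intro integral_restrict_space) simp
  also have "(\<lambda>x. indicator \<Omega> x *\<^sub>R f x) = f"
    using assms(3) by (auto simp: fun_eq_iff indicator_def)
  also have "(\<integral>x. f x \<partial>lebesgue) = (\<integral>x. f x \<partial>lborel)"
    using assms(1) by (intro integral_completion) simp
  finally show ?thesis .
qed

lemma test_functionsD:
  assumes "\<phi> \<in> test_functions \<Omega>"
  obtains K where "smooth \<phi>" "compact K" "K \<subseteq> \<Omega>" "\<And>x. x \<notin> K \<Longrightarrow> \<phi> x = 0"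
  using assms closure_subset[of "{x. \<phi> x \<noteq> 0}"]
  by (intro that[of "closure {x. \<phi> x \<noteq> 0}"]) (auto simp: test_functions_def)

lemma test_function_bounds:
  assumes "\<phi> \<in> test_functions \<Omega>" "i \<in> Basis"
  obtains B where "B \<ge> 0" "\<And>x. \<bar>\<phi> x\<bar> \<le> B" "\<And>x. \<bar>frechet_derivative \<phi> (at x) i\<bar> \<le> B"
proof -
  obtain K where K: "smooth \<phi>" "compact K" "K \<subseteq> \<Omega>" "\<And>x. x \<notin> K \<Longrightarrow> \<phi> x = 0"
    using assms(1) by (rule test_functionsD) (rule that)
  obtain B1 where B1: "B1 \<ge> 0" "\<And>x. \<bar>\<phi> x\<bar> \<le> B1"
    using bounded_compact_support[OF smooth_continuous_on[OF K(1)] K(2,4)] by blast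
  have "frechet_derivative \<phi> (at x) i = 0" if "x \<notin> K" for x
    using gradient_eq_0_outside[OF compact_imp_closed[OF K(2)] K(4) that] gradient_inner[OF K(1), of x i] by simp
  then obtain B2 where B2: "B2 \<ge> 0" "\<And>x. \<bar>frechet_derivative \<phi> (at x) i\<bar> \<le> B2"
    using bounded_compact_support[OF smooth_continuous_on[OF smooth_partial[OF K(1) assms(2)]] K(2)] by blast
  show thesis
    using B1 B2 by (intro that[of "max B1 B2"]) (auto simp: le_max_iff_disj)
qed

text \<open>The product of \<psi> with a test function has compact support, so the integral of its
  partial derivative over the whole space vanishes; the product rule gives the identity.\<close>

lemma smooth_has_weak_gradient:
  fixes \<Omega> :: "'a::euclidean_space set"
  assumes \<psi>: "smooth \<psi>" and \<Omega>: "\<Omega> \<in> sets lebesgue"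
  shows "has_weak_gradient \<Omega> \<psi> (gradient \<psi>)"
  unfolding has_weak_gradient_def
proof (intro ballI)
  fix \<phi> and i :: 'a
  assume \<phi>: "\<phi> \<in> test_functions \<Omega>" and i: "i \<in> Basis"
  obtain K where K: "smooth \<phi>" "compact K" "K \<subseteq> \<Omega>" "\<And>x. x \<notin> K \<Longrightarrow> \<phi> x = 0"
    using \<phi> by (rule test_functionsD) (rule that)
  have d\<phi>: "frechet_derivative \<phi> (at x) i = 0" if "x \<notin> K" for x
    using gradient_eq_0_outside[OF compact_imp_closed[OF K(2)] K(4) that] gradient_inner[OF K(1), of x i] by simp
  have smooth1: "smooth (\<lambda>x. \<psi> x * frechet_derivative \<phi> (at x) i)"
    by (intro smooth_mult \<psi> smooth_partial K i)
  have smooth2: "smooth (\<lambda>x. (gradient \<psi> x \<bullet> i) * \<phi> x)"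
    unfolding gradient_inner[OF \<psi>] by (intro smooth_mult \<psi> smooth_partial K i)
  have "gradient (\<lambda>x. \<psi> x * \<phi> x) x \<bullet> i = \<psi> x * frechet_derivative \<phi> (at x) i + (gradient \<psi> x \<bullet> i) * \<phi> x" for x
    using frechet_derivative_eq[OF has_derivative_mult[OF smooth_has_derivative smooth_has_derivative], OF \<psi> K(1)]
    by (simp add: gradient_inner smooth_mult \<psi> K)
  then have "0 = (\<integral>x. \<psi> x * frechet_derivative \<phi> (at x) i + (gradient \<psi> x \<bullet> i) * \<phi> x \<partial>lborel)"
    using integral_directional_derivative_zero[OF smooth_mult[OF \<psi> K(1)] K(2), of i] K(4) by simp
  also have "\<dots> = (\<integral>x. \<psi> x * frechet_derivative \<phi> (at x) i \<partial>lborel) + (\<integral>x. (gradient \<psi> x \<bullet> i) * \<phi> x \<partial>lborel)"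
    using d\<phi> K by (intro Bochner_Integration.integral_add
        integrable_lborel_compact_support[OF smooth_continuous_on, OF smooth1]
        integrable_lborel_compact_support[OF smooth_continuous_on, OF smooth2]) auto
  also have "(\<integral>x. \<psi> x * frechet_derivative \<phi> (at x) i \<partial>lborel) = (\<integral>x. \<psi> x * frechet_derivative \<phi> (at x) i \<partial>lebesgue_on \<Omega>)"
    using d\<phi> K by (intro integral_lebesgue_on_support[symmetric] smooth_borel_measurable smooth1 \<Omega>) auto
  also have "(\<integral>x. (gradient \<psi> x \<bullet> i) * \<phi> x \<partial>lborel) = (\<integral>x. (gradient \<psi> x \<bullet> i) * \<phi> x \<partial>lebesgue_on \<Omega>)"
    using K by (intro integral_lebesgue_on_support[symmetric] smooth_borel_measurable smooth2 \<Omega>) auto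
  finally show "(\<integral>x. \<psi> x * frechet_derivative \<phi> (at x) i \<partial>lebesgue_on \<Omega>)
      = - (\<integral>x. (gradient \<psi> x \<bullet> i) * \<phi> x \<partial>lebesgue_on \<Omega>)"
    by simp
qed

section \<open>The fundamental lemma of the calculus of variations\<close>

lemma flat_nonzeroD: "flat \<epsilon> p s \<noteq> 0 \<Longrightarrow> s > 0"
  by (auto simp: flat_def split: if_splits)

text \<open>By Lindelof's theorem countably many of the neighbourhoods cover \<open>S\<close>, and a
  countable union of null sets is null.\<close>

lemma AE_lborel_locally:
  assumes "\<And>x. x \<in> S \<Longrightarrow> \<exists>U. open U \<and> x \<in> U \<and> (AE y in lborel. y \<in> U \<longrightarrow> P y)"
  shows "AE y in lborel. y \<in> S \<longrightarrow> P (y::'a::euclidean_space)"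
proof -
  define \<F> where "\<F> = {U. open U \<and> (AE y in lborel. y \<in> U \<longrightarrow> P y)}"
  obtain \<F>' where F': "\<F>' \<subseteq> \<F>" "countable \<F>'" "\<Union>\<F>' = \<Union>\<F>"
    using Lindelof[of \<F>] unfolding \<F>_def by blast
  have "AE y in lborel. \<forall>U\<in>\<F>'. y \<in> U \<longrightarrow> P y"
    using F' by (subst AE_ball_countable) (auto simp: \<F>_def)
  moreover have "S \<subseteq> \<Union>\<F>'"
    using assms unfolding F'(3) \<F>_def by blast
  ultimately show ?thesis
    by (auto elim!: eventually_mono)
qed

text \<open>Boxes form an intersection-stable generator of the Borel sets, and the sets over which
  \<open>f\<close> integrates to zero form a Dynkin system; the vanishing total integral gives
  complements. The conclusion follows by taking the sets where \<open>f\<close> is positive and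
  where it is negative.\<close>

lemma AE_zero_if_box_integrals_zero:
  fixes f :: "'a::euclidean_space \<Rightarrow> real"
  assumes f: "integrable lborel f" and total: "(\<integral>x. f x \<partial>lborel) = 0"
    and box: "\<And>a b. (LINT x:box a b|lborel. f x) = 0"
  shows "AE x in lborel. f x = 0"
proof -
  have fA: "set_integrable lborel A f" if "A \<in> sets borel" for A
    using that f unfolding set_integrable_def by (intro integrable_mult_indicator) auto
  have zero: "(LINT x:A|lborel. f x) = 0" if A: "A \<in> sets borel" for A
  proof -
    have "Int_stable (range (\<lambda>(a, b). box a b :: 'a set))"
      by (auto simp: Int_stable_def box_Int_box)
    moreover have "range (\<lambda>(a, b). box a b :: 'a set) \<subseteq> Pow UNIV"
      by auto
    moreover have "A \<in> sigma_sets UNIV (range (\<lambda>(a, b). box a b))"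
      using A unfolding borel_eq_box by simp
    ultimately show ?thesis
    proof (induction rule: sigma_sets_induct_disjoint)
      case (basic A)
      then show ?case using box by auto
    next
      case (compl A)
      then have "A \<in> sets borel" by (simp add: borel_eq_box)
      then have "(LINT x:A \<union> (UNIV - A)|lborel. f x) = (LINT x:A|lborel. f x) + (LINT x:UNIV - A|lborel. f x)"
        by (intro set_integral_Un fA) auto
      then show ?case
        using compl.IH total by (simp add: set_lebesgue_integral_def)
    next
      case (union F)
      then have "F i \<in> sets borel" for i
        by (simp add: borel_eq_box subset_eq)
      then have "(LINT x:(\<Union>i. F i)|lborel. f x) = (\<Sum>i. (LINT x:(F i)|lborel. f x))"
        using union(1) by (intro lebesgue_integral_countable_add fA) (auto simp: disjoint_family_on_def)
      then show ?case using union.IH by simp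
    qed (simp add: set_lebesgue_integral_def)
  qed
  have [measurable]: "f \<in> borel_measurable borel"
    using borel_measurable_integrable[OF f] by simp
  have sgn: "AE x in lborel. \<not> (c * f x > 0)" for c
  proof -
    let ?A = "{x. c * f x > 0}"
    have A: "?A \<in> sets borel" by measurable
    have "AE x in lborel. indicator ?A x *\<^sub>R (c * f x) = 0"
    proof (subst integral_nonneg_eq_0_iff_AE[symmetric])
      show "integrable lborel (\<lambda>x. indicator ?A x *\<^sub>R (c * f x))"
        using A f by (intro integrable_mult_indicator) auto
      show "(\<integral>x. indicator ?A x *\<^sub>R (c * f x) \<partial>lborel) = 0"
        using zero[OF A] unfolding set_lebesgue_integral_def by (simp add: mult.left_commute)
    qed (auto simp: indicator_def)
    then show ?thesis by (auto elim!: eventually_mono simp: indicator_def split: if_splits)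
  qed
  show ?thesis
    using sgn[of 1] sgn[of "- 1"] by eventually_elim auto
qed

lemma fundamental_lemma_calculus_of_variations:
  fixes f :: "'a::euclidean_space \<Rightarrow> real"
  assumes \<Omega>: "open \<Omega>" and f: "integrable (lebesgue_on \<Omega>) f"
    and test: "\<And>\<phi>. \<phi> \<in> test_functions \<Omega> \<Longrightarrow> (\<integral>x. f x * \<phi> x \<partial>lebesgue_on \<Omega>) = 0"
  shows "AE x in lebesgue_on \<Omega>. f x = 0"
proof -
  have \<Omega>_sets: "\<Omega> \<inter> space lebesgue \<in> sets lebesgue"
    using \<Omega> by auto
  define F where "F x = indicator \<Omega> x *\<^sub>R f x" for x
  have F: "integrable lebesgue F"
    using f unfolding F_def integrable_restrict_space[OF \<Omega>_sets] .
  \<comment> \<open>The Dynkin argument concerns Borel sets and functions, so the Lebesgue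
    measurable \<open>F\<close> is replaced by a Borel representative.\<close>
  obtain g where g: "g \<in> borel_measurable lborel" "AE x in lborel. F x = g x"
    using completion_ex_borel_measurable_real[OF borel_measurable_integrable[OF F]] by auto
  have gF: "AE x in lebesgue. F x = g x"
    using g(2) by (rule AE_completion)
  have g_meas: "g \<in> borel_measurable lebesgue"
    using g(1) by (rule measurable_completion)
  have "integrable lebesgue g"
    using F gF g_meas by (subst integrable_cong_AE[symmetric]) auto
  then have g_int: "integrable lborel g"
    using g(1) by (simp add: integrable_completion)
  have box_zero: "(LINT x:box a b|lborel. g x) = 0" if ab: "cbox a b \<subseteq> \<Omega>" for a b
  proof -
    \<comment> \<open>Smooth bumps, bounded by 1 and supported in the closed box, that converge
      pointwise to the indicator of the open box.\<close>
    define \<phi> where "\<phi> n x = (\<Prod>i\<in>Basis. flat (1 / real (Suc n)) 1 (x \<bullet> i - a \<bullet> i) * flat (1 / real (Suc n)) 1 (b \<bullet> i - x \<bullet> i))" for n x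
    have \<phi>_smooth: "smooth (\<phi> n)" for n
      unfolding \<phi>_def
      by (intro smooth_prod smooth_mult smooth_flat smooth_diff smooth_inner_const smooth_const) auto
    have \<phi>_le: "\<bar>\<phi> n x\<bar> \<le> 1" for n x
      unfolding \<phi>_def abs_prod
      by (intro prod_le_1) (auto simp: abs_mult flat_1_bounds intro!: mult_le_one)
    have \<phi>_supp: "x \<in> box a b" if "\<phi> n x \<noteq> 0" for n x
      using that flat_nonzeroD by (simp add: \<phi>_def mem_box) (metis diff_gt_0_iff_gt)
    then have supp_subset: "{x. \<phi> n x \<noteq> 0} \<subseteq> cbox a b" for n
      using box_subset_cbox by blast
    have \<phi>_test: "\<phi> n \<in> test_functions \<Omega>" for n
      using \<phi>_smooth closure_minimal[OF supp_subset closed_cbox, of n] ab bounded_subset[OF bounded_cbox supp_subset, of n]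
      by (simp add: test_functions_def compact_closure subset_trans)
    have \<phi>_lim: "(\<lambda>n. \<phi> n x) \<longlonglongrightarrow> indicator (box a b) x" for x
    proof -
      have "(\<lambda>n. \<phi> n x) \<longlonglongrightarrow> (\<Prod>i\<in>Basis. indicator {0<..} (x \<bullet> i - a \<bullet> i) * indicator {0<..} (b \<bullet> i - x \<bullet> i))"
        unfolding \<phi>_def by (intro tendsto_prod tendsto_mult flat_1_tendsto)
      also have "(\<Prod>i\<in>Basis. indicator {0<..} (x \<bullet> i - a \<bullet> i) * indicator {0<..} (b \<bullet> i - x \<bullet> i)) = (indicator (box a b) x :: real)"
        by (cases "x \<in> box a b") (auto simp: indicator_def mem_box intro!: prod.neutral prod_zero)
      finally show ?thesis .
    qed
    have "(\<integral>x. F x * \<phi> n x \<partial>lebesgue) = 0" for n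
      using test[OF \<phi>_test, of n] by (subst (asm) integral_restrict_space[OF \<Omega>_sets]) (simp add: F_def mult.assoc)
    moreover have "(\<lambda>n. \<integral>x. F x * \<phi> n x \<partial>lebesgue) \<longlonglongrightarrow> (\<integral>x. F x * indicator (box a b) x \<partial>lebesgue)"
    proof (rule integral_dominated_convergence)
      show "integrable lebesgue (\<lambda>x. \<bar>F x\<bar>)" using F by simp
      show "(\<lambda>x. F x * indicator (box a b) x) \<in> borel_measurable lebesgue"
        using F by (intro borel_measurable_times borel_measurable_indicator) auto
      show "(\<lambda>x. F x * \<phi> n x) \<in> borel_measurable lebesgue" for n
        using smooth_borel_measurable[OF \<phi>_smooth[of n]]
        by (intro borel_measurable_times borel_measurable_integrable[OF F] measurable_completion[of "\<phi> n" lborel]) simp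
      show "AE x in lebesgue. (\<lambda>n. F x * \<phi> n x) \<longlonglongrightarrow> F x * indicator (box a b) x"
        by (intro AE_I2 tendsto_mult \<phi>_lim tendsto_const)
      show "AE x in lebesgue. norm (F x * \<phi> n x) \<le> \<bar>F x\<bar>" for n
        using \<phi>_le[of n] by (intro AE_I2) (auto simp: abs_mult intro: mult_left_le)
    qed
    ultimately have "(\<integral>x. F x * indicator (box a b) x \<partial>lebesgue) = 0"
      by (simp add: LIMSEQ_const_iff)
    also have "(\<integral>x. F x * indicator (box a b) x \<partial>lebesgue) = (\<integral>x. indicator (box a b) x *\<^sub>R g x \<partial>lebesgue)"
    proof (rule integral_cong_AE)
      show "(\<lambda>x. F x * indicator (box a b) x) \<in> borel_measurable lebesgue"
        using F by (intro borel_measurable_times borel_measurable_indicator) auto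
      show "(\<lambda>x. indicator (box a b) x *\<^sub>R g x) \<in> borel_measurable lebesgue"
        using g_meas by (intro borel_measurable_scaleR borel_measurable_indicator) auto
    qed (use gF in \<open>auto elim!: eventually_mono simp: indicator_def\<close>)
    also have "\<dots> = (\<integral>x. indicator (box a b) x *\<^sub>R g x \<partial>lborel)"
      using g(1) by (intro integral_completion) auto
    finally show ?thesis by (simp add: set_lebesgue_integral_def)
  qed
  have "AE x in lborel. x \<in> \<Omega> \<longrightarrow> g x = 0"
  proof (rule AE_lborel_locally)
    fix x assume "x \<in> \<Omega>"
    then obtain a b where ab: "x \<in> box a b" "cbox a b \<subseteq> \<Omega>"
      using open_contains_cbox[OF \<Omega>] by metis
    have "AE y in lborel. indicator (box a b) y *\<^sub>R g y = 0"
    proof (rule AE_zero_if_box_integrals_zero)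
      show "integrable lborel (\<lambda>y. indicator (box a b) y *\<^sub>R g y)"
        using g_int by (intro integrable_mult_indicator) auto
      show "(\<integral>y. indicator (box a b) y *\<^sub>R g y \<partial>lborel) = 0"
        using box_zero[OF ab(2)] by (simp add: set_lebesgue_integral_def)
      fix c d :: 'a
      \<comment> \<open>These are the corners of the intersection of the two boxes. Its closed
        version lies in \<open>cbox a b\<close> and hence in \<Omega>, so \<open>box_zero\<close>
        applies to it, whatever the box from \<open>c\<close> to \<open>d\<close>.\<close>
      let ?u = "\<Sum>i\<in>Basis. max (c \<bullet> i) (a \<bullet> i) *\<^sub>R i" and ?v = "\<Sum>i\<in>Basis. min (d \<bullet> i) (b \<bullet> i) *\<^sub>R i"
      have "cbox ?u ?v \<subseteq> \<Omega>"
        using ab(2) by (auto simp: mem_box subset_eq)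
      then have "(LINT y:box ?u ?v|lborel. g y) = 0"
        by (rule box_zero)
      moreover have "box ?u ?v = box c d \<inter> box a b"
        by (simp add: box_Int_box)
      ultimately show "(LINT y:box c d|lborel. indicator (box a b) y *\<^sub>R g y) = 0"
        by (simp add: set_lebesgue_integral_def indicator_inter_arith mult.assoc)
    qed
    then show "\<exists>U. open U \<and> x \<in> U \<and> (AE y in lborel. y \<in> U \<longrightarrow> g y = 0)"
      using ab(1) by (intro exI[of _ "box a b"]) (auto elim!: eventually_mono)
  qed
  with g(2) have "AE x in lborel. x \<in> \<Omega> \<longrightarrow> f x = 0"
    by eventually_elim (auto simp: F_def)
  then show ?thesis
    unfolding AE_restrict_space_iff[OF \<Omega>_sets] by (rule AE_completion)
qed

section \<open>Mean square distance\<close>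

text \<open>The squared distance in L2, with values in \<open>ennreal\<close> so that it is the very
  quantity tending to zero in \<open>has_trace\<close> and makes sense before integrability is
  known. The price of the square is a factor 2 in each triangle inequality.\<close>

definition dist_sq :: "'a measure \<Rightarrow> ('a \<Rightarrow> 'b::euclidean_space) \<Rightarrow> ('a \<Rightarrow> 'b) \<Rightarrow> ennreal" where
  "dist_sq M f g = (\<integral>\<^sup>+x. ennreal ((norm (f x - g x))\<^sup>2) \<partial>M)"

lemma norm_diff_square_le:
  fixes x y :: "'a::real_normed_vector"
  shows "(norm (x - y))\<^sup>2 \<le> 2 * (norm x)\<^sup>2 + 2 * (norm y)\<^sup>2"
proof -
  have "(norm (x - y))\<^sup>2 \<le> (norm x + norm y)\<^sup>2"
    by (intro power_mono norm_triangle_ineq4) auto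
  also have "\<dots> \<le> 2 * (norm x)\<^sup>2 + 2 * (norm y)\<^sup>2"
    using sum_squares_bound[of "norm x" "norm y"] by (simp add: power2_sum)
  finally show ?thesis .
qed

lemma L2D: "f \<in> L2 M \<Longrightarrow> f \<in> borel_measurable M" "f \<in> L2 M \<Longrightarrow> integrable M (\<lambda>x. (norm (f x))\<^sup>2)"
  by (auto simp: L2_def)

lemma L2I_bound:
  fixes f :: "'a \<Rightarrow> 'b::euclidean_space" and g :: "'a \<Rightarrow> 'c::euclidean_space"
  assumes "f \<in> L2 M" "g \<in> borel_measurable M" "AE x in M. norm (g x) \<le> norm (f x)"
  shows "g \<in> L2 M"
  unfolding L2_def
proof (intro CollectI conjI assms(2))
  show "integrable M (\<lambda>x. (norm (g x))\<^sup>2)"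
    by (rule Bochner_Integration.integrable_bound[OF L2D(2)[OF assms(1)]])
      (use assms in \<open>auto elim!: eventually_mono intro: power_mono\<close>)
qed

lemma L2_diff:
  assumes "f \<in> L2 M" "g \<in> L2 M"
  shows "(\<lambda>x. f x - g x) \<in> L2 M"
  unfolding L2_def
proof (intro CollectI conjI)
  show "(\<lambda>x. f x - g x) \<in> borel_measurable M"
    using assms L2D(1) by (intro borel_measurable_diff) auto
  show "integrable M (\<lambda>x. (norm (f x - g x))\<^sup>2)"
  proof (rule Bochner_Integration.integrable_bound)
    show "integrable M (\<lambda>x. 2 * (norm (f x))\<^sup>2 + 2 * (norm (g x))\<^sup>2)"
      using assms L2D(2) by (intro Bochner_Integration.integrable_add integrable_mult_right) auto
    show "(\<lambda>x. (norm (f x - g x))\<^sup>2) \<in> borel_measurable M"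
      using \<open>(\<lambda>x. f x - g x) \<in> borel_measurable M\<close> by simp
    show "AE x in M. norm ((norm (f x - g x))\<^sup>2) \<le> norm (2 * (norm (f x))\<^sup>2 + 2 * (norm (g x))\<^sup>2)"
      using norm_diff_square_le by (intro AE_I2) (auto intro: order_trans)
  qed
qed

lemma L2_iff_dist_sq:
  assumes "f \<in> borel_measurable M" "g \<in> borel_measurable M"
  shows "(\<lambda>x. f x - g x) \<in> L2 M \<longleftrightarrow> dist_sq M f g < \<infinity>"
  using assms by (auto simp: L2_def dist_sq_def integrable_iff_bounded)

lemma L2_of_dist_sq:
  assumes "f \<in> L2 M" "g \<in> borel_measurable M" "dist_sq M f g < \<infinity>"
  shows "g \<in> L2 M"
proof -
  have "(\<lambda>x. f x - g x) \<in> L2 M"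
    using assms L2_iff_dist_sq[of f M g] L2D(1)[OF assms(1)] by auto
  from L2_diff[OF assms(1) this] show ?thesis by simp
qed

lemma (in finite_measure) L2_const: "(\<lambda>x. c) \<in> L2 M"
  by (simp add: L2_def)

lemma (in finite_measure) L2_integrable:
  fixes f :: "'a \<Rightarrow> 'b::euclidean_space"
  assumes "f \<in> L2 M"
  shows "integrable M f"
proof (rule Bochner_Integration.integrable_bound)
  show "integrable M (\<lambda>x. 1 + (norm (f x))\<^sup>2)"
    using L2D(2)[OF assms] by simp
  have "y \<le> 1 + y\<^sup>2" for y :: real
    using sum_squares_bound[of y 1] zero_le_power2[of y] unfolding one_power2 mult_1_right by linarith
  then show "AE x in M. norm (f x) \<le> norm (1 + (norm (f x))\<^sup>2)"
    by (intro AE_I2) (simp add: abs_of_nonneg)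
qed (use L2D(1)[OF assms] in simp)

lemma L2_inner_integrable:
  assumes "f \<in> L2 M" "g \<in> L2 M"
  shows "integrable M (\<lambda>x. f x \<bullet> g x)"
proof (rule Bochner_Integration.integrable_bound)
  show "integrable M (\<lambda>x. (norm (f x))\<^sup>2 + (norm (g x))\<^sup>2)"
    using assms L2D(2) by (intro Bochner_Integration.integrable_add) auto
  show "(\<lambda>x. f x \<bullet> g x) \<in> borel_measurable M"
    using assms L2D(1) by (intro borel_measurable_inner) auto
  have "\<bar>f x \<bullet> g x\<bar> \<le> (norm (f x))\<^sup>2 + (norm (g x))\<^sup>2" for x
    using Cauchy_Schwarz_ineq2[of "f x" "g x"] sum_squares_bound[of "norm (f x)" "norm (g x)"]
      mult_nonneg_nonneg[of "norm (f x)" "norm (g x)"] by simp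
  then show "AE x in M. norm (f x \<bullet> g x) \<le> norm ((norm (f x))\<^sup>2 + (norm (g x))\<^sup>2)"
    by (intro AE_I2) simp
qed

lemma dist_sq_commute: "dist_sq M f g = dist_sq M g f"
  by (simp add: dist_sq_def norm_minus_commute)

lemma ennreal_2_plus_2:
  "0 \<le> b \<Longrightarrow> 0 \<le> c \<Longrightarrow> ennreal (2 * b + 2 * c) = 2 * ennreal b + 2 * ennreal c"
  by (simp add: ennreal_plus ennreal_mult')

lemma dist_sq_diff_le:
  assumes "f \<in> borel_measurable M" "g \<in> borel_measurable M" "f' \<in> borel_measurable M" "g' \<in> borel_measurable M"
  shows "dist_sq M (\<lambda>x. f x - f' x) (\<lambda>x. g x - g' x) \<le> 2 * dist_sq M f g + 2 * dist_sq M f' g'"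
proof -
  have "dist_sq M (\<lambda>x. f x - f' x) (\<lambda>x. g x - g' x)
      \<le> (\<integral>\<^sup>+x. 2 * ennreal ((norm (f x - g x))\<^sup>2) + 2 * ennreal ((norm (f' x - g' x))\<^sup>2) \<partial>M)"
    unfolding dist_sq_def
  proof (rule nn_integral_mono)
    fix x
    have "(norm (f x - f' x - (g x - g' x)))\<^sup>2 \<le> 2 * (norm (f x - g x))\<^sup>2 + 2 * (norm (f' x - g' x))\<^sup>2"
      using norm_diff_square_le[of "f x - g x" "f' x - g' x"] by (simp add: algebra_simps)
    then show "ennreal ((norm (f x - f' x - (g x - g' x)))\<^sup>2)
        \<le> 2 * ennreal ((norm (f x - g x))\<^sup>2) + 2 * ennreal ((norm (f' x - g' x))\<^sup>2)"
      unfolding ennreal_2_plus_2[symmetric, OF zero_le_power2 zero_le_power2] by (rule ennreal_leI)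
  qed
  also have "\<dots> = 2 * dist_sq M f g + 2 * dist_sq M f' g'"
    using assms unfolding dist_sq_def
    by (subst nn_integral_add) (auto simp: nn_integral_cmult)
  finally show ?thesis .
qed

lemma dist_sq_triangle:
  assumes "f \<in> borel_measurable M" "g \<in> borel_measurable M" "h \<in> borel_measurable M"
  shows "dist_sq M f h \<le> 2 * dist_sq M f g + 2 * dist_sq M g h"
proof -
  have "dist_sq M f h = dist_sq M (\<lambda>x. f x - h x) (\<lambda>x. g x - g x)"
    by (simp add: dist_sq_def)
  also have "\<dots> \<le> 2 * dist_sq M f g + 2 * dist_sq M h g"
    by (rule dist_sq_diff_le) fact+
  finally show ?thesis by (simp add: dist_sq_commute[of M h g])
qed

lemma dist_sq_mono:
  assumes "\<And>x. norm (f x - g x) \<le> norm (f' x - g' x)"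
  shows "dist_sq M f g \<le> dist_sq M f' g'"
  unfolding dist_sq_def by (intro nn_integral_mono ennreal_leI power_mono assms) auto

lemma AE_eq_if_dist_sq_0:
  assumes "f \<in> borel_measurable M" "g \<in> borel_measurable M" "dist_sq M f g = 0"
  shows "AE x in M. f x = g x"
proof -
  have "AE x in M. ennreal ((norm (f x - g x))\<^sup>2) = 0"
    using assms unfolding dist_sq_def by (subst (asm) nn_integral_0_iff_AE) auto
  then show ?thesis by (auto elim!: eventually_mono)
qed

lemma dist_sq_dominated_convergence:
  fixes f :: "'a \<Rightarrow> 'b::euclidean_space" and w :: "'a \<Rightarrow> 'c::euclidean_space"
  assumes meas: "f \<in> borel_measurable M" "\<And>n. g n \<in> borel_measurable M"
    and w: "w \<in> L2 M" "\<And>n. AE x in M. norm (f x - g n x) \<le> norm (w x)"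
    and lim: "AE x in M. (\<lambda>n. g n x) \<longlonglongrightarrow> f x"
  shows "(\<lambda>n. dist_sq M f (g n)) \<longlonglongrightarrow> 0"
proof -
  have "(\<lambda>n. dist_sq M f (g n)) \<longlonglongrightarrow> (\<integral>\<^sup>+x. 0 \<partial>M)"
    unfolding dist_sq_def
  proof (rule nn_integral_dominated_convergence[where w = "\<lambda>x. ennreal ((norm (w x))\<^sup>2)"])
    show "AE x in M. ennreal ((norm (f x - g n x))\<^sup>2) \<le> ennreal ((norm (w x))\<^sup>2)" for n
      using w(2)[of n] by eventually_elim (auto intro!: ennreal_leI power_mono)
    show "(\<integral>\<^sup>+x. ennreal ((norm (w x))\<^sup>2) \<partial>M) < \<infinity>"
      using L2D(2)[OF w(1)] by (simp add: integrable_iff_bounded)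
    show "AE x in M. (\<lambda>n. ennreal ((norm (f x - g n x))\<^sup>2)) \<longlonglongrightarrow> 0"
      using lim
    proof eventually_elim
      case (elim x)
      then have "(\<lambda>n. ennreal ((norm (f x - g n x))\<^sup>2)) \<longlonglongrightarrow> ennreal ((norm (f x - f x))\<^sup>2)"
        by (intro tendsto_intros tendsto_ennrealI)
      then show ?case by simp
    qed
  qed (use meas L2D(1)[OF w(1)] in simp_all)
  then show ?thesis by simp
qed

text \<open>Mean square convergence is L1 convergence of the squared norms, and an L1 convergent
  sequence has an almost everywhere convergent subsequence.\<close>

lemma dist_sq_AE_subseq:
  fixes f :: "'a \<Rightarrow> 'b::euclidean_space"
  assumes meas: "f \<in> borel_measurable M" "\<And>n. g n \<in> borel_measurable M"
    and fin: "\<And>n. dist_sq M f (g n) < \<infinity>" and lim: "(\<lambda>n. dist_sq M f (g n)) \<longlonglongrightarrow> 0"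
  obtains r :: "nat \<Rightarrow> nat" where "strict_mono r" "AE x in M. (\<lambda>n. g (r n) x) \<longlonglongrightarrow> f x"
proof -
  let ?d = "\<lambda>n x. (norm (f x - g n x))\<^sup>2"
  have int: "integrable M (?d n)" for n
    using fin[of n] meas L2_iff_dist_sq[of f M "g n"] by (simp add: L2_def)
  have "dist_sq M f (g n) = ennreal (\<integral>x. norm (?d n x) \<partial>M)" for n
    unfolding dist_sq_def using nn_integral_eq_integral[OF int[of n]] by simp
  then have "(\<lambda>n. ennreal (\<integral>x. norm (?d n x) \<partial>M)) \<longlonglongrightarrow> ennreal 0"
    using lim by simp
  then have "(\<lambda>n. \<integral>x. norm (?d n x) \<partial>M) \<longlonglongrightarrow> 0"
    by (rule tendsto_ennrealD) auto
  from tendsto_L1_AE_subseq[OF int this]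
  obtain r :: "nat \<Rightarrow> nat" where r: "strict_mono r" "AE x in M. (\<lambda>n. ?d (r n) x) \<longlonglongrightarrow> 0"
    by auto
  have "AE x in M. (\<lambda>n. g (r n) x) \<longlonglongrightarrow> f x"
    using r(2)
  proof eventually_elim
    case (elim x)
    from tendsto_real_sqrt[OF elim] have "(\<lambda>n. norm (f x - g (r n) x)) \<longlonglongrightarrow> 0"
      by simp
    then have "(\<lambda>n. f x - g (r n) x) \<longlonglongrightarrow> 0"
      by (rule tendsto_norm_zero_cancel)
    then have "(\<lambda>n. f x - (f x - g (r n) x)) \<longlonglongrightarrow> f x - 0"
      by (intro tendsto_intros)
    then show ?case by simp
  qed
  with r(1) show thesis by (rule that)
qed

text \<open>Cauchy-Schwarz against the constant 1. Test functions are bounded, so L1 convergence is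
  the form in which weak gradient identities pass to the limit.\<close>

lemma (in finite_measure) L1_tendsto_0_if_dist_sq:
  fixes f :: "'a \<Rightarrow> 'b::euclidean_space"
  assumes L2: "\<And>n. (\<lambda>x. f x - g n x) \<in> L2 M" and lim: "(\<lambda>n. dist_sq M f (g n)) \<longlonglongrightarrow> 0"
  shows "(\<lambda>n. \<integral>x. norm (f x - g n x) \<partial>M) \<longlonglongrightarrow> 0"
proof -
  let ?I = "\<lambda>n. \<integral>x. norm (f x - g n x) \<partial>M"
  have I: "(\<integral>\<^sup>+x. ennreal (norm (f x - g n x)) \<partial>M) = ennreal (?I n)" for n
    using L2_integrable[OF L2[of n]] by (intro nn_integral_eq_integral) auto
  have le: "ennreal ((?I n)\<^sup>2) \<le> dist_sq M f (g n) * emeasure M (space M)" for n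
  proof -
    have "(\<integral>\<^sup>+x. ennreal (norm (f x - g n x)) * 1 \<partial>M)\<^sup>2
        \<le> (\<integral>\<^sup>+x. (ennreal (norm (f x - g n x)))\<^sup>2 \<partial>M) * (\<integral>\<^sup>+x. 1\<^sup>2 \<partial>M)"
      using L2D(1)[OF L2[of n]] by (intro Cauchy_Schwarz_nn_integral) auto
    then show ?thesis
      by (simp add: I dist_sq_def ennreal_power)
  qed
  have "(\<lambda>n. dist_sq M f (g n) * emeasure M (space M)) \<longlonglongrightarrow> 0 * emeasure M (space M)"
    by (intro tendsto_mult_ennreal lim tendsto_const) auto
  then have upper: "(\<lambda>n. dist_sq M f (g n) * emeasure M (space M)) \<longlonglongrightarrow> 0"
    by simp
  have "(\<lambda>n. ennreal ((?I n)\<^sup>2)) \<longlonglongrightarrow> 0"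
    by (rule tendsto_sandwich[OF _ _ tendsto_const upper]) (use le in auto)
  then have "(\<lambda>n. ennreal ((?I n)\<^sup>2)) \<longlonglongrightarrow> ennreal 0" by simp
  then have "(\<lambda>n. (?I n)\<^sup>2) \<longlonglongrightarrow> 0"
    by (rule tendsto_ennrealD) auto
  from tendsto_real_sqrt[OF this] show ?thesis by simp
qed

section \<open>Gradients and traces by smooth approximation\<close>

lemma space_surface_on [simp]: "space (restrict_space (hausdorff_measure k) S) = S"
  by (simp add: space_restrict_space)

lemma measurable_surface_on_borel:
  "f \<in> borel_measurable borel \<Longrightarrow> f \<in> borel_measurable (surface_on S)"
  by (intro measurable_restrict_space1 measurable_hausdorff_measure_borel)

lemma measurable_lebesgue_on_borel:
  "f \<in> borel_measurable borel \<Longrightarrow> f \<in> borel_measurable (lebesgue_on \<Omega>)"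
  by (intro measurable_restrict_space1 measurable_completion) simp

abbreviation trace_close ::
    "'a::euclidean_space set \<Rightarrow> ('a \<Rightarrow> real) \<Rightarrow> ('a \<Rightarrow> 'a) \<Rightarrow> ('a \<Rightarrow> real) \<Rightarrow> real \<Rightarrow> ('a \<Rightarrow> real) \<Rightarrow> bool" where
  "trace_close \<Omega> u G t \<epsilon> \<phi> \<equiv> dist_sq (lebesgue_on \<Omega>) u \<phi> < ennreal \<epsilon> \<and>
     dist_sq (lebesgue_on \<Omega>) G (gradient \<phi>) < ennreal \<epsilon> \<and>
     dist_sq (surface_on (frontier \<Omega>)) t \<phi> < ennreal \<epsilon>"

text \<open>The graph of \<open>u \<mapsto> (\<nabla>u, trace u)\<close> on the closure of the smooth functions. Up to null sets the
  second component is the weak gradient, so this is the relation \<^const>\<open>has_trace\<close>.\<close>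

definition approx_trace ::
    "'a::euclidean_space set \<Rightarrow> ('a \<Rightarrow> real) \<Rightarrow> ('a \<Rightarrow> 'a) \<Rightarrow> ('a \<Rightarrow> real) \<Rightarrow> bool" where
  "approx_trace \<Omega> u G t \<longleftrightarrow>
     u \<in> L2 (lebesgue_on \<Omega>) \<and> G \<in> L2 (lebesgue_on \<Omega>) \<and> t \<in> L2 (surface_on (frontier \<Omega>)) \<and>
     (\<forall>\<epsilon>>0. \<exists>\<phi>. smooth \<phi> \<and> trace_close \<Omega> u G t \<epsilon> \<phi>)"

lemma approx_traceD:
  assumes "approx_trace \<Omega> u G t"
  shows "u \<in> L2 (lebesgue_on \<Omega>)" "G \<in> L2 (lebesgue_on \<Omega>)" "t \<in> L2 (surface_on (frontier \<Omega>))"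
    "u \<in> borel_measurable (lebesgue_on \<Omega>)" "G \<in> borel_measurable (lebesgue_on \<Omega>)"
    "t \<in> borel_measurable (surface_on (frontier \<Omega>))"
  using assms L2D(1) unfolding approx_trace_def by blast+

lemma approx_traceE:
  assumes "approx_trace \<Omega> u G t"
  obtains \<phi> where "\<And>n. smooth (\<phi> n)"
    "\<And>n. dist_sq (lebesgue_on \<Omega>) u (\<phi> n) < \<infinity>" "(\<lambda>n. dist_sq (lebesgue_on \<Omega>) u (\<phi> n)) \<longlonglongrightarrow> 0"
    "\<And>n. dist_sq (lebesgue_on \<Omega>) G (gradient (\<phi> n)) < \<infinity>" "(\<lambda>n. dist_sq (lebesgue_on \<Omega>) G (gradient (\<phi> n))) \<longlonglongrightarrow> 0"
    "\<And>n. dist_sq (surface_on (frontier \<Omega>)) t (\<phi> n) < \<infinity>" "(\<lambda>n. dist_sq (surface_on (frontier \<Omega>)) t (\<phi> n)) \<longlonglongrightarrow> 0"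
proof -
  have "\<exists>\<phi>. smooth \<phi> \<and> trace_close \<Omega> u G t (1 / real (Suc n)) \<phi>" for n
    using assms unfolding approx_trace_def by (meson of_nat_0_less_iff zero_less_Suc zero_less_divide_1_iff)
  then obtain \<phi> where \<phi>: "\<And>n. smooth (\<phi> n)"
      "\<And>n. dist_sq (lebesgue_on \<Omega>) u (\<phi> n) < ennreal (1 / real (Suc n))"
      "\<And>n. dist_sq (lebesgue_on \<Omega>) G (gradient (\<phi> n)) < ennreal (1 / real (Suc n))"
      "\<And>n. dist_sq (surface_on (frontier \<Omega>)) t (\<phi> n) < ennreal (1 / real (Suc n))"
    by metis
  have lim: "(\<lambda>n. ennreal (1 / real (Suc n))) \<longlonglongrightarrow> 0"
    using LIMSEQ_inverse_real_of_nat tendsto_ennrealI[of "\<lambda>n. 1 / real (Suc n)" 0 sequentially]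
    by (simp add: inverse_eq_divide)
  have small: "(\<forall>n. f n < \<infinity>) \<and> f \<longlonglongrightarrow> 0" if "\<And>n. f n < ennreal (1 / real (Suc n))" for f :: "nat \<Rightarrow> ennreal"
  proof (intro conjI allI)
    show "f n < \<infinity>" for n
      using that[of n] by (rule less_trans) simp
    have "\<forall>\<^sub>F n in sequentially. f n \<le> ennreal (1 / real (Suc n))"
      by (intro always_eventually allI less_imp_le that)
    then show "f \<longlonglongrightarrow> 0"
      by (intro tendsto_sandwich[OF _ _ tendsto_const lim]) simp_all
  qed
  show thesis
    using \<phi>(1) small[of "\<lambda>n. dist_sq (lebesgue_on \<Omega>) u (\<phi> n)"] small[of "\<lambda>n. dist_sq (lebesgue_on \<Omega>) G (gradient (\<phi> n))"]
      small[of "\<lambda>n. dist_sq (surface_on (frontier \<Omega>)) t (\<phi> n)"] \<phi>(2-4) by (intro that[of \<phi>]) blast+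
qed

lemma approx_traceI:
  assumes L2: "u \<in> L2 (lebesgue_on \<Omega>)" "G \<in> L2 (lebesgue_on \<Omega>)" "t \<in> L2 (surface_on (frontier \<Omega>))"
    and \<phi>: "\<And>n. smooth (\<phi> n)" "(\<lambda>n. dist_sq (lebesgue_on \<Omega>) u (\<phi> n)) \<longlonglongrightarrow> 0"
    "(\<lambda>n. dist_sq (lebesgue_on \<Omega>) G (gradient (\<phi> n))) \<longlonglongrightarrow> 0"
    "(\<lambda>n. dist_sq (surface_on (frontier \<Omega>)) t (\<phi> n)) \<longlonglongrightarrow> 0"
  shows "approx_trace \<Omega> u G t"
  unfolding approx_trace_def
proof (intro conjI L2 allI impI)
  fix \<epsilon> :: real assume "\<epsilon> > 0"
  then have "\<forall>\<^sub>F n in sequentially. trace_close \<Omega> u G t \<epsilon> (\<phi> n)"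
    using \<phi>(2-4)[THEN order_tendstoD(2), of "ennreal \<epsilon>"] by (simp add: eventually_conj_iff)
  then show "\<exists>\<phi>. smooth \<phi> \<and> trace_close \<Omega> u G t \<epsilon> \<phi>"
    using \<phi>(1) eventually_happens'[OF sequentially_bot] by blast
qed

text \<open>Quarters absorb the factors 2 in \<open>dist_sq_triangle\<close> and
  \<open>dist_sq_diff_le\<close>.\<close>

lemma four_quarters_less:
  assumes "a < ennreal (\<epsilon> / 4)" "b < ennreal (\<epsilon> / 4)" "c \<le> 2 * a + 2 * b" "\<epsilon> > 0"
  shows "c < ennreal \<epsilon>"
proof -
  obtain a' where a': "a = ennreal a'" "0 \<le> a'" "a' < \<epsilon> / 4"
    using assms(1,4) by (cases a) (auto simp: ennreal_less_iff)
  obtain b' where b': "b = ennreal b'" "0 \<le> b'" "b' < \<epsilon> / 4"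
    using assms(2,4) by (cases b) (auto simp: ennreal_less_iff)
  have "c \<le> ennreal (2 * a' + 2 * b')"
    using assms(3) unfolding a'(1) b'(1) by (simp only: ennreal_2_plus_2[OF a'(2) b'(2)])
  also have "\<dots> < ennreal \<epsilon>"
    using a' b' assms(4) by (intro ennreal_lessI) auto
  finally show ?thesis .
qed

text \<open>The relation is closed. Since \<open>approx_trace\<close> asks for one good approximant
  per \<epsilon>, no diagonal sequence has to be chosen.\<close>

lemma approx_trace_limit:
  assumes L2: "u \<in> L2 (lebesgue_on \<Omega>)" "G \<in> L2 (lebesgue_on \<Omega>)" "t \<in> L2 (surface_on (frontier \<Omega>))"
    and approx: "\<And>n. approx_trace \<Omega> (u' n) (G' n) (t' n)"
    and lim: "(\<lambda>n. dist_sq (lebesgue_on \<Omega>) u (u' n)) \<longlonglongrightarrow> 0" "(\<lambda>n. dist_sq (lebesgue_on \<Omega>) G (G' n)) \<longlonglongrightarrow> 0"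
    "(\<lambda>n. dist_sq (surface_on (frontier \<Omega>)) t (t' n)) \<longlonglongrightarrow> 0"
  shows "approx_trace \<Omega> u G t"
  unfolding approx_trace_def
proof (intro conjI L2 allI impI)
  fix \<epsilon> :: real assume \<epsilon>: "\<epsilon> > 0"
  then have "\<forall>\<^sub>F n in sequentially. dist_sq (lebesgue_on \<Omega>) u (u' n) < ennreal (\<epsilon> / 4) \<and>
      dist_sq (lebesgue_on \<Omega>) G (G' n) < ennreal (\<epsilon> / 4) \<and>
      dist_sq (surface_on (frontier \<Omega>)) t (t' n) < ennreal (\<epsilon> / 4)"
    using lim[THEN order_tendstoD(2), of "ennreal (\<epsilon> / 4)"] by (simp add: eventually_conj_iff)
  then obtain n where n: "dist_sq (lebesgue_on \<Omega>) u (u' n) < ennreal (\<epsilon> / 4)"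
      "dist_sq (lebesgue_on \<Omega>) G (G' n) < ennreal (\<epsilon> / 4)"
      "dist_sq (surface_on (frontier \<Omega>)) t (t' n) < ennreal (\<epsilon> / 4)"
    using eventually_happens'[OF sequentially_bot] by blast
  have "\<epsilon> / 4 > 0" using \<epsilon> by simp
  then obtain \<phi> where \<phi>: "smooth \<phi>" "dist_sq (lebesgue_on \<Omega>) (u' n) \<phi> < ennreal (\<epsilon> / 4)"
      "dist_sq (lebesgue_on \<Omega>) (G' n) (gradient \<phi>) < ennreal (\<epsilon> / 4)"
      "dist_sq (surface_on (frontier \<Omega>)) (t' n) \<phi> < ennreal (\<epsilon> / 4)"
    using approx[of n] unfolding approx_trace_def by blast
  note meas = L2[THEN L2D(1)] approx_traceD(4-6)[OF approx[of n]]
    measurable_lebesgue_on_borel[OF smooth_borel_measurable[OF \<phi>(1)]]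
    measurable_lebesgue_on_borel[OF borel_measurable_gradient[OF \<phi>(1)]]
    measurable_surface_on_borel[OF smooth_borel_measurable[OF \<phi>(1)]]
  have "dist_sq (lebesgue_on \<Omega>) u \<phi> < ennreal \<epsilon>"
    by (rule four_quarters_less[OF n(1) \<phi>(2) dist_sq_triangle \<epsilon>]) (rule meas)+
  moreover have "dist_sq (lebesgue_on \<Omega>) G (gradient \<phi>) < ennreal \<epsilon>"
    by (rule four_quarters_less[OF n(2) \<phi>(3) dist_sq_triangle \<epsilon>]) (rule meas)+
  moreover have "dist_sq (surface_on (frontier \<Omega>)) t \<phi> < ennreal \<epsilon>"
    by (rule four_quarters_less[OF n(3) \<phi>(4) dist_sq_triangle \<epsilon>]) (rule meas)+
  ultimately show "\<exists>\<phi>. smooth \<phi> \<and> trace_close \<Omega> u G t \<epsilon> \<phi>"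
    using \<phi>(1) by blast
qed

lemma approx_trace_diff:
  assumes "approx_trace \<Omega> u G t" "approx_trace \<Omega> u' G' t'"
  shows "approx_trace \<Omega> (\<lambda>x. u x - u' x) (\<lambda>x. G x - G' x) (\<lambda>x. t x - t' x)"
  unfolding approx_trace_def
proof (intro conjI L2_diff approx_traceD[OF assms(1)] approx_traceD[OF assms(2)] allI impI)
  fix \<epsilon> :: real assume \<epsilon>: "\<epsilon> > 0"
  then have "\<epsilon> / 4 > 0" by simp
  then obtain \<phi> \<phi>' where \<phi>: "smooth \<phi>" "dist_sq (lebesgue_on \<Omega>) u \<phi> < ennreal (\<epsilon> / 4)"
      "dist_sq (lebesgue_on \<Omega>) G (gradient \<phi>) < ennreal (\<epsilon> / 4)"
      "dist_sq (surface_on (frontier \<Omega>)) t \<phi> < ennreal (\<epsilon> / 4)"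
    and \<phi>': "smooth \<phi>'" "dist_sq (lebesgue_on \<Omega>) u' \<phi>' < ennreal (\<epsilon> / 4)"
      "dist_sq (lebesgue_on \<Omega>) G' (gradient \<phi>') < ennreal (\<epsilon> / 4)"
      "dist_sq (surface_on (frontier \<Omega>)) t' \<phi>' < ennreal (\<epsilon> / 4)"
    using assms unfolding approx_trace_def by metis
  note meas = approx_traceD(4-6)[OF assms(1)] approx_traceD(4-6)[OF assms(2)]
    \<phi>(1)[THEN smooth_borel_measurable, THEN measurable_lebesgue_on_borel]
    \<phi>'(1)[THEN smooth_borel_measurable, THEN measurable_lebesgue_on_borel]
    \<phi>(1)[THEN borel_measurable_gradient, THEN measurable_lebesgue_on_borel]
    \<phi>'(1)[THEN borel_measurable_gradient, THEN measurable_lebesgue_on_borel]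
    \<phi>(1)[THEN smooth_borel_measurable, THEN measurable_surface_on_borel]
    \<phi>'(1)[THEN smooth_borel_measurable, THEN measurable_surface_on_borel]
  have "gradient (\<lambda>x. \<phi> x - \<phi>' x) = (\<lambda>x. gradient \<phi> x - gradient \<phi>' x)"
    by (simp add: fun_eq_iff gradient_diff \<phi>(1) \<phi>'(1))
  moreover have "dist_sq (lebesgue_on \<Omega>) (\<lambda>x. u x - u' x) (\<lambda>x. \<phi> x - \<phi>' x) < ennreal \<epsilon>"
    by (rule four_quarters_less[OF \<phi>(2) \<phi>'(2) dist_sq_diff_le \<epsilon>]) (rule meas)+
  moreover have "dist_sq (lebesgue_on \<Omega>) (\<lambda>x. G x - G' x) (\<lambda>x. gradient \<phi> x - gradient \<phi>' x) < ennreal \<epsilon>"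
    by (rule four_quarters_less[OF \<phi>(3) \<phi>'(3) dist_sq_diff_le \<epsilon>]) (rule meas)+
  moreover have "dist_sq (surface_on (frontier \<Omega>)) (\<lambda>x. t x - t' x) (\<lambda>x. \<phi> x - \<phi>' x) < ennreal \<epsilon>"
    by (rule four_quarters_less[OF \<phi>(4) \<phi>'(4) dist_sq_diff_le \<epsilon>]) (rule meas)+
  ultimately show "\<exists>\<phi>. smooth \<phi> \<and> trace_close \<Omega> (\<lambda>x. u x - u' x) (\<lambda>x. G x - G' x) (\<lambda>x. t x - t' x) \<epsilon> \<phi>"
    using smooth_diff[OF \<phi>(1) \<phi>'(1)] by metis
qed

lemma approx_trace_const:
  assumes "finite_measure (lebesgue_on \<Omega>)" "finite_measure (surface_on (frontier \<Omega>))"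
  shows "approx_trace \<Omega> (\<lambda>x. c) (\<lambda>x. 0) (\<lambda>x. c)"
  by (rule approx_traceI[where \<phi> = "\<lambda>n x. c"])
    (intro finite_measure.L2_const assms | simp add: dist_sq_def gradient_const)+

text \<open>A smooth substitute for the positive part: \<open>s * flat \<epsilon> 1 s = s * exp (- \<epsilon> / s)\<close> for \<open>s > 0\<close>.\<close>

lemma soft_has_real_derivative:
  assumes "\<epsilon> > 0"
  shows "((\<lambda>s. s * flat \<epsilon> 1 s) has_real_derivative flat \<epsilon> [:1, \<epsilon>:] s) (at s)"
proof -
  have "((\<lambda>s. s * flat \<epsilon> 1 s) has_real_derivative
      1 * flat \<epsilon> 1 s + flat \<epsilon> ([:0, 0, 1:] * (smult \<epsilon> 1 - pderiv 1)) s * s) (at s)"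
    by (rule DERIV_mult[OF DERIV_ident flat_has_real_derivative[OF assms]])
  moreover have "1 * flat \<epsilon> 1 s + flat \<epsilon> ([:0, 0, 1:] * (smult \<epsilon> 1 - pderiv 1)) s * s = flat \<epsilon> [:1, \<epsilon>:] s"
    by (simp add: flat_def field_simps)
  ultimately show ?thesis by simp
qed

text \<open>For positive \<open>s\<close> and \<open>x = \<epsilon> / s\<close> the value is
  \<open>(1 + x) * exp (- x)\<close>, and \<open>1 + x\<close> is at most \<open>exp x\<close>. The
  bound is uniform in \<epsilon> and makes the substitute for the positive part a
  contraction.\<close>

lemma soft_derivative_bounds:
  assumes "\<epsilon> > 0"
  shows "\<bar>flat \<epsilon> [:1, \<epsilon>:] s\<bar> \<le> 1"
proof (cases "s > 0")
  case True
  have "1 + \<epsilon> / s \<le> exp (\<epsilon> / s)"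
    by (rule exp_ge_add_one_self)
  then have "(1 + \<epsilon> / s) * exp (- (\<epsilon> / s)) \<le> exp (\<epsilon> / s) * exp (- (\<epsilon> / s))"
    by (rule mult_right_mono) simp
  also have "\<dots> = 1"
    by (simp flip: exp_add)
  finally have "(1 + \<epsilon> / s) * exp (- (\<epsilon> / s)) \<le> 1" .
  moreover have "0 \<le> (1 + \<epsilon> / s) * exp (- (\<epsilon> / s))"
    using True assms by (intro mult_nonneg_nonneg add_nonneg_nonneg) auto
  moreover have "flat \<epsilon> [:1, \<epsilon>:] s = (1 + \<epsilon> / s) * exp (- (\<epsilon> / s))"
    using True by (simp add: flat_def)
  ultimately show ?thesis by linarith
qed (simp add: flat_def)

lemma soft_diff_le:
  assumes "\<epsilon> > 0"
  shows "\<bar>x * flat \<epsilon> 1 x - y * flat \<epsilon> 1 y\<bar> \<le> \<bar>x - y\<bar>"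
proof -
  have "norm (x * flat \<epsilon> 1 x - y * flat \<epsilon> 1 y) \<le> 1 * norm (x - y)"
    by (rule field_differentiable_bound[of UNIV _ "flat \<epsilon> [:1, \<epsilon>:]"])
      (auto intro: soft_has_real_derivative assms soft_derivative_bounds)
  then show ?thesis by simp
qed

lemma continuous_on_flat: "\<epsilon> > 0 \<Longrightarrow> continuous_on S (flat \<epsilon> p)"
  by (intro continuous_at_imp_continuous_on ballI DERIV_isCont[OF flat_has_real_derivative])

lemma borel_measurable_flat: "\<epsilon> > 0 \<Longrightarrow> flat \<epsilon> p \<in> borel_measurable borel"
  by (intro borel_measurable_continuous_onI continuous_on_flat)

text \<open>A chain rule: compose the approximants with the smooth contraction. Function and trace
  converge because it is a contraction. For the gradients, \<open>h'(\<psi> n) G\<close> is inserted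
  between \<open>h'(u) G\<close> and \<open>h'(\<psi> n)\<close> times the gradient of
  \<open>\<psi> n\<close>: the first difference tends to zero by dominated convergence, the second
  by the bound on \<open>h'\<close>.\<close>

lemma approx_trace_soft:
  assumes approx: "approx_trace \<Omega> u G t" and \<epsilon>: "\<epsilon> > 0"
  shows "approx_trace \<Omega> (\<lambda>x. u x * flat \<epsilon> 1 (u x)) (\<lambda>x. flat \<epsilon> [:1, \<epsilon>:] (u x) *\<^sub>R G x) (\<lambda>x. t x * flat \<epsilon> 1 (t x))"
proof -
  let ?M = "lebesgue_on \<Omega>" and ?S = "surface_on (frontier \<Omega>)"
  let ?h = "\<lambda>s. s * flat \<epsilon> 1 s" and ?h' = "flat \<epsilon> [:1, \<epsilon>:]"
  note L2 = approx_traceD(1-3)[OF approx] and meas = approx_traceD(4-6)[OF approx]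
  have h_meas: "?h \<in> borel_measurable borel" and h'_meas: "?h' \<in> borel_measurable borel"
    using borel_measurable_flat[OF \<epsilon>] by auto
  obtain \<phi> where \<phi>: "\<And>n. smooth (\<phi> n)"
    "\<And>n. dist_sq ?M u (\<phi> n) < \<infinity>" "(\<lambda>n. dist_sq ?M u (\<phi> n)) \<longlonglongrightarrow> 0"
    "\<And>n. dist_sq ?M G (gradient (\<phi> n)) < \<infinity>" "(\<lambda>n. dist_sq ?M G (gradient (\<phi> n))) \<longlonglongrightarrow> 0"
    "\<And>n. dist_sq ?S t (\<phi> n) < \<infinity>" "(\<lambda>n. dist_sq ?S t (\<phi> n)) \<longlonglongrightarrow> 0"
    using approx by (rule approx_traceE) (rule that)
  note \<phi>_meas = \<phi>(1)[THEN smooth_borel_measurable, THEN measurable_lebesgue_on_borel]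
    \<phi>(1)[THEN borel_measurable_gradient, THEN measurable_lebesgue_on_borel]
  \<comment> \<open>Dominated convergence for \<open>h'(\<psi> n x)\<close> needs pointwise
    convergence, which only a subsequence provides.\<close>
  obtain r :: "nat \<Rightarrow> nat" where r: "strict_mono r" "AE x in ?M. (\<lambda>n. \<phi> (r n) x) \<longlonglongrightarrow> u x"
    using meas(1) \<phi>_meas(1) \<phi>(2,3) by (rule dist_sq_AE_subseq) (rule that)
  define \<psi> where "\<psi> n = \<phi> (r n)" for n
  have sub: "(\<lambda>n. f (r n)) \<longlonglongrightarrow> 0" if "f \<longlonglongrightarrow> 0" for f :: "nat \<Rightarrow> ennreal"
    using LIMSEQ_subseq_LIMSEQ[OF that r(1)] by (simp add: o_def)
  have \<psi>: "\<And>n. smooth (\<psi> n)" "(\<lambda>n. dist_sq ?M u (\<psi> n)) \<longlonglongrightarrow> 0"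
    "(\<lambda>n. dist_sq ?M G (gradient (\<psi> n))) \<longlonglongrightarrow> 0" "(\<lambda>n. dist_sq ?S t (\<psi> n)) \<longlonglongrightarrow> 0"
    "AE x in ?M. (\<lambda>n. \<psi> n x) \<longlonglongrightarrow> u x"
    unfolding \<psi>_def using \<phi>(1) sub[OF \<phi>(3)] sub[OF \<phi>(5)] sub[OF \<phi>(7)] r(2) by auto
  note \<psi>_meas = \<psi>(1)[THEN smooth_borel_measurable, THEN measurable_lebesgue_on_borel]
    \<psi>(1)[THEN borel_measurable_gradient, THEN measurable_lebesgue_on_borel]
  have contraction: "(\<lambda>n. dist_sq N (\<lambda>x. ?h (f x)) (\<lambda>x. ?h (\<psi> n x))) \<longlonglongrightarrow> 0"
    if "(\<lambda>n. dist_sq N f (\<psi> n)) \<longlonglongrightarrow> 0" for N f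
  proof (rule tendsto_sandwich[OF _ _ tendsto_const that])
    have "dist_sq N (\<lambda>x. ?h (f x)) (\<lambda>x. ?h (\<psi> n x)) \<le> dist_sq N f (\<psi> n)" for n
      by (rule dist_sq_mono) (simp add: soft_diff_le[OF \<epsilon>])
    then show "\<forall>\<^sub>F n in sequentially. dist_sq N (\<lambda>x. ?h (f x)) (\<lambda>x. ?h (\<psi> n x)) \<le> dist_sq N f (\<psi> n)"
      by simp
  qed simp
  have grad: "gradient (\<lambda>x. ?h (\<psi> n x)) = (\<lambda>x. ?h' (\<psi> n x) *\<^sub>R gradient (\<psi> n) x)" for n
    using gradient_compose[OF soft_has_real_derivative[OF \<epsilon>] \<psi>(1)] by auto
  show ?thesis
  proof (rule approx_traceI[where \<phi> = "\<lambda>n x. ?h (\<psi> n x)"])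
    have "norm (?h s) \<le> norm s" for s
      using soft_diff_le[OF \<epsilon>, of s 0] by (simp add: flat_def)
    then show "(\<lambda>x. ?h (u x)) \<in> L2 ?M" "(\<lambda>x. ?h (t x)) \<in> L2 ?S"
      using L2 measurable_compose[OF meas(1) h_meas] measurable_compose[OF meas(3) h_meas]
      by (auto intro: L2I_bound)
    show "(\<lambda>x. ?h' (u x) *\<^sub>R G x) \<in> L2 ?M"
      using soft_derivative_bounds[OF \<epsilon>] measurable_compose[OF meas(1) h'_meas] meas(2)
      by (intro L2I_bound[OF L2(2)] AE_I2) (auto intro: mult_left_le_one_le)
    show "smooth (\<lambda>x. ?h (\<psi> n x))" for n
      by (intro smooth_mult smooth_flat \<epsilon> \<psi>(1))
    show "(\<lambda>n. dist_sq ?M (\<lambda>x. ?h (u x)) (\<lambda>x. ?h (\<psi> n x))) \<longlonglongrightarrow> 0"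
      "(\<lambda>n. dist_sq ?S (\<lambda>x. ?h (t x)) (\<lambda>x. ?h (\<psi> n x))) \<longlonglongrightarrow> 0"
      by (intro contraction \<psi>(2,4))+
    have meas1: "(\<lambda>x. ?h' (u x) *\<^sub>R G x) \<in> borel_measurable ?M"
      and meas2: "(\<lambda>x. ?h' (\<psi> n x) *\<^sub>R G x) \<in> borel_measurable ?M"
      and meas3: "(\<lambda>x. ?h' (\<psi> n x) *\<^sub>R gradient (\<psi> n) x) \<in> borel_measurable ?M" for n
      using measurable_compose[OF meas(1) h'_meas] measurable_compose[OF \<psi>_meas(1)[of n] h'_meas] meas(2) \<psi>_meas(2)[of n]
      by (auto intro: borel_measurable_scaleR)
    have "(\<lambda>n. dist_sq ?M (\<lambda>x. ?h' (u x) *\<^sub>R G x) (\<lambda>x. ?h' (\<psi> n x) *\<^sub>R G x)) \<longlonglongrightarrow> 0"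
    proof (rule dist_sq_dominated_convergence[OF meas1 meas2])
      show "(\<lambda>x. 2 *\<^sub>R G x) \<in> L2 ?M"
        using L2(2) by (auto simp: L2_def power_mult_distrib)
      show "AE x in ?M. norm (?h' (u x) *\<^sub>R G x - ?h' (\<psi> n x) *\<^sub>R G x) \<le> norm (2 *\<^sub>R G x)" for n
      proof (rule AE_I2)
        fix x
        have "\<bar>?h' (u x) - ?h' (\<psi> n x)\<bar> \<le> 2"
          using soft_derivative_bounds[OF \<epsilon>, of "u x"] soft_derivative_bounds[OF \<epsilon>, of "\<psi> n x"] by linarith
        then show "norm (?h' (u x) *\<^sub>R G x - ?h' (\<psi> n x) *\<^sub>R G x) \<le> norm (2 *\<^sub>R G x)"
          by (simp add: scaleR_diff_left[symmetric] mult_right_mono)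
      qed
      show "AE x in ?M. (\<lambda>n. ?h' (\<psi> n x) *\<^sub>R G x) \<longlonglongrightarrow> ?h' (u x) *\<^sub>R G x"
        using \<psi>(5)
      proof eventually_elim
        case (elim x)
        then show ?case
          by (intro tendsto_scaleR tendsto_const isCont_tendsto_compose[OF DERIV_isCont[OF flat_has_real_derivative[OF \<epsilon>]]])
      qed
    qed
    then have "(\<lambda>n. 2 * dist_sq ?M (\<lambda>x. ?h' (u x) *\<^sub>R G x) (\<lambda>x. ?h' (\<psi> n x) *\<^sub>R G x) + 2 * dist_sq ?M G (gradient (\<psi> n)))
        \<longlonglongrightarrow> 2 * 0 + 2 * 0"
      by (intro tendsto_add ennreal_tendsto_cmult \<psi>(3)) auto
    then have upper: "(\<lambda>n. 2 * dist_sq ?M (\<lambda>x. ?h' (u x) *\<^sub>R G x) (\<lambda>x. ?h' (\<psi> n x) *\<^sub>R G x) + 2 * dist_sq ?M G (gradient (\<psi> n))) \<longlonglongrightarrow> 0"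
      by simp
    have "dist_sq ?M (\<lambda>x. ?h' (u x) *\<^sub>R G x) (gradient (\<lambda>x. ?h (\<psi> n x)))
        \<le> 2 * dist_sq ?M (\<lambda>x. ?h' (u x) *\<^sub>R G x) (\<lambda>x. ?h' (\<psi> n x) *\<^sub>R G x) + 2 * dist_sq ?M G (gradient (\<psi> n))" for n
    proof -
      have "dist_sq ?M (\<lambda>x. ?h' (\<psi> n x) *\<^sub>R G x) (\<lambda>x. ?h' (\<psi> n x) *\<^sub>R gradient (\<psi> n) x) \<le> dist_sq ?M G (gradient (\<psi> n))"
        using soft_derivative_bounds[OF \<epsilon>]
        by (intro dist_sq_mono) (auto simp: scaleR_diff_right[symmetric] intro: mult_left_le_one_le)
      then have "2 * dist_sq ?M (\<lambda>x. ?h' (u x) *\<^sub>R G x) (\<lambda>x. ?h' (\<psi> n x) *\<^sub>R G x)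
          + 2 * dist_sq ?M (\<lambda>x. ?h' (\<psi> n x) *\<^sub>R G x) (\<lambda>x. ?h' (\<psi> n x) *\<^sub>R gradient (\<psi> n) x)
        \<le> 2 * dist_sq ?M (\<lambda>x. ?h' (u x) *\<^sub>R G x) (\<lambda>x. ?h' (\<psi> n x) *\<^sub>R G x) + 2 * dist_sq ?M G (gradient (\<psi> n))"
        by (intro add_left_mono mult_left_mono) auto
      then show ?thesis
        unfolding grad by (rule order_trans[OF dist_sq_triangle[OF meas1 meas2 meas3]])
    qed
    then show "(\<lambda>n. dist_sq ?M (\<lambda>x. ?h' (u x) *\<^sub>R G x) (gradient (\<lambda>x. ?h (\<psi> n x)))) \<longlonglongrightarrow> 0"
      by (intro tendsto_sandwich[OF _ _ tendsto_const upper]) auto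
  qed
qed

lemma soft_derivative_tendsto:
  "(\<lambda>n. flat (1 / real (Suc n)) [:1, 1 / real (Suc n):] s) \<longlonglongrightarrow> indicator {0<..} s"
proof (cases "s > 0")
  case True
  have "(\<lambda>n. (1 + 1 / s * (1 / real (Suc n))) * exp (- (1 / real (Suc n)) / s)) \<longlonglongrightarrow> (1 + 1 / s * 0) * exp (- 0 / s)"
    using LIMSEQ_inverse_real_of_nat True by (intro tendsto_intros) (auto simp: inverse_eq_divide)
  then show ?thesis using True by (simp add: flat_def)
qed (simp add: flat_def)

text \<open>Let \<epsilon> tend to zero in \<open>approx_trace_soft\<close>; the errors are
  dominated by \<open>u\<close>, \<open>2 G\<close> and \<open>t\<close>. The derivatives of the
  substitutes vanish at \<open>s = 0\<close>, so the limit gradient is cut off by the open half line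
  and is zero where \<open>u\<close> is zero.\<close>

lemma approx_trace_pos_part:
  assumes approx: "approx_trace \<Omega> u G t"
  shows "approx_trace \<Omega> (\<lambda>x. max 0 (u x)) (\<lambda>x. indicator {0<..} (u x) *\<^sub>R G x) (\<lambda>x. max 0 (t x))"
proof -
  let ?M = "lebesgue_on \<Omega>" and ?S = "surface_on (frontier \<Omega>)"
  define \<epsilon> where "\<epsilon> n = 1 / real (Suc n)" for n
  have \<epsilon>: "\<epsilon> n > 0" for n by (simp add: \<epsilon>_def)
  note L2 = approx_traceD(1-3)[OF approx] and meas = approx_traceD(4-6)[OF approx]
  have soft: "approx_trace \<Omega> (\<lambda>x. u x * flat (\<epsilon> n) 1 (u x)) (\<lambda>x. flat (\<epsilon> n) [:1, \<epsilon> n:] (u x) *\<^sub>R G x)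
      (\<lambda>x. t x * flat (\<epsilon> n) 1 (t x))" for n
    by (rule approx_trace_soft[OF approx \<epsilon>])
  have max_lim: "(\<lambda>n. s * flat (\<epsilon> n) 1 s) \<longlonglongrightarrow> max 0 s" for s
  proof -
    have "s * indicator {0<..} s = max 0 s"
      by (auto simp: indicator_def max_def)
    then show ?thesis
      using tendsto_mult[OF tendsto_const flat_1_tendsto, of s s] by (simp only: \<epsilon>_def)
  qed
  have max_le: "norm (max 0 s - s * flat (\<epsilon> n) 1 s) \<le> norm s" for s n
  proof (cases "s > 0")
    case True
    then have "0 \<le> s * flat (\<epsilon> n) 1 s" "s * flat (\<epsilon> n) 1 s \<le> s"
      using flat_1_bounds[OF \<epsilon>] by (auto intro: mult_left_le)
    with True show ?thesis by simp
  qed (simp add: flat_def)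
  have max_conv: "(\<lambda>n. dist_sq N (\<lambda>x. max 0 (f x)) (\<lambda>x. f x * flat (\<epsilon> n) 1 (f x))) \<longlonglongrightarrow> 0" if "f \<in> L2 N" for f :: "'a \<Rightarrow> real" and N
    using L2D(1)[OF that] measurable_compose[OF L2D(1)[OF that] borel_measurable_flat[OF \<epsilon>]] max_le max_lim
    by (intro dist_sq_dominated_convergence[where w = f] that) auto
  have ind_meas: "(\<lambda>x. indicator {0<..} (u x) *\<^sub>R G x) \<in> borel_measurable ?M"
    using meas(1,2) by (intro borel_measurable_scaleR measurable_compose[OF meas(1)]) auto
  have max_L2: "(\<lambda>x. max 0 (f x)) \<in> L2 N" if "f \<in> L2 N" for f :: "'a \<Rightarrow> real" and N
    using L2D(1)[OF that] by (intro L2I_bound[OF that]) auto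
  have ind_L2: "(\<lambda>x. indicator {0<..} (u x) *\<^sub>R G x) \<in> L2 ?M"
    by (intro L2I_bound[OF L2(2)] ind_meas) (auto simp: indicator_def)
  have "(\<lambda>n. dist_sq ?M (\<lambda>x. indicator {0<..} (u x) *\<^sub>R G x) (\<lambda>x. flat (\<epsilon> n) [:1, \<epsilon> n:] (u x) *\<^sub>R G x)) \<longlonglongrightarrow> 0"
  proof (rule dist_sq_dominated_convergence[OF ind_meas])
    show "(\<lambda>x. flat (\<epsilon> n) [:1, \<epsilon> n:] (u x) *\<^sub>R G x) \<in> borel_measurable ?M" for n
      using approx_traceD(5)[OF soft] .
    show "(\<lambda>x. 2 *\<^sub>R G x) \<in> L2 ?M"
      using L2(2) by (auto simp: L2_def power_mult_distrib)
    show "AE x in ?M. norm (indicator {0<..} (u x) *\<^sub>R G x - flat (\<epsilon> n) [:1, \<epsilon> n:] (u x) *\<^sub>R G x) \<le> norm (2 *\<^sub>R G x)" for n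
    proof (rule AE_I2)
      fix x
      have "\<bar>indicator {0<..} (u x) - flat (\<epsilon> n) [:1, \<epsilon> n:] (u x)\<bar> \<le> 2"
        using soft_derivative_bounds[OF \<epsilon>[of n], of "u x"] by (auto simp: indicator_def)
      then show "norm (indicator {0<..} (u x) *\<^sub>R G x - flat (\<epsilon> n) [:1, \<epsilon> n:] (u x) *\<^sub>R G x) \<le> norm (2 *\<^sub>R G x)"
        by (simp add: scaleR_diff_left[symmetric] mult_right_mono)
    qed
    show "AE x in ?M. (\<lambda>n. flat (\<epsilon> n) [:1, \<epsilon> n:] (u x) *\<^sub>R G x) \<longlonglongrightarrow> indicator {0<..} (u x) *\<^sub>R G x"
      unfolding \<epsilon>_def by (intro AE_I2 tendsto_scaleR soft_derivative_tendsto tendsto_const)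
  qed
  from approx_trace_limit[OF max_L2[OF L2(1)] ind_L2 max_L2[OF L2(3)] soft max_conv[OF L2(1)] this max_conv[OF L2(3)]]
  show ?thesis .
qed

section \<open>The trace inequality\<close>

text \<open>The fundamental theorem of calculus on the segment from \<open>x\<close> to
  \<open>x + s v\<close>, followed by Cauchy-Schwarz; the factor \<open>s\<close> is the length of
  the parameter interval.\<close>

lemma smooth_line_estimate:
  fixes \<phi> :: "'a::euclidean_space \<Rightarrow> real"
  assumes \<phi>: "smooth \<phi>" and s: "0 \<le> s"
  shows "ennreal ((\<phi> (x + s *\<^sub>R v) - \<phi> x)\<^sup>2)
    \<le> ennreal (s * (norm v)\<^sup>2) * (\<integral>\<^sup>+\<tau>. ennreal ((norm (gradient \<phi> (x + \<tau> *\<^sub>R v)))\<^sup>2) * indicator {0<..<s} \<tau> \<partial>lborel)"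
proof -
  define g where "g \<tau> = gradient \<phi> (x + \<tau> *\<^sub>R v) \<bullet> v" for \<tau>
  define J where "J = (\<integral>\<^sup>+\<tau>. ennreal ((norm (gradient \<phi> (x + \<tau> *\<^sub>R v)))\<^sup>2) * indicator {0<..<s} \<tau> \<partial>lborel)"
  have "continuous_on UNIV (\<lambda>\<tau>. gradient \<phi> (x + \<tau> *\<^sub>R v))"
    by (rule continuous_on_compose2[OF continuous_on_gradient[OF \<phi>, of UNIV]]) (auto intro!: continuous_intros)
  then have g_cont: "continuous_on UNIV g"
    and [measurable]: "(\<lambda>\<tau>. gradient \<phi> (x + \<tau> *\<^sub>R v)) \<in> borel_measurable borel"
    unfolding g_def by (auto intro!: continuous_intros borel_measurable_continuous_onI)
  then have [measurable]: "g \<in> borel_measurable borel"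
    by (intro borel_measurable_continuous_onI)
  have "((\<lambda>\<tau>. \<phi> (x + \<tau> *\<^sub>R v)) has_real_derivative g \<tau>) (at \<tau>)" for \<tau>
    unfolding g_def by (rule smooth_has_real_derivative_line[OF \<phi>])
  then have int: "has_bochner_integral lborel (\<lambda>\<tau>. g \<tau> * indicator {0..s} \<tau>) (\<phi> (x + s *\<^sub>R v) - \<phi> (x + 0 *\<^sub>R v))"
    using g_cont s by (intro has_bochner_integral_FTC_Icc_real) (auto simp: continuous_on_eq_continuous_at)
  have "\<bar>\<phi> (x + s *\<^sub>R v) - \<phi> x\<bar> = norm (\<integral>\<tau>. g \<tau> * indicator {0..s} \<tau> \<partial>lborel)"
    using has_bochner_integral_integral_eq[OF int] by simp
  then have "ennreal \<bar>\<phi> (x + s *\<^sub>R v) - \<phi> x\<bar> \<le> (\<integral>\<^sup>+\<tau>. norm (g \<tau> * indicator {0..s} \<tau>) \<partial>lborel)"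
    using integral_norm_bound_ennreal[OF integrable.intros[OF int]] by simp
  \<comment> \<open>The end points are null and are dropped, because later the segments lie in the
    domain only in their interior. The separate indicator is the constant factor for
    Cauchy-Schwarz.\<close>
  also have "\<dots> = (\<integral>\<^sup>+\<tau>. indicator {0<..<s} \<tau> * ennreal (\<bar>g \<tau>\<bar> * indicator {0<..<s} \<tau>) \<partial>lborel)"
  proof (rule nn_integral_cong_AE)
    show "AE \<tau> in lborel. ennreal (norm (g \<tau> * indicator {0..s} \<tau>)) = indicator {0<..<s} \<tau> * ennreal (\<bar>g \<tau>\<bar> * indicator {0<..<s} \<tau>)"
      using AE_lborel_singleton[of 0] AE_lborel_singleton[of s]
      by eventually_elim (auto simp: indicator_def)
  qed
  finally have "ennreal ((\<phi> (x + s *\<^sub>R v) - \<phi> x)\<^sup>2)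
      \<le> (\<integral>\<^sup>+\<tau>. indicator {0<..<s} \<tau> * ennreal (\<bar>g \<tau>\<bar> * indicator {0<..<s} \<tau>) \<partial>lborel)\<^sup>2"
    by (subst power2_abs[symmetric], subst ennreal_power[symmetric]) (auto intro: power_mono)
  also have "\<dots> \<le> (\<integral>\<^sup>+\<tau>. (indicator {0<..<s} \<tau>)\<^sup>2 \<partial>lborel) * (\<integral>\<^sup>+\<tau>. (ennreal (\<bar>g \<tau>\<bar> * indicator {0<..<s} \<tau>))\<^sup>2 \<partial>lborel)"
    by (rule Cauchy_Schwarz_nn_integral) auto
  also have "(\<integral>\<^sup>+\<tau>. (indicator {0<..<s} \<tau>)\<^sup>2 \<partial>lborel) = (\<integral>\<^sup>+\<tau>. indicator {0<..<s} \<tau> \<partial>lborel)"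
    by (intro nn_integral_cong) (auto simp: indicator_def)
  also have "\<dots> = ennreal s"
    using s by simp
  also have "(\<integral>\<^sup>+\<tau>. (ennreal (\<bar>g \<tau>\<bar> * indicator {0<..<s} \<tau>))\<^sup>2 \<partial>lborel) \<le> ennreal ((norm v)\<^sup>2) * J"
    unfolding J_def
  proof (subst nn_integral_cmult[symmetric])
    have "(ennreal (\<bar>g \<tau>\<bar> * indicator {0<..<s} \<tau>))\<^sup>2
        \<le> ennreal ((norm v)\<^sup>2) * (ennreal ((norm (gradient \<phi> (x + \<tau> *\<^sub>R v)))\<^sup>2) * indicator {0<..<s} \<tau>)" for \<tau>
    proof (cases "\<tau> \<in> {0<..<s}")
      case True
      have "\<bar>g \<tau>\<bar>\<^sup>2 \<le> (norm v * norm (gradient \<phi> (x + \<tau> *\<^sub>R v)))\<^sup>2"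
        unfolding g_def using Cauchy_Schwarz_ineq2[of "gradient \<phi> (x + \<tau> *\<^sub>R v)" v]
        by (intro power_mono) (auto simp: mult.commute)
      then show ?thesis
        using True by (simp add: ennreal_power power_mult_distrib flip: ennreal_mult)
    qed simp
    then show "(\<integral>\<^sup>+\<tau>. (ennreal (\<bar>g \<tau>\<bar> * indicator {0<..<s} \<tau>))\<^sup>2 \<partial>lborel)
        \<le> (\<integral>\<^sup>+\<tau>. ennreal ((norm v)\<^sup>2) * (ennreal ((norm (gradient \<phi> (x + \<tau> *\<^sub>R v)))\<^sup>2) * indicator {0<..<s} \<tau>) \<partial>lborel)"
      by (intro nn_integral_mono)
  qed auto
  finally show ?thesis
    using s unfolding J_def[symmetric] by (simp add: ennreal_mult mult.assoc mult_left_mono)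
qed

lemma nn_integral_surface_on:
  fixes S :: "'a::euclidean_space set"
  assumes "S \<in> sets borel"
  shows "(\<integral>\<^sup>+x. f x \<partial>surface_on S) = (\<integral>\<^sup>+x. f x * indicator S x \<partial>hausdorff_measure (DIM('a) - 1))"
  using assms sets_borel_subset_hausdorff_measure by (subst nn_integral_restrict_space) auto

abbreviation energy :: "'a::euclidean_space set \<Rightarrow> ('a \<Rightarrow> real) \<Rightarrow> ennreal" where
  "energy \<Omega> \<phi> \<equiv> (\<integral>\<^sup>+x. ennreal ((\<phi> x)\<^sup>2) \<partial>lebesgue_on \<Omega>) +
     (\<integral>\<^sup>+x. ennreal ((norm (gradient \<phi> x))\<^sup>2) \<partial>lebesgue_on \<Omega>)"

section \<open>The estimate near one boundary point\<close>

locale lipschitz_graph_patch =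
  fixes \<Omega> :: "'a::euclidean_space set" and x0 e :: 'a and r L :: real and f :: "'a \<Rightarrow> real"
  assumes open_dom: "open \<Omega>" and bounded_dom: "bounded \<Omega>" and r: "r > 0" and e: "norm e = 1"
    and lip: "L-lipschitz_on {z. z \<bullet> e = 0} f"
    and epigraph: "\<And>y. y \<in> ball x0 r \<Longrightarrow> y \<in> \<Omega> \<longleftrightarrow> f (y - (y \<bullet> e) *\<^sub>R e) < y \<bullet> e"
begin

text \<open>Since \<open>f\<close> is Lipschitz on the entire hyperplane, this function is Lipschitz
  on the whole space, as \<open>eilenberg_inequality\<close> requires. Inside the ball \<Omega> is
  the set where it is positive.\<close>

definition height :: "'a \<Rightarrow> real" where
  "height x = x \<bullet> e - f (x - (x \<bullet> e) *\<^sub>R e)"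

text \<open>Half the radius, so that translates by less than \<open>r / 2\<close> stay in the ball
  where the boundary is described as a graph.\<close>

definition patch :: "'a set" where
  "patch = frontier \<Omega> \<inter> cball x0 (r / 2)"

lemma inner_e_e: "e \<bullet> e = 1"
  using e by (simp add: norm_eq_1)

text \<open>The triangle inequality gives the constant 2 for the projection onto the hyperplane;
  with 1 for the coordinate along \<open>e\<close> this makes \<open>1 + 2 * L\<close>.\<close>

lemma height_lipschitz: "(1 + 2 * L)-lipschitz_on UNIV height"
proof (rule lipschitz_onI)
  have L: "0 \<le> L" using lip by (rule lipschitz_on_nonneg)
  then show "0 \<le> 1 + 2 * L" by simp
  fix x y
  let ?P = "\<lambda>x. x - (x \<bullet> e) *\<^sub>R e"
  have inner: "\<bar>(x - y) \<bullet> e\<bar> \<le> norm (x - y)"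
    using Cauchy_Schwarz_ineq2[of "x - y" e] e by simp
  have "?P x - ?P y = (x - y) - ((x - y) \<bullet> e) *\<^sub>R e"
    by (simp add: algebra_simps)
  then have "norm (?P x - ?P y) \<le> norm (x - y) + norm (((x - y) \<bullet> e) *\<^sub>R e)"
    by (metis norm_triangle_ineq4)
  then have "dist (?P x) (?P y) \<le> 2 * norm (x - y)"
    using inner e by (simp add: dist_norm)
  then have "L * dist (?P x) (?P y) \<le> L * (2 * norm (x - y))"
    using L by (rule mult_left_mono)
  moreover have "dist (f (?P x)) (f (?P y)) \<le> L * dist (?P x) (?P y)"
    by (rule lipschitz_onD[OF lip]) (auto simp: inner_diff_left inner_e_e)
  ultimately have "\<bar>f (?P x) - f (?P y)\<bar> \<le> L * (2 * norm (x - y))"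
    unfolding dist_real_def by linarith
  moreover have "height x - height y = (x - y) \<bullet> e - (f (?P x) - f (?P y))"
    by (simp add: height_def inner_diff_left)
  ultimately show "dist (height x) (height y) \<le> (1 + 2 * L) * dist x y"
    using inner by (simp add: dist_real_def dist_norm algebra_simps)
qed

lemma height_shift: "height (y + s *\<^sub>R e) = height y + s"
  by (simp add: height_def inner_add_left inner_e_e algebra_simps)

text \<open>A frontier point is outside the open \<Omega>, so its height is not positive. If it were
  negative, a whole neighbourhood would miss \<Omega>, and the point would not be in the
  closure.\<close>

lemma height_frontier:
  assumes "y \<in> frontier \<Omega>" "y \<in> ball x0 r"
  shows "height y = 0"
proof (rule ccontr)
  assume "height y \<noteq> 0"
  have "y \<notin> \<Omega>"
    using assms(1) open_dom by (simp add: frontier_def interior_open)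
  then have neg: "height y < 0"
    using epigraph[OF assms(2)] \<open>height y \<noteq> 0\<close> by (simp add: height_def)
  let ?U = "{z. height z < 0} \<inter> ball x0 r"
  have "continuous_on UNIV height"
    using height_lipschitz by (rule lipschitz_on_continuous_on)
  then have "open {z. height z < 0}"
    by (intro open_Collect_less continuous_on_const)
  then have "open ?U" by auto
  moreover have "?U \<inter> \<Omega> = {}"
    using epigraph by (fastforce simp: height_def)
  ultimately have "?U \<inter> closure \<Omega> = {}"
    by (simp add: open_Int_closure_eq_empty)
  then show False
    using neg assms by (auto simp: frontier_def)
qed

lemma patch_shift:
  assumes "y \<in> patch" "s \<in> {0<..<r / 2}"
  shows "y + s *\<^sub>R e \<in> \<Omega> \<inter> ball x0 r" "height (y + s *\<^sub>R e) = s"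
proof -
  have "dist x0 y \<le> r / 2" using assms by (simp add: patch_def)
  moreover have "dist y (y + s *\<^sub>R e) = s"
    using assms e by (simp add: dist_norm)
  ultimately have ball: "y + s *\<^sub>R e \<in> ball x0 r"
    using assms(2) dist_triangle[of x0 "y + s *\<^sub>R e" y] by simp
  have "y \<in> ball x0 r"
    using \<open>dist x0 y \<le> r / 2\<close> r by simp
  then have "height y = 0"
    using assms by (intro height_frontier) (auto simp: patch_def)
  then show h: "height (y + s *\<^sub>R e) = s"
    by (simp add: height_shift)
  then show "y + s *\<^sub>R e \<in> \<Omega> \<inter> ball x0 r"
    using ball assms(2) epigraph[OF ball] by (simp add: height_def)
qed

lemma patch_borel: "patch \<in> sets borel"
  unfolding patch_def by (intro sets.Int borel_closed) auto

abbreviation patch_measure :: "'a measure" where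
  "patch_measure \<equiv> surface_on patch"

abbreviation time_measure :: "real measure" where
  "time_measure \<equiv> restrict_space lborel {0<..<r / 2}"

lemma id_measurable_patch: "(\<lambda>y. y) \<in> measurable patch_measure borel"
  by (rule measurable_surface_on_borel) simp

lemma shift_measurable: "(\<lambda>(s, y). y + s *\<^sub>R e) \<in> measurable (time_measure \<Otimes>\<^sub>M patch_measure) borel"
proof -
  have "(\<lambda>s. s) \<in> measurable time_measure borel"
    by (rule measurable_restrict_space1) simp
  then have "(\<lambda>p. fst p) \<in> measurable (time_measure \<Otimes>\<^sub>M patch_measure) borel"
    "(\<lambda>p. snd p) \<in> measurable (time_measure \<Otimes>\<^sub>M patch_measure) borel"
    using id_measurable_patch measurable_compose[OF measurable_fst] measurable_compose[OF measurable_snd] by blast+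
  then show ?thesis
    unfolding split_beta by (intro borel_measurable_add borel_measurable_scaleR) auto
qed

text \<open>The translates of the patch in direction \<open>e\<close> are level sets of \<^const>\<open>height\<close>.\<close>

lemma layer_bound:
  "\<exists>c\<ge>0. \<forall>A\<in>sets borel. (\<integral>\<^sup>+s. emeasure patch_measure {y \<in> patch. y + s *\<^sub>R e \<in> A} \<partial>time_measure)
     \<le> ennreal c * emeasure lborel (A \<inter> \<Omega>)"
proof -
  let ?k = "DIM('a) - 1"
  obtain c where c: "c \<ge> 0" "\<And>A. A \<in> sets borel \<Longrightarrow> bounded A \<Longrightarrow>
      (\<integral>\<^sup>+s. hausdorff_outer ?k (A \<inter> height -` {s}) \<partial>lborel) \<le> ennreal c * emeasure lborel A"
    using eilenberg_inequality[OF height_lipschitz] by blast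
  have "(\<integral>\<^sup>+s. emeasure patch_measure {y \<in> patch. y + s *\<^sub>R e \<in> A} \<partial>time_measure)
      \<le> ennreal c * emeasure lborel (A \<inter> \<Omega>)" if A: "A \<in> sets borel" for A
  proof -
    have A\<Omega>: "A \<inter> \<Omega> \<in> sets borel" "bounded (A \<inter> \<Omega>)"
      using A open_dom bounded_dom by auto
    have le: "emeasure patch_measure {y \<in> patch. y + s *\<^sub>R e \<in> A} \<le> hausdorff_outer ?k (A \<inter> \<Omega> \<inter> height -` {s})"
      if s: "s \<in> {0<..<r / 2}" for s
    proof -
      let ?B = "{y \<in> patch. y + s *\<^sub>R e \<in> A}"
      have "?B = patch \<inter> (\<lambda>y. y + s *\<^sub>R e) -` A" by auto
      moreover have "(\<lambda>y. y + s *\<^sub>R e) -` A \<in> sets borel"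
        using A by (intro measurable_sets_borel[of _ borel]) auto
      ultimately have B: "?B \<in> sets borel"
        using patch_borel by simp
      have "emeasure patch_measure ?B = emeasure (hausdorff_measure ?k) ?B"
        using patch_borel sets_borel_subset_hausdorff_measure by (intro emeasure_restrict_space) auto
      also have "\<dots> = hausdorff_outer ?k ?B"
        using B sets_borel_subset_hausdorff_measure by (intro emeasure_hausdorff_measure) auto
      \<comment> \<open>Written as a translate back by \<open>s e\<close>, so that
        \<open>hausdorff_outer_translation_le\<close> bounds the set on the boundary by its copy
        inside the domain.\<close>
      also have "\<dots> = hausdorff_outer ?k ((+) (- (s *\<^sub>R e)) ` (+) (s *\<^sub>R e) ` ?B)"
        by (simp add: image_image)
      also have "\<dots> \<le> hausdorff_outer ?k ((+) (s *\<^sub>R e) ` ?B)"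
        by (rule hausdorff_outer_translation_le)
      also have "\<dots> \<le> hausdorff_outer ?k (A \<inter> \<Omega> \<inter> height -` {s})"
        using patch_shift[OF _ s] by (intro hausdorff_outer_mono) (auto simp: add.commute)
      finally show ?thesis .
    qed
    have "(\<integral>\<^sup>+s. emeasure patch_measure {y \<in> patch. y + s *\<^sub>R e \<in> A} \<partial>time_measure)
        \<le> (\<integral>\<^sup>+s. hausdorff_outer ?k (A \<inter> \<Omega> \<inter> height -` {s}) \<partial>time_measure)"
      by (intro nn_integral_mono le) (simp add: space_restrict_space)
    also have "\<dots> = (\<integral>\<^sup>+s. hausdorff_outer ?k (A \<inter> \<Omega> \<inter> height -` {s}) * indicator {0<..<r / 2} s \<partial>lborel)"
      by (rule nn_integral_restrict_space) simp
    also have "\<dots> \<le> (\<integral>\<^sup>+s. hausdorff_outer ?k (A \<inter> \<Omega> \<inter> height -` {s}) \<partial>lborel)"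
      by (intro nn_integral_mono) (auto simp: indicator_def)
    also have "\<dots> \<le> ennreal c * emeasure lborel (A \<inter> \<Omega>)"
      by (rule c(2)[OF A\<Omega>])
    finally show ?thesis .
  qed
  with c(1) show ?thesis by blast
qed

text \<open>With \<open>A = UNIV\<close> the integrand of \<open>layer_bound\<close> is the constant
  measure of the patch, so \<open>r / 2\<close> times this measure is at most a multiple of the
  volume of \<Omega>. Finiteness is then available for product measures.\<close>

lemma finite_patch_measure: "finite_measure patch_measure"
proof
  obtain c where c: "c \<ge> 0" "\<And>A. A \<in> sets borel \<Longrightarrow>
      (\<integral>\<^sup>+s. emeasure patch_measure {y \<in> patch. y + s *\<^sub>R e \<in> A} \<partial>time_measure) \<le> ennreal c * emeasure lborel (A \<inter> \<Omega>)"
    using layer_bound by blast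
  have "emeasure time_measure {0<..<r / 2} = ennreal (r / 2)"
    using r by (subst emeasure_restrict_space) auto
  then have "ennreal (r / 2) * emeasure patch_measure patch = (\<integral>\<^sup>+s. emeasure patch_measure patch \<partial>time_measure)"
    by (simp add: space_restrict_space mult.commute)
  also have "\<dots> \<le> ennreal c * emeasure lborel \<Omega>"
    using c(2)[of UNIV] by simp
  also have "\<dots> < \<infinity>"
    using emeasure_bounded_finite[OF bounded_dom] by (simp add: ennreal_mult_less_top)
  finally show "emeasure patch_measure (space patch_measure) \<noteq> \<infinity>"
    using r by (auto simp: ennreal_mult_less_top top_unique space_restrict_space)
qed

text \<open>\<open>layer_bound\<close> says that the image of the product measure under the shift is
  at most \<open>c\<close> times Lebesgue measure on \<Omega>. A comparison of measures carries over
  to integrals of all nonnegative Borel functions, and Fubini's theorem orders the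
  integrals.\<close>

lemma layer_nn_integral_bound:
  "\<exists>c\<ge>0. \<forall>F\<in>borel_measurable borel. (\<integral>\<^sup>+y. \<integral>\<^sup>+s. F (y + s *\<^sub>R e) \<partial>time_measure \<partial>patch_measure)
     \<le> ennreal c * (\<integral>\<^sup>+x. F x \<partial>lebesgue_on \<Omega>)"
proof -
  interpret PM: finite_measure patch_measure by (rule finite_patch_measure)
  interpret TM: finite_measure time_measure
    using r by (intro finite_measure_restrict_space finite_measureI) (auto simp: emeasure_restrict_space space_restrict_space)
  interpret pair_sigma_finite time_measure patch_measure ..
  obtain c where c: "c \<ge> 0" "\<And>A. A \<in> sets borel \<Longrightarrow>
      (\<integral>\<^sup>+s. emeasure patch_measure {y \<in> patch. y + s *\<^sub>R e \<in> A} \<partial>time_measure) \<le> ennreal c * emeasure lborel (A \<inter> \<Omega>)"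
    using layer_bound by blast
  define N where "N = distr (time_measure \<Otimes>\<^sub>M patch_measure) borel (\<lambda>(s, y). y + s *\<^sub>R e)"
  define \<Lambda> where "\<Lambda> = scale_measure (ennreal c) (density lborel (indicator \<Omega> :: 'a \<Rightarrow> ennreal))"
  have \<Omega>: "\<Omega> \<in> sets borel" using open_dom by simp
  have "N \<le> \<Lambda>"
  proof (subst le_measure, simp add: N_def \<Lambda>_def, intro ballI)
    fix A assume "A \<in> sets N"
    then have A: "A \<in> sets borel" by (simp add: N_def)
    let ?X = "(\<lambda>(s, y). y + s *\<^sub>R e) -` A \<inter> space (time_measure \<Otimes>\<^sub>M patch_measure)"
    have "emeasure N A = emeasure (time_measure \<Otimes>\<^sub>M patch_measure) ?X"
      unfolding N_def by (rule emeasure_distr[OF shift_measurable A])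
    also have "\<dots> = (\<integral>\<^sup>+s. emeasure patch_measure (Pair s -` ?X) \<partial>time_measure)"
      by (rule PM.emeasure_pair_measure_alt[OF measurable_sets[OF shift_measurable A]])
    also have "\<dots> = (\<integral>\<^sup>+s. emeasure patch_measure {y \<in> patch. y + s *\<^sub>R e \<in> A} \<partial>time_measure)"
      by (intro nn_integral_cong arg_cong[where f = "emeasure patch_measure"]) (auto simp: space_pair_measure space_restrict_space)
    also have "\<dots> \<le> ennreal c * emeasure lborel (A \<inter> \<Omega>)"
      by (rule c(2)[OF A])
    also have "emeasure lborel (A \<inter> \<Omega>) = (\<integral>\<^sup>+x. indicator (A \<inter> \<Omega>) x \<partial>lborel)"
      using A \<Omega> by simp
    also have "\<dots> = (\<integral>\<^sup>+x. indicator \<Omega> x * indicator A x \<partial>lborel)"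
      by (intro nn_integral_cong) (auto simp: indicator_def)
    also have "\<dots> = emeasure (density lborel (indicator \<Omega>)) A"
      using A \<Omega> by (intro emeasure_density[symmetric]) auto
    also have "ennreal c * \<dots> = emeasure \<Lambda> A"
      by (simp add: \<Lambda>_def)
    finally show "emeasure N A \<le> emeasure \<Lambda> A" .
  qed
  have "(\<integral>\<^sup>+y. \<integral>\<^sup>+s. F (y + s *\<^sub>R e) \<partial>time_measure \<partial>patch_measure) \<le> ennreal c * (\<integral>\<^sup>+x. F x \<partial>lebesgue_on \<Omega>)"
    if F: "F \<in> borel_measurable borel" for F
  proof -
    have "(\<lambda>(s, y). F (y + s *\<^sub>R e)) \<in> borel_measurable (time_measure \<Otimes>\<^sub>M patch_measure)"
      using measurable_compose[OF shift_measurable F] by (simp add: split_beta)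
    from nn_integral_snd[OF this]
    have "(\<integral>\<^sup>+y. \<integral>\<^sup>+s. F (y + s *\<^sub>R e) \<partial>time_measure \<partial>patch_measure)
        = (\<integral>\<^sup>+p. F (case p of (s, y) \<Rightarrow> y + s *\<^sub>R e) \<partial>(time_measure \<Otimes>\<^sub>M patch_measure))"
      by (simp add: case_prod_unfold)
    also have "\<dots> = (\<integral>\<^sup>+x. F x \<partial>N)"
      unfolding N_def using F by (subst nn_integral_distr[OF shift_measurable]) auto
    also have "\<dots> \<le> (\<integral>\<^sup>+x. F x \<partial>\<Lambda>)"
      by (rule nn_integral_mono_measure[OF _ \<open>N \<le> \<Lambda>\<close>]) (simp add: N_def \<Lambda>_def)
    also have "\<dots> = ennreal c * (\<integral>\<^sup>+x. F x * indicator \<Omega> x \<partial>lborel)"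
      using F \<Omega> by (simp add: \<Lambda>_def nn_integral_scale_measure nn_integral_density mult.commute)
    also have "(\<integral>\<^sup>+x. F x * indicator \<Omega> x \<partial>lborel) = (\<integral>\<^sup>+x. F x \<partial>lebesgue_on \<Omega>)"
      using F \<Omega> by (simp add: nn_integral_restrict_space nn_integral_completion)
    finally show ?thesis .
  qed
  with c(1) show ?thesis by blast
qed

text \<open>The value at a boundary point is compared with the value at height \<open>s\<close> by
  \<open>smooth_line_estimate\<close>, averaged over \<open>s\<close>, and integrated over the
  patch; the layer bound turns the result into volume integrals.\<close>

lemma patch_trace_inequality:
  "\<exists>C\<ge>0. \<forall>\<phi>. smooth \<phi> \<longrightarrow> (\<integral>\<^sup>+y. ennreal ((\<phi> y)\<^sup>2) \<partial>patch_measure)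
     \<le> ennreal C * energy \<Omega> \<phi>"
proof -
  define \<delta> where "\<delta> = r / 2"
  have \<delta>: "\<delta> > 0" using r by (simp add: \<delta>_def)
  obtain c where c: "c \<ge> 0" "\<And>F. F \<in> borel_measurable borel \<Longrightarrow>
      (\<integral>\<^sup>+y. \<integral>\<^sup>+s. F (y + s *\<^sub>R e) \<partial>time_measure \<partial>patch_measure) \<le> ennreal c * (\<integral>\<^sup>+x. F x \<partial>lebesgue_on \<Omega>)"
    using layer_nn_integral_bound by blast
  \<comment> \<open>Integrating \<open>2 (\<phi> (y + s e))^2 + 2 \<delta> J\<close> over
    \<open>s\<close> from 0 to \<delta> leaves the factor 2 before the function and
    \<open>2 \<delta>^2\<close> before the gradient term \<open>J\<close>.\<close>
  define B where "B = max 2 (2 * \<delta>\<^sup>2)"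
  have bound: "(\<integral>\<^sup>+y. ennreal ((\<phi> y)\<^sup>2) \<partial>patch_measure)
     \<le> ennreal (c * B / \<delta>) * energy \<Omega> \<phi>"
    if \<phi>: "smooth \<phi>" for \<phi>
  proof -
    note [measurable] = smooth_borel_measurable[OF \<phi>] borel_measurable_gradient[OF \<phi>]
    let ?D = "\<lambda>x. (norm (gradient \<phi> x))\<^sup>2"
    define F where "F x = ennreal B * (ennreal ((\<phi> x)\<^sup>2) + ennreal (?D x))" for x
    have F_meas: "F \<in> borel_measurable borel" unfolding F_def by measurable
    have time: "(\<integral>\<^sup>+s. h s \<partial>time_measure) = (\<integral>\<^sup>+s. h s * indicator {0<..<\<delta>} s \<partial>lborel)" for h
      unfolding \<delta>_def by (rule nn_integral_restrict_space) simp
    have pointwise: "ennreal \<delta> * ennreal ((\<phi> y)\<^sup>2) \<le> (\<integral>\<^sup>+s. F (y + s *\<^sub>R e) \<partial>time_measure)" for y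
    proof -
      define J where "J = (\<integral>\<^sup>+\<tau>. ennreal (?D (y + \<tau> *\<^sub>R e)) * indicator {0<..<\<delta>} \<tau> \<partial>lborel)"
      have step: "ennreal ((\<phi> y)\<^sup>2) \<le> 2 * ennreal ((\<phi> (y + s *\<^sub>R e))\<^sup>2) + 2 * (ennreal \<delta> * J)" if s: "s \<in> {0<..<\<delta>}" for s
      proof -
        have "(\<phi> y)\<^sup>2 \<le> 2 * (\<phi> (y + s *\<^sub>R e))\<^sup>2 + 2 * (\<phi> (y + s *\<^sub>R e) - \<phi> y)\<^sup>2"
          using norm_diff_square_le[of "\<phi> (y + s *\<^sub>R e)" "\<phi> (y + s *\<^sub>R e) - \<phi> y"] by simp
        then have "ennreal ((\<phi> y)\<^sup>2) \<le> 2 * ennreal ((\<phi> (y + s *\<^sub>R e))\<^sup>2) + 2 * ennreal ((\<phi> (y + s *\<^sub>R e) - \<phi> y)\<^sup>2)"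
          unfolding ennreal_2_plus_2[symmetric, OF zero_le_power2 zero_le_power2] by (rule ennreal_leI)
        moreover have "ennreal ((\<phi> (y + s *\<^sub>R e) - \<phi> y)\<^sup>2) \<le> ennreal \<delta> * J"
        proof -
          have "ennreal ((\<phi> (y + s *\<^sub>R e) - \<phi> y)\<^sup>2)
              \<le> ennreal (s * (norm e)\<^sup>2) * (\<integral>\<^sup>+\<tau>. ennreal (?D (y + \<tau> *\<^sub>R e)) * indicator {0<..<s} \<tau> \<partial>lborel)"
            using s by (intro smooth_line_estimate \<phi>) auto
          also have "\<dots> \<le> ennreal \<delta> * J"
            unfolding J_def using s e by (intro mult_mono ennreal_leI nn_integral_mono) (auto simp: indicator_def)
          finally show ?thesis .
        qed
        ultimately show ?thesis
          by (meson add_left_mono mult_left_mono order_trans zero_le)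
      qed
      have "ennreal \<delta> * ennreal ((\<phi> y)\<^sup>2) = (\<integral>\<^sup>+s. ennreal ((\<phi> y)\<^sup>2) * indicator {0<..<\<delta>} s \<partial>lborel)"
        using \<delta> by (subst nn_integral_cmult_indicator) (auto simp: mult.commute)
      also have "\<dots> \<le> (\<integral>\<^sup>+s. 2 * (ennreal ((\<phi> (y + s *\<^sub>R e))\<^sup>2) * indicator {0<..<\<delta>} s) + 2 * (ennreal \<delta> * J) * indicator {0<..<\<delta>} s \<partial>lborel)"
        using step by (intro nn_integral_mono) (auto simp: indicator_def)
      also have "\<dots> = 2 * (\<integral>\<^sup>+s. ennreal ((\<phi> (y + s *\<^sub>R e))\<^sup>2) * indicator {0<..<\<delta>} s \<partial>lborel) + 2 * (ennreal \<delta> * J) * ennreal \<delta>"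
        using \<delta> by (subst nn_integral_add) (auto simp: nn_integral_cmult nn_integral_cmult_indicator)
      also have "2 * (ennreal \<delta> * J) * ennreal \<delta> = ennreal (2 * \<delta>\<^sup>2) * J"
        using \<delta> by (simp add: ennreal_mult power2_eq_square ac_simps)
      also have "2 * (\<integral>\<^sup>+s. ennreal ((\<phi> (y + s *\<^sub>R e))\<^sup>2) * indicator {0<..<\<delta>} s \<partial>lborel) + ennreal (2 * \<delta>\<^sup>2) * J
          \<le> ennreal B * (\<integral>\<^sup>+s. ennreal ((\<phi> (y + s *\<^sub>R e))\<^sup>2) * indicator {0<..<\<delta>} s \<partial>lborel) + ennreal B * J"
        by (intro add_mono mult_right_mono) (auto simp: B_def simp flip: ennreal_numeral intro!: ennreal_leI)
      also have "\<dots> = (\<integral>\<^sup>+s. F (y + s *\<^sub>R e) \<partial>time_measure)"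
        unfolding time F_def J_def distrib_left[symmetric]
        by (subst nn_integral_add[symmetric]) (auto simp: nn_integral_cmult[symmetric] distrib_right mult.assoc)
      finally show ?thesis .
    qed
    have "ennreal \<delta> * (\<integral>\<^sup>+y. ennreal ((\<phi> y)\<^sup>2) \<partial>patch_measure) = (\<integral>\<^sup>+y. ennreal \<delta> * ennreal ((\<phi> y)\<^sup>2) \<partial>patch_measure)"
      using measurable_surface_on_borel[OF smooth_borel_measurable[OF \<phi>]] by (subst nn_integral_cmult) auto
    also have "\<dots> \<le> (\<integral>\<^sup>+y. \<integral>\<^sup>+s. F (y + s *\<^sub>R e) \<partial>time_measure \<partial>patch_measure)"
      by (intro nn_integral_mono pointwise)
    also have "\<dots> \<le> ennreal c * (\<integral>\<^sup>+x. F x \<partial>lebesgue_on \<Omega>)"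
      by (rule c(2)[OF F_meas])
    also have "(\<integral>\<^sup>+x. F x \<partial>lebesgue_on \<Omega>) = ennreal B * energy \<Omega> \<phi>"
      using measurable_lebesgue_on_borel[OF smooth_borel_measurable[OF \<phi>]] measurable_lebesgue_on_borel[OF borel_measurable_gradient[OF \<phi>]]
      unfolding F_def by (simp add: nn_integral_cmult nn_integral_add)
    finally have "ennreal (1 / \<delta>) * (ennreal \<delta> * (\<integral>\<^sup>+y. ennreal ((\<phi> y)\<^sup>2) \<partial>patch_measure))
        \<le> ennreal (1 / \<delta>) * (ennreal c * (ennreal B * energy \<Omega> \<phi>))"
      by (rule mult_left_mono) simp
    then show ?thesis
      using \<delta> c(1) by (simp add: mult.assoc[symmetric] ennreal_mult[symmetric] B_def max_def split: if_splits)
  qed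
  show ?thesis
    using \<delta> c(1) by (intro exI[of _ "c * B / \<delta>"] conjI allI impI bound) (auto simp: B_def)
qed

end

text \<open>The frontier is compact, so finitely many patches cover it and their constants add
  up.\<close>

lemma trace_inequality:
  fixes \<Omega> :: "'a::euclidean_space set"
  assumes \<Omega>: "bounded_lipschitz_domain \<Omega>"
  shows "\<exists>C\<ge>0. \<forall>\<phi>. smooth \<phi> \<longrightarrow> (\<integral>\<^sup>+y. ennreal ((\<phi> y)\<^sup>2) \<partial>surface_on (frontier \<Omega>))
     \<le> ennreal C * energy \<Omega> \<phi>"
proof -
  have "\<exists>\<rho> C. \<rho> > 0 \<and> C \<ge> 0 \<and> (\<forall>\<phi>. smooth \<phi> \<longrightarrow>
      (\<integral>\<^sup>+y. ennreal ((\<phi> y)\<^sup>2) \<partial>surface_on (frontier \<Omega> \<inter> cball x \<rho>)) \<le> ennreal C * energy \<Omega> \<phi>)"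
    if x: "x \<in> frontier \<Omega>" for x
  proof -
    have "lipschitz_boundary \<Omega>"
      using \<Omega> by (simp add: bounded_lipschitz_domain_def)
    then obtain r e f L where patch: "r > 0" "norm e = 1" "L-lipschitz_on {z. z \<bullet> e = 0} f"
        "\<forall>y\<in>ball x r. y \<in> \<Omega> \<longleftrightarrow> f (y - (y \<bullet> e) *\<^sub>R e) < y \<bullet> e"
      using x unfolding lipschitz_boundary_def by blast
    interpret lipschitz_graph_patch \<Omega> x e r L f
      by standard (use patch \<Omega> in \<open>auto simp: bounded_lipschitz_domain_def\<close>)
    from patch_trace_inequality obtain C where "C \<ge> 0" "\<forall>\<phi>. smooth \<phi> \<longrightarrow>
        (\<integral>\<^sup>+y. ennreal ((\<phi> y)\<^sup>2) \<partial>surface_on (frontier \<Omega> \<inter> cball x (r / 2))) \<le> ennreal C * energy \<Omega> \<phi>"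
      unfolding patch_def by blast
    then show ?thesis
      using patch(1) by (intro exI[of _ "r / 2"] exI[of _ C]) simp
  qed
  then obtain \<rho> C where \<rho>: "\<And>x. x \<in> frontier \<Omega> \<Longrightarrow> \<rho> x > 0" and C: "\<And>x. x \<in> frontier \<Omega> \<Longrightarrow> C x \<ge> 0"
    and bound: "\<And>x \<phi>. x \<in> frontier \<Omega> \<Longrightarrow> smooth \<phi> \<Longrightarrow>
      (\<integral>\<^sup>+y. ennreal ((\<phi> y)\<^sup>2) \<partial>surface_on (frontier \<Omega> \<inter> cball x (\<rho> x))) \<le> ennreal (C x) * energy \<Omega> \<phi>"
    by metis
  have "compact (frontier \<Omega>)"
    using \<Omega> by (intro compact_frontier_bounded) (simp add: bounded_lipschitz_domain_def)
  moreover have "open (ball x (\<rho> x))" for x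
    by (rule open_ball)
  moreover have "frontier \<Omega> \<subseteq> (\<Union>x\<in>frontier \<Omega>. ball x (\<rho> x))"
    using \<rho> by force
  ultimately obtain D where D: "D \<subseteq> frontier \<Omega>" "finite D" "frontier \<Omega> \<subseteq> (\<Union>x\<in>D. ball x (\<rho> x))"
    by (rule compactE_image) (rule that)
  have total: "(\<integral>\<^sup>+y. ennreal ((\<phi> y)\<^sup>2) \<partial>surface_on (frontier \<Omega>)) \<le> ennreal (\<Sum>x\<in>D. C x) * energy \<Omega> \<phi>"
    if \<phi>: "smooth \<phi>" for \<phi>
  proof -
    let ?H = "hausdorff_measure (DIM('a) - 1) :: 'a measure"
    have meas: "(\<lambda>y. ennreal ((\<phi> y)\<^sup>2) * indicator (frontier \<Omega> \<inter> cball x (\<rho> x)) y) \<in> borel_measurable ?H" for x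
    proof (rule measurable_hausdorff_measure_borel)
      have [measurable]: "frontier \<Omega> \<inter> cball x (\<rho> x) \<in> sets borel" "\<phi> \<in> borel_measurable borel"
        using smooth_borel_measurable[OF \<phi>] by (auto intro!: borel_closed closed_Int)
      show "(\<lambda>y. ennreal ((\<phi> y)\<^sup>2) * indicator (frontier \<Omega> \<inter> cball x (\<rho> x)) y) \<in> borel_measurable borel"
        by measurable
    qed
    have "(\<integral>\<^sup>+y. ennreal ((\<phi> y)\<^sup>2) \<partial>surface_on (frontier \<Omega>)) = (\<integral>\<^sup>+y. ennreal ((\<phi> y)\<^sup>2) * indicator (frontier \<Omega>) y \<partial>?H)"
      by (rule nn_integral_surface_on) simp
    also have "\<dots> \<le> (\<integral>\<^sup>+y. (\<Sum>x\<in>D. ennreal ((\<phi> y)\<^sup>2) * indicator (frontier \<Omega> \<inter> cball x (\<rho> x)) y) \<partial>?H)"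
    proof (rule nn_integral_mono)
      fix y
      show "ennreal ((\<phi> y)\<^sup>2) * indicator (frontier \<Omega>) y
          \<le> (\<Sum>x\<in>D. ennreal ((\<phi> y)\<^sup>2) * indicator (frontier \<Omega> \<inter> cball x (\<rho> x)) y)"
      proof (cases "y \<in> frontier \<Omega>")
        case True
        then obtain x where "x \<in> D" "y \<in> cball x (\<rho> x)"
          using D(3) by fastforce
        then show ?thesis
          using True D(2) member_le_sum[of x D "\<lambda>x. ennreal ((\<phi> y)\<^sup>2) * indicator (frontier \<Omega> \<inter> cball x (\<rho> x)) y"] by simp
      qed simp
    qed
    also have "\<dots> = (\<Sum>x\<in>D. \<integral>\<^sup>+y. ennreal ((\<phi> y)\<^sup>2) * indicator (frontier \<Omega> \<inter> cball x (\<rho> x)) y \<partial>?H)"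
      by (rule nn_integral_sum) (rule meas)
    also have "\<dots> = (\<Sum>x\<in>D. \<integral>\<^sup>+y. ennreal ((\<phi> y)\<^sup>2) \<partial>surface_on (frontier \<Omega> \<inter> cball x (\<rho> x)))"
      by (intro sum.cong refl nn_integral_surface_on[symmetric]) auto
    also have "\<dots> \<le> (\<Sum>x\<in>D. ennreal (C x) * energy \<Omega> \<phi>)"
      using D(1) by (intro sum_mono bound \<phi>) auto
    also have "\<dots> = ennreal (\<Sum>x\<in>D. C x) * energy \<Omega> \<phi>"
      using D(1) C by (subst sum_distrib_right[symmetric], subst sum_ennreal) auto
    finally show ?thesis .
  qed
  show ?thesis
    using D(1) C by (intro exI[of _ "\<Sum>x\<in>D. C x"] conjI allI impI total) (auto intro!: sum_nonneg)
qed

section \<open>Uniqueness of gradients and traces\<close>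

lemma finite_measure_lebesgue_on_bounded:
  assumes "bounded \<Omega>" "open \<Omega>"
  shows "finite_measure (lebesgue_on \<Omega>)"
proof
  have "emeasure lebesgue \<Omega> < \<infinity>"
    using assms emeasure_bounded_finite[OF assms(1)] by simp
  then show "emeasure (lebesgue_on \<Omega>) (space (lebesgue_on \<Omega>)) \<noteq> \<infinity>"
    using assms by (simp add: emeasure_restrict_space space_restrict_space)
qed

text \<open>The trace inequality for the constant function 1 bounds the area of the boundary by the
  volume of the domain.\<close>

lemma finite_measure_surface_on_frontier:
  assumes "bounded_lipschitz_domain \<Omega>"
  shows "finite_measure (surface_on (frontier \<Omega>))"
proof
  interpret finite_measure "lebesgue_on \<Omega>"
    using assms by (intro finite_measure_lebesgue_on_bounded) (auto simp: bounded_lipschitz_domain_def)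
  obtain C where "\<forall>\<phi>. smooth \<phi> \<longrightarrow> (\<integral>\<^sup>+y. ennreal ((\<phi> y)\<^sup>2) \<partial>surface_on (frontier \<Omega>))
     \<le> ennreal C * energy \<Omega> \<phi>"
    using trace_inequality[OF assms] by blast
  from this[rule_format, OF smooth_const[of 1]] have "emeasure (surface_on (frontier \<Omega>)) (space (surface_on (frontier \<Omega>)))
      \<le> ennreal C * emeasure (lebesgue_on \<Omega>) (space (lebesgue_on \<Omega>))"
    by (simp add: gradient_const)
  also have "\<dots> < \<infinity>"
    unfolding infinity_ennreal_def less_top[symmetric] by (simp add: ennreal_mult_eq_top_iff)
  finally show "emeasure (surface_on (frontier \<Omega>)) (space (surface_on (frontier \<Omega>))) \<noteq> \<infinity>"
    by simp
qed

lemma integrable_mult_bounded: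
  assumes "\<phi> \<in> borel_measurable M" "\<And>x. \<bar>\<phi> x\<bar> \<le> B" "integrable M f"
  shows "integrable M (\<lambda>x. f x * \<phi> x :: real)"
proof (rule Bochner_Integration.integrable_bound)
  show "integrable M (\<lambda>x. B * f x)" using assms(3) by simp
  show "AE x in M. norm (f x * \<phi> x) \<le> norm (B * f x)"
  proof (rule AE_I2)
    fix x
    have "\<bar>\<phi> x\<bar> * \<bar>f x\<bar> \<le> \<bar>B\<bar> * \<bar>f x\<bar>"
      using assms(2)[of x] by (intro mult_right_mono) auto
    then show "norm (f x * \<phi> x) \<le> norm (B * f x)"
      by (simp add: abs_mult mult.commute)
  qed
qed (use assms in \<open>auto intro: borel_measurable_times\<close>)

text \<open>Smooth functions satisfy the weak gradient identity, and against a fixed test function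
  both sides are continuous for L1 convergence of functions and gradients.\<close>

lemma approx_trace_has_weak_gradient:
  fixes \<Omega> :: "'a::euclidean_space set"
  assumes \<Omega>: "open \<Omega>" "bounded \<Omega>" and approx: "approx_trace \<Omega> u G t"
  shows "has_weak_gradient \<Omega> u G"
  unfolding has_weak_gradient_def
proof (intro ballI)
  let ?M = "lebesgue_on \<Omega>"
  interpret finite_measure ?M
    using \<Omega> by (intro finite_measure_lebesgue_on_bounded)
  fix \<theta> and i :: 'a
  assume \<theta>: "\<theta> \<in> test_functions \<Omega>" and i: "i \<in> Basis"
  let ?d = "\<lambda>x. frechet_derivative \<theta> (at x) i"
  obtain B where B: "B \<ge> 0" "\<And>x. \<bar>\<theta> x\<bar> \<le> B" "\<And>x. \<bar>?d x\<bar> \<le> B"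
    using \<theta> i by (rule test_function_bounds) (rule that)
  have "smooth \<theta>" using \<theta> by (simp add: test_functions_def)
  then have \<theta>_meas: "\<theta> \<in> borel_measurable ?M" "?d \<in> borel_measurable ?M"
    using smooth_partial[OF _ i] by (blast intro: measurable_lebesgue_on_borel smooth_borel_measurable)+
  obtain \<phi> where \<phi>: "\<And>n. smooth (\<phi> n)"
    "\<And>n. dist_sq ?M u (\<phi> n) < \<infinity>" "(\<lambda>n. dist_sq ?M u (\<phi> n)) \<longlonglongrightarrow> 0"
    "\<And>n. dist_sq ?M G (gradient (\<phi> n)) < \<infinity>" "(\<lambda>n. dist_sq ?M G (gradient (\<phi> n))) \<longlonglongrightarrow> 0"
    using approx by (rule approx_traceE) (rule that)
  note L2 = approx_traceD(1,2)[OF approx]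
  have \<phi>_L2: "\<phi> n \<in> L2 ?M" "gradient (\<phi> n) \<in> L2 ?M" for n
    using L2_of_dist_sq[OF L2(1) _ \<phi>(2)[of n]] L2_of_dist_sq[OF L2(2) _ \<phi>(4)[of n]]
      measurable_lebesgue_on_borel smooth_borel_measurable[OF \<phi>(1)[of n]] borel_measurable_gradient[OF \<phi>(1)[of n]]
    by blast+
  let ?du = "\<lambda>n x. u x - \<phi> n x" and ?dG = "\<lambda>n x. G x - gradient (\<phi> n) x"
  have d_L2: "?du n \<in> L2 ?M" "?dG n \<in> L2 ?M" for n
    by (intro L2_diff L2 \<phi>_L2)+
  have int_d: "integrable ?M (?du n)" "integrable ?M (\<lambda>x. ?dG n x \<bullet> i)" for n
    using L2_integrable[OF d_L2(1)[of n]] L2_integrable[OF d_L2(2)[of n]] by auto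
  have int_\<phi>: "integrable ?M (\<phi> n)" "integrable ?M (\<lambda>x. gradient (\<phi> n) x \<bullet> i)" for n
    using L2_integrable[OF \<phi>_L2(1)[of n]] L2_integrable[OF \<phi>_L2(2)[of n]] by auto
  \<comment> \<open>The defect of the identity for \<open>u\<close> and \<open>G\<close>. The defect
    of each \<open>\<phi> n\<close> is zero, so only the differences contribute to it.\<close>
  define I where "I = (\<integral>x. u x * ?d x \<partial>?M) + (\<integral>x. (G x \<bullet> i) * \<theta> x \<partial>?M)"
  have I_le: "\<bar>I\<bar> \<le> B * (\<integral>x. norm (?du n x) \<partial>?M) + B * (\<integral>x. norm (?dG n x) \<partial>?M)" for n
  proof -
    note ints = integrable_mult_bounded[OF \<theta>_meas(2) B(3) int_d(1)[of n]]
      integrable_mult_bounded[OF \<theta>_meas(2) B(3) int_\<phi>(1)[of n]]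
      integrable_mult_bounded[OF \<theta>_meas(1) B(2) int_d(2)[of n]]
      integrable_mult_bounded[OF \<theta>_meas(1) B(2) int_\<phi>(2)[of n]]
    have "(\<integral>x. \<phi> n x * ?d x \<partial>?M) = - (\<integral>x. (gradient (\<phi> n) x \<bullet> i) * \<theta> x \<partial>?M)"
      using smooth_has_weak_gradient[OF \<phi>(1)[of n], of \<Omega>] \<Omega>(1) \<theta> i by (auto simp: has_weak_gradient_def)
    moreover have "(\<integral>x. u x * ?d x \<partial>?M) = (\<integral>x. ?du n x * ?d x + \<phi> n x * ?d x \<partial>?M)"
      by (simp add: algebra_simps)
    then have "(\<integral>x. u x * ?d x \<partial>?M) = (\<integral>x. ?du n x * ?d x \<partial>?M) + (\<integral>x. \<phi> n x * ?d x \<partial>?M)"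
      using Bochner_Integration.integral_add[OF ints(1,2)] by simp
    moreover have "(\<integral>x. (G x \<bullet> i) * \<theta> x \<partial>?M) = (\<integral>x. (?dG n x \<bullet> i) * \<theta> x + (gradient (\<phi> n) x \<bullet> i) * \<theta> x \<partial>?M)"
      by (simp add: algebra_simps)
    then have "(\<integral>x. (G x \<bullet> i) * \<theta> x \<partial>?M) = (\<integral>x. (?dG n x \<bullet> i) * \<theta> x \<partial>?M) + (\<integral>x. (gradient (\<phi> n) x \<bullet> i) * \<theta> x \<partial>?M)"
      using Bochner_Integration.integral_add[OF ints(3,4)] by simp
    ultimately have "I = (\<integral>x. ?du n x * ?d x \<partial>?M) + (\<integral>x. (?dG n x \<bullet> i) * \<theta> x \<partial>?M)"
      by (simp add: I_def)
    moreover have "\<bar>\<integral>x. ?du n x * ?d x \<partial>?M\<bar> \<le> (\<integral>x. B * norm (?du n x) \<partial>?M)"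
    proof (rule integral_abs_bound[THEN order_trans], rule integral_mono)
      show "\<bar>?du n x * ?d x\<bar> \<le> B * norm (?du n x)" for x
        using mult_left_mono[OF B(3)[of x], of "\<bar>?du n x\<bar>"] by (simp add: abs_mult mult.commute)
    qed (use ints(1) int_d(1)[of n] in auto)
    moreover have "\<bar>\<integral>x. (?dG n x \<bullet> i) * \<theta> x \<partial>?M\<bar> \<le> (\<integral>x. B * norm (?dG n x) \<partial>?M)"
    proof (rule integral_abs_bound[THEN order_trans], rule integral_mono)
      show "\<bar>(?dG n x \<bullet> i) * \<theta> x\<bar> \<le> B * norm (?dG n x)" for x
        using mult_mono[OF Basis_le_norm[OF i, of "?dG n x"] B(2)[of x]] by (simp add: abs_mult mult.commute)
    qed (use ints(3) L2_integrable[OF d_L2(2)[of n]] in auto)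
    ultimately show ?thesis by simp
  qed
  have "(\<lambda>n. B * (\<integral>x. norm (?du n x) \<partial>?M) + B * (\<integral>x. norm (?dG n x) \<partial>?M)) \<longlonglongrightarrow> B * 0 + B * 0"
    by (intro tendsto_intros L1_tendsto_0_if_dist_sq d_L2 \<phi>)
  then have "\<bar>I\<bar> \<le> 0"
    using I_le by (intro LIMSEQ_le_const[of _ _ "\<bar>I\<bar>"]) auto
  then show "(\<integral>x. u x * ?d x \<partial>?M) = - (\<integral>x. (G x \<bullet> i) * \<theta> x \<partial>?M)"
    by (simp add: I_def)
qed

lemma weak_gradient_unique:
  fixes \<Omega> :: "'a::euclidean_space set"
  assumes \<Omega>: "open \<Omega>" "bounded \<Omega>" and L2: "G \<in> L2 (lebesgue_on \<Omega>)" "G' \<in> L2 (lebesgue_on \<Omega>)"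
    and weak: "has_weak_gradient \<Omega> u G" "has_weak_gradient \<Omega> u G'"
  shows "AE x in lebesgue_on \<Omega>. G x = G' x"
proof -
  let ?M = "lebesgue_on \<Omega>"
  interpret finite_measure ?M
    using \<Omega> by (intro finite_measure_lebesgue_on_bounded)
  have "AE x in ?M. G x \<bullet> i - G' x \<bullet> i = 0" if i: "i \<in> Basis" for i
  proof (rule fundamental_lemma_calculus_of_variations[OF \<Omega>(1)])
    have int: "integrable ?M (\<lambda>x. G x \<bullet> i)" "integrable ?M (\<lambda>x. G' x \<bullet> i)"
      using L2[THEN L2_integrable] by auto
    then show "integrable ?M (\<lambda>x. G x \<bullet> i - G' x \<bullet> i)" by simp
    fix \<theta> assume \<theta>: "\<theta> \<in> test_functions \<Omega>"
    obtain B where B: "\<And>x. \<bar>\<theta> x\<bar> \<le> B"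
      using test_function_bounds[OF \<theta> i] by blast
    have "\<theta> \<in> borel_measurable ?M"
      using \<theta> by (intro measurable_lebesgue_on_borel smooth_borel_measurable) (simp add: test_functions_def)
    note ints = int[THEN integrable_mult_bounded[OF this B]]
    have "(\<integral>x. (G x \<bullet> i) * \<theta> x \<partial>?M) = (\<integral>x. (G' x \<bullet> i) * \<theta> x \<partial>?M)"
      using weak \<theta> i by (simp add: has_weak_gradient_def)
    then show "(\<integral>x. (G x \<bullet> i - G' x \<bullet> i) * \<theta> x \<partial>?M) = 0"
      using Bochner_Integration.integral_diff[OF ints] by (simp add: left_diff_distrib)
  qed
  then have "AE x in ?M. \<forall>i\<in>Basis. G x \<bullet> i - G' x \<bullet> i = 0"
    by (intro AE_finite_allI) auto
  then show ?thesis
    by eventually_elim (auto intro: euclidean_eqI)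
qed

lemma bounded_lipschitz_domainD:
  assumes "bounded_lipschitz_domain \<Omega>"
  shows "open \<Omega>" "bounded \<Omega>" "connected \<Omega>" "\<Omega> \<noteq> {}"
  using assms by (auto simp: bounded_lipschitz_domain_def)

text \<open>Closability, to which all uniqueness statements reduce by linearity. The zero function
  has zero weak gradient, so the approximants tend to zero in function and gradient; the trace
  inequality then forces their boundary values to zero as well.\<close>

lemma approx_trace_zero:
  assumes \<Omega>: "bounded_lipschitz_domain \<Omega>" and approx: "approx_trace \<Omega> u G t"
    and zero: "AE x in lebesgue_on \<Omega>. u x = 0"
  shows "AE x in lebesgue_on \<Omega>. G x = 0" "AE x in surface_on (frontier \<Omega>). t x = 0"
proof -
  let ?M = "lebesgue_on \<Omega>" and ?S = "surface_on (frontier \<Omega>)"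
  note dom = bounded_lipschitz_domainD[OF \<Omega>]
  interpret M: finite_measure ?M
    using dom by (intro finite_measure_lebesgue_on_bounded)
  show G0: "AE x in ?M. G x = 0"
  proof (rule weak_gradient_unique[OF dom(1,2)])
    show "G \<in> L2 ?M" using approx by (rule approx_traceD)
    show "(\<lambda>x. 0) \<in> L2 ?M" by (rule M.L2_const)
    show "has_weak_gradient \<Omega> u G"
      using dom(1,2) approx by (rule approx_trace_has_weak_gradient)
    have "(\<integral>x. u x * frechet_derivative \<phi> (at x) i \<partial>?M) = 0" for \<phi> i
      by (rule integral_eq_zero_AE) (use zero in \<open>auto elim!: eventually_mono\<close>)
    then show "has_weak_gradient \<Omega> u (\<lambda>x. 0)"
      by (simp add: has_weak_gradient_def)
  qed
  obtain \<phi> where \<phi>: "\<And>n. smooth (\<phi> n)"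
    "(\<lambda>n. dist_sq ?M u (\<phi> n)) \<longlonglongrightarrow> 0" "(\<lambda>n. dist_sq ?M G (gradient (\<phi> n))) \<longlonglongrightarrow> 0"
    "(\<lambda>n. dist_sq ?S t (\<phi> n)) \<longlonglongrightarrow> 0"
    using approx by (rule approx_traceE) (rule that)
  obtain C where C: "C \<ge> 0" "\<And>\<phi>. smooth \<phi> \<Longrightarrow> (\<integral>\<^sup>+y. ennreal ((\<phi> y)\<^sup>2) \<partial>?S)
      \<le> ennreal C * energy \<Omega> \<phi>"
    using trace_inequality[OF \<Omega>] by blast
  have u_eq: "dist_sq ?M u (\<phi> n) = (\<integral>\<^sup>+x. ennreal ((\<phi> n x)\<^sup>2) \<partial>?M)" for n
    unfolding dist_sq_def by (rule nn_integral_cong_AE) (use zero in \<open>auto elim!: eventually_mono\<close>)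
  have G_eq: "dist_sq ?M G (gradient (\<phi> n)) = (\<integral>\<^sup>+x. ennreal ((norm (gradient (\<phi> n) x))\<^sup>2) \<partial>?M)" for n
    unfolding dist_sq_def by (rule nn_integral_cong_AE) (use G0 in \<open>auto elim!: eventually_mono\<close>)
  \<comment> \<open>The distance of \<open>t\<close> to zero passes through \<open>\<phi> n\<close>,
    whose boundary norm is controlled by the trace inequality; every term tends to zero.\<close>
  let ?b = "\<lambda>n. 2 * dist_sq ?S t (\<phi> n) + 2 * (ennreal C * (dist_sq ?M u (\<phi> n) + dist_sq ?M G (gradient (\<phi> n))))"
  have t_meas: "t \<in> borel_measurable ?S" using approx by (rule approx_traceD)
  have "dist_sq ?S t (\<lambda>x. 0) \<le> ?b n" for n
  proof -
    have "dist_sq ?S t (\<lambda>x. 0) \<le> 2 * dist_sq ?S t (\<phi> n) + 2 * dist_sq ?S (\<phi> n) (\<lambda>x. 0)"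
      using t_meas measurable_surface_on_borel[OF smooth_borel_measurable[OF \<phi>(1)]] by (intro dist_sq_triangle) auto
    also have "dist_sq ?S (\<phi> n) (\<lambda>x. 0) \<le> ennreal C * (dist_sq ?M u (\<phi> n) + dist_sq ?M G (gradient (\<phi> n)))"
      using C(2)[OF \<phi>(1)[of n]] unfolding u_eq G_eq by (simp add: dist_sq_def)
    finally show ?thesis by (simp add: add_left_mono mult_left_mono)
  qed
  moreover have "?b \<longlonglongrightarrow> 2 * 0 + 2 * (ennreal C * (0 + 0))"
    by (intro tendsto_add ennreal_tendsto_cmult \<phi>(2-4)) auto
  ultimately have "dist_sq ?S t (\<lambda>x. 0) \<le> 0"
    by (intro LIMSEQ_le_const[of ?b]) auto
  then show "AE x in ?S. t x = 0"
    using t_meas by (intro AE_eq_if_dist_sq_0) auto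
qed

lemma approx_trace_unique:
  assumes \<Omega>: "bounded_lipschitz_domain \<Omega>" and approx: "approx_trace \<Omega> u G t" "approx_trace \<Omega> u' G' t'"
    and eq: "AE x in lebesgue_on \<Omega>. u x = u' x"
  shows "AE x in lebesgue_on \<Omega>. G x = G' x" "AE x in surface_on (frontier \<Omega>). t x = t' x"
proof -
  have "AE x in lebesgue_on \<Omega>. u x - u' x = 0"
    using eq by eventually_elim simp
  from approx_trace_zero[OF \<Omega> approx_trace_diff[OF approx] this]
  show "AE x in lebesgue_on \<Omega>. G x = G' x" "AE x in surface_on (frontier \<Omega>). t x = t' x"
    by simp_all
qed

section \<open>Agreement with the chosen weak gradient and boundary trace\<close>

lemma weak_gradient_in_L2:
  assumes "u \<in> H1 \<Omega>"
  shows "weak_gradient \<Omega> u \<in> L2 (lebesgue_on \<Omega>)" "has_weak_gradient \<Omega> u (weak_gradient \<Omega> u)"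
proof -
  have "\<exists>G. G \<in> L2 (lebesgue_on \<Omega>) \<and> has_weak_gradient \<Omega> u G"
    using assms by (auto simp: H1_def)
  from someI_ex[OF this]
  show "weak_gradient \<Omega> u \<in> L2 (lebesgue_on \<Omega>)" "has_weak_gradient \<Omega> u (weak_gradient \<Omega> u)"
    by (simp_all add: weak_gradient_def)
qed

lemma has_trace_imp_approx_trace:
  assumes "has_trace \<Omega> u t"
  shows "approx_trace \<Omega> u (weak_gradient \<Omega> u) t"
proof -
  from assms obtain \<phi> where "u \<in> H1 \<Omega>" and t: "t \<in> L2 (surface_on (frontier \<Omega>))"
    and \<phi>: "\<And>n. smooth (\<phi> n)"
      "(\<lambda>n. \<integral>\<^sup>+x. ennreal ((u x - \<phi> n x)\<^sup>2) \<partial>lebesgue_on \<Omega>) \<longlonglongrightarrow> 0"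
      "(\<lambda>n. \<integral>\<^sup>+x. ennreal ((norm (weak_gradient \<Omega> u x - gradient (\<phi> n) x))\<^sup>2) \<partial>lebesgue_on \<Omega>) \<longlonglongrightarrow> 0"
      "(\<lambda>n. \<integral>\<^sup>+x. ennreal ((t x - \<phi> n x)\<^sup>2) \<partial>surface_on (frontier \<Omega>)) \<longlonglongrightarrow> 0"
    unfolding has_trace_def by blast
  then show ?thesis
    by (intro approx_traceI[where \<phi> = \<phi>] weak_gradient_in_L2(1)) (auto simp: dist_sq_def H1_def)
qed

text \<open>\<open>has_trace\<close> measures gradients against the chosen
  \<open>weak_gradient\<close>, which by uniqueness agrees with \<open>G\<close> almost everywhere,
  so the same approximants serve.\<close>

lemma approx_trace_imp_has_trace:
  assumes \<Omega>: "bounded_lipschitz_domain \<Omega>" and approx: "approx_trace \<Omega> u G t"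
  shows "u \<in> H1 \<Omega>" "AE x in lebesgue_on \<Omega>. weak_gradient \<Omega> u x = G x" "has_trace \<Omega> u t"
proof -
  let ?M = "lebesgue_on \<Omega>" and ?S = "surface_on (frontier \<Omega>)"
  note dom = bounded_lipschitz_domainD[OF \<Omega>]
  have weak: "has_weak_gradient \<Omega> u G"
    using dom(1,2) approx by (rule approx_trace_has_weak_gradient)
  show H1: "u \<in> H1 \<Omega>"
    using approx_traceD(1,2)[OF approx] weak by (auto simp: H1_def)
  show ae: "AE x in ?M. weak_gradient \<Omega> u x = G x"
    using weak_gradient_in_L2[OF H1] approx_traceD(2)[OF approx] weak
    by (intro weak_gradient_unique[OF dom(1,2)])
  obtain \<phi> where \<phi>: "\<And>n. smooth (\<phi> n)"
    "(\<lambda>n. dist_sq ?M u (\<phi> n)) \<longlonglongrightarrow> 0" "(\<lambda>n. dist_sq ?M G (gradient (\<phi> n))) \<longlonglongrightarrow> 0"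
    "(\<lambda>n. dist_sq ?S t (\<phi> n)) \<longlonglongrightarrow> 0"
    using approx by (rule approx_traceE) (rule that)
  have "dist_sq ?M G (gradient (\<phi> n)) = (\<integral>\<^sup>+x. ennreal ((norm (weak_gradient \<Omega> u x - gradient (\<phi> n) x))\<^sup>2) \<partial>?M)" for n
    unfolding dist_sq_def by (rule nn_integral_cong_AE) (use ae in \<open>auto elim!: eventually_mono\<close>)
  with \<phi> show "has_trace \<Omega> u t"
    using H1 approx_traceD(3)[OF approx] unfolding has_trace_def
    by (intro conjI exI[of _ \<phi>]) (auto simp: dist_sq_def)
qed

text \<open>The given triple shows that the choice in \<open>boundary_trace\<close> is made from a
  nonempty set; uniqueness then identifies the chosen trace with \<open>t\<close> almost
  everywhere.\<close>

lemma boundary_trace_eq: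
  assumes \<Omega>: "bounded_lipschitz_domain \<Omega>" and approx: "approx_trace \<Omega> u G t"
  shows "approx_trace \<Omega> u (weak_gradient \<Omega> u) (boundary_trace \<Omega> u)"
    "AE x in surface_on (frontier \<Omega>). boundary_trace \<Omega> u x = t x"
proof -
  have "has_trace \<Omega> u (boundary_trace \<Omega> u)"
    using someI[of "has_trace \<Omega> u" t, OF approx_trace_imp_has_trace(3)[OF assms]] by (simp add: boundary_trace_def)
  then show "approx_trace \<Omega> u (weak_gradient \<Omega> u) (boundary_trace \<Omega> u)"
    by (rule has_trace_imp_approx_trace)
  from approx_trace_unique(2)[OF \<Omega> this approx]
  show "AE x in surface_on (frontier \<Omega>). boundary_trace \<Omega> u x = t x"
    by simp
qed

section \<open>Functions with vanishing gradient\<close>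

lemma nn_integral_lborel_shift:
  fixes h :: "'a::euclidean_space"
  assumes "F \<in> borel_measurable borel"
  shows "(\<integral>\<^sup>+x. F (x + h) \<partial>lborel) = (\<integral>\<^sup>+x. F x \<partial>lborel)"
proof -
  have "(\<integral>\<^sup>+x. F x \<partial>distr lborel borel ((+) h)) = (\<integral>\<^sup>+x. F (h + x) \<partial>lborel)"
    using assms by (intro nn_integral_distr) auto
  then show ?thesis
    by (simp add: lborel_distr_plus add.commute)
qed

lemma nn_integral_shift_le:
  fixes h :: "'a::euclidean_space"
  assumes "F \<in> borel_measurable borel" "\<Omega> \<in> sets borel" "\<And>x. x \<in> S \<Longrightarrow> x + h \<in> \<Omega>"
  shows "(\<integral>\<^sup>+x. F (x + h) * indicator S x \<partial>lborel) \<le> (\<integral>\<^sup>+x. F x * indicator \<Omega> x \<partial>lborel)"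
proof -
  have "(\<integral>\<^sup>+x. F (x + h) * indicator S x \<partial>lborel) \<le> (\<integral>\<^sup>+x. F (x + h) * indicator \<Omega> (x + h) \<partial>lborel)"
    using assms(3) by (intro nn_integral_mono) (auto simp: indicator_def)
  also have "\<dots> = (\<integral>\<^sup>+x. F x * indicator \<Omega> x \<partial>lborel)"
    using assms(1,2) by (intro nn_integral_lborel_shift) auto
  finally show ?thesis .
qed

text \<open>\<open>smooth_line_estimate\<close> with \<open>s = 1\<close>, Fubini's theorem, and for
  each \<tau> the translation invariance of Lebesgue measure, since \<open>S\<close> moved by
  \<open>\<tau> h\<close> stays in \<Omega>.\<close>

lemma smooth_shift_estimate:
  fixes \<phi> :: "'a::euclidean_space \<Rightarrow> real"
  assumes \<phi>: "smooth \<phi>" and \<Omega>: "\<Omega> \<in> sets borel" and S: "S \<in> sets borel"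
    and sub: "\<And>x \<tau>. x \<in> S \<Longrightarrow> \<tau> \<in> {0<..<1} \<Longrightarrow> x + \<tau> *\<^sub>R h \<in> \<Omega>"
  shows "(\<integral>\<^sup>+x. ennreal ((\<phi> (x + h) - \<phi> x)\<^sup>2) * indicator S x \<partial>lborel)
    \<le> ennreal ((norm h)\<^sup>2) * (\<integral>\<^sup>+x. ennreal ((norm (gradient \<phi> x))\<^sup>2) * indicator \<Omega> x \<partial>lborel)"
proof -
  note [measurable] = smooth_borel_measurable[OF \<phi>] borel_measurable_gradient[OF \<phi>] \<Omega> S
  let ?D = "\<lambda>x. ennreal ((norm (gradient \<phi> x))\<^sup>2)"
  have "(\<integral>\<^sup>+x. ennreal ((\<phi> (x + h) - \<phi> x)\<^sup>2) * indicator S x \<partial>lborel)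
      \<le> (\<integral>\<^sup>+x. ennreal ((norm h)\<^sup>2) * (\<integral>\<^sup>+\<tau>. ?D (x + \<tau> *\<^sub>R h) * indicator {0<..<1} \<tau> * indicator S x \<partial>lborel) \<partial>lborel)"
  proof (rule nn_integral_mono)
    fix x
    show "ennreal ((\<phi> (x + h) - \<phi> x)\<^sup>2) * indicator S x
        \<le> ennreal ((norm h)\<^sup>2) * (\<integral>\<^sup>+\<tau>. ?D (x + \<tau> *\<^sub>R h) * indicator {0<..<1} \<tau> * indicator S x \<partial>lborel)"
      using smooth_line_estimate[OF \<phi>, of 1 x h] by (cases "x \<in> S") auto
  qed
  also have "\<dots> = ennreal ((norm h)\<^sup>2) * (\<integral>\<^sup>+x. \<integral>\<^sup>+\<tau>. ?D (x + \<tau> *\<^sub>R h) * indicator {0<..<1} \<tau> * indicator S x \<partial>lborel \<partial>lborel)"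
    by (rule nn_integral_cmult) measurable
  also have "(\<integral>\<^sup>+x. \<integral>\<^sup>+\<tau>. ?D (x + \<tau> *\<^sub>R h) * indicator {0<..<1} \<tau> * indicator S x \<partial>lborel \<partial>lborel)
      = (\<integral>\<^sup>+\<tau>. \<integral>\<^sup>+x. ?D (x + \<tau> *\<^sub>R h) * indicator {0<..<1} \<tau> * indicator S x \<partial>lborel \<partial>lborel)"
    by (rule lborel_pair.Fubini') measurable
  also have "\<dots> \<le> (\<integral>\<^sup>+\<tau>. (\<integral>\<^sup>+x. ?D x * indicator \<Omega> x \<partial>lborel) * indicator {0<..<1::real} \<tau> \<partial>lborel)"
  proof (rule nn_integral_mono)
    fix \<tau> :: real
    show "(\<integral>\<^sup>+x. ?D (x + \<tau> *\<^sub>R h) * indicator {0<..<1} \<tau> * indicator S x \<partial>lborel)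
        \<le> (\<integral>\<^sup>+x. ?D x * indicator \<Omega> x \<partial>lborel) * indicator {0<..<1} \<tau>"
      using nn_integral_shift_le[of ?D \<Omega> S "\<tau> *\<^sub>R h"] sub by (cases "\<tau> \<in> {0<..<1}") auto
  qed
  also have "\<dots> = (\<integral>\<^sup>+x. ?D x * indicator \<Omega> x \<partial>lborel)"
    by (subst nn_integral_cmult_indicator) auto
  finally show ?thesis
    by (simp add: mult_left_mono)
qed

lemma AE_lborel_open_ex:
  fixes U :: "'a::euclidean_space set"
  assumes "AE x in lborel. P x" "open U" "U \<noteq> {}"
  obtains x where "x \<in> U" "P x"
proof -
  from assms(1) obtain N where N: "{x \<in> space lborel. \<not> P x} \<subseteq> N" "N \<in> null_sets lborel"
    unfolding eventually_ae_filter by blast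
  have "negligible N"
    using N(2) by (simp add: negligible_iff_null_sets null_sets_completionI)
  then have "\<not> U \<subseteq> N"
    using open_not_negligible[OF assms(2,3)] negligible_subset by blast
  then show thesis
    using N(1) that by auto
qed

text \<open>Translations and Fubini's theorem are applied on \<open>lborel\<close>, which calls for
  a Borel representative.\<close>

lemma AE_lebesgue_on_borel_version:
  assumes "\<Omega> \<in> sets lebesgue" "u \<in> borel_measurable (lebesgue_on \<Omega>)"
  obtains w :: "'a::euclidean_space \<Rightarrow> real" where "w \<in> borel_measurable borel" "AE x in lborel. x \<in> \<Omega> \<longrightarrow> u x = w x"
proof -
  have "(\<lambda>x. indicator \<Omega> x *\<^sub>R u x) \<in> borel_measurable lebesgue"
    using assms by (simp add: borel_measurable_restrict_space_iff mult.commute)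
  then obtain w where "w \<in> borel_measurable lborel" "AE x in lborel. indicator \<Omega> x *\<^sub>R u x = w x"
    using completion_ex_borel_measurable_real by blast
  then show thesis
    by (intro that[of w]) (auto elim!: eventually_mono)
qed

lemma nn_integral_lebesgue_on_borel:
  assumes "\<Omega> \<in> sets borel" "F \<in> borel_measurable borel"
  shows "(\<integral>\<^sup>+x. F x \<partial>lebesgue_on \<Omega>) = (\<integral>\<^sup>+x. F x * indicator \<Omega> x \<partial>lborel)"
  using assms by (simp add: nn_integral_restrict_space nn_integral_completion)

lemma AE_lebesgue_onI:
  assumes "\<Omega> \<in> sets lebesgue" "AE x in lborel. x \<in> \<Omega> \<longrightarrow> P x"
  shows "AE x in lebesgue_on \<Omega>. P x"
  using AE_completion[OF assms(2)] assms(1) by (subst AE_restrict_space_iff) auto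

text \<open>The shift estimate passes to the limit along approximants whose gradients tend to zero,
  which leaves no difference between \<open>w\<close> and its translate.\<close>

lemma AE_shift_invariant:
  fixes \<Omega> :: "'a::euclidean_space set"
  assumes \<Omega>: "open \<Omega>" and approx: "approx_trace \<Omega> u G t" and G0: "AE x in lebesgue_on \<Omega>. G x = 0"
    and w: "w \<in> borel_measurable borel" "AE x in lborel. x \<in> \<Omega> \<longrightarrow> u x = w x"
    and S: "S \<in> sets borel" and sub: "\<And>x \<tau>. x \<in> S \<Longrightarrow> \<tau> \<in> {0..1} \<Longrightarrow> x + \<tau> *\<^sub>R h \<in> \<Omega>"
  shows "AE x in lborel. x \<in> S \<longrightarrow> w (x + h) = w x"
proof -
  let ?M = "lebesgue_on \<Omega>" and ?P = "restrict_space lborel S"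
  have \<Omega>_borel: "\<Omega> \<in> sets borel" using \<Omega> by simp
  obtain \<phi> where \<phi>: "\<And>n. smooth (\<phi> n)"
    "(\<lambda>n. dist_sq ?M u (\<phi> n)) \<longlonglongrightarrow> 0" "(\<lambda>n. dist_sq ?M G (gradient (\<phi> n))) \<longlonglongrightarrow> 0"
    using approx by (rule approx_traceE) (rule that)
  have P: "dist_sq ?P f g = (\<integral>\<^sup>+x. ennreal ((norm (f x - g x))\<^sup>2) * indicator S x \<partial>lborel)" for f g :: "'a \<Rightarrow> real"
    unfolding dist_sq_def using S by (subst nn_integral_restrict_space) auto
  let ?F = "\<lambda>n x. ennreal ((norm (w x - \<phi> n x))\<^sup>2)"
  note [measurable] = w(1) smooth_borel_measurable[OF \<phi>(1)] borel_measurable_gradient[OF \<phi>(1)]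
  have u_eq: "dist_sq ?M u (\<phi> n) = (\<integral>\<^sup>+x. ?F n x * indicator \<Omega> x \<partial>lborel)" for n
  proof -
    have "AE x in ?M. u x = w x"
      using \<Omega> w(2) by (intro AE_lebesgue_onI) auto
    then have "dist_sq ?M u (\<phi> n) = (\<integral>\<^sup>+x. ?F n x \<partial>?M)"
      unfolding dist_sq_def by (intro nn_integral_cong_AE) (auto elim!: eventually_mono)
    then show ?thesis
      using nn_integral_lebesgue_on_borel[OF \<Omega>_borel, of "?F n"] by simp
  qed
  have G_eq: "dist_sq ?M G (gradient (\<phi> n)) = (\<integral>\<^sup>+x. ennreal ((norm (gradient (\<phi> n) x))\<^sup>2) * indicator \<Omega> x \<partial>lborel)" for n
  proof -
    have "dist_sq ?M G (gradient (\<phi> n)) = (\<integral>\<^sup>+x. ennreal ((norm (gradient (\<phi> n) x))\<^sup>2) \<partial>?M)"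
      unfolding dist_sq_def using G0 by (intro nn_integral_cong_AE) (auto elim!: eventually_mono)
    then show ?thesis
      using nn_integral_lebesgue_on_borel[OF \<Omega>_borel, of "\<lambda>x. ennreal ((norm (gradient (\<phi> n) x))\<^sup>2)"] by simp
  qed
  \<comment> \<open>Bounds for the three differences on the way from \<open>w(x + h)\<close> through
    \<open>\<phi> n (x + h)\<close> and \<open>\<phi> n x\<close> to \<open>w x\<close>, with the
    factors of two triangle inequalities.\<close>
  let ?b = "\<lambda>n. 2 * dist_sq ?M u (\<phi> n)
    + 2 * (2 * (ennreal ((norm h)\<^sup>2) * dist_sq ?M G (gradient (\<phi> n))) + 2 * dist_sq ?M u (\<phi> n))"
  have "dist_sq ?P (\<lambda>x. w (x + h)) w \<le> ?b n" for n
  proof -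
    have m: "f \<in> borel_measurable ?P" if "f \<in> borel_measurable borel" for f :: "'a \<Rightarrow> real"
      using that by (intro measurable_restrict_space1) simp
    have A: "dist_sq ?P (\<lambda>x. w (x + h)) (\<lambda>x. \<phi> n (x + h)) \<le> dist_sq ?M u (\<phi> n)"
      unfolding P u_eq using nn_integral_shift_le[of "?F n" \<Omega> S h] sub[of _ 1] \<Omega>_borel by simp
    have B: "dist_sq ?P (\<lambda>x. \<phi> n (x + h)) (\<phi> n) \<le> ennreal ((norm h)\<^sup>2) * dist_sq ?M G (gradient (\<phi> n))"
      unfolding P G_eq using smooth_shift_estimate[OF \<phi>(1) \<Omega>_borel S, of h n] sub by simp
    have "dist_sq ?P w (\<phi> n) \<le> dist_sq ?M u (\<phi> n)"
      unfolding P u_eq using nn_integral_shift_le[of "?F n" \<Omega> S 0] sub[of _ 0] \<Omega>_borel by simp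
    then have C: "dist_sq ?P (\<phi> n) w \<le> dist_sq ?M u (\<phi> n)"
      unfolding dist_sq_commute[of ?P "\<phi> n" w] .
    have "dist_sq ?P (\<lambda>x. w (x + h)) w
        \<le> 2 * dist_sq ?P (\<lambda>x. w (x + h)) (\<lambda>x. \<phi> n (x + h)) + 2 * dist_sq ?P (\<lambda>x. \<phi> n (x + h)) w"
      by (intro dist_sq_triangle m) measurable
    also have "dist_sq ?P (\<lambda>x. \<phi> n (x + h)) w \<le> 2 * dist_sq ?P (\<lambda>x. \<phi> n (x + h)) (\<phi> n) + 2 * dist_sq ?P (\<phi> n) w"
      by (intro dist_sq_triangle m) measurable
    also have "2 * dist_sq ?P (\<lambda>x. w (x + h)) (\<lambda>x. \<phi> n (x + h))
        + 2 * (2 * dist_sq ?P (\<lambda>x. \<phi> n (x + h)) (\<phi> n) + 2 * dist_sq ?P (\<phi> n) w) \<le> ?b n"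
      by (intro add_mono mult_left_mono A B C) auto
    finally show ?thesis by (simp add: add_left_mono mult_left_mono)
  qed
  moreover have "?b \<longlonglongrightarrow> 2 * 0 + 2 * (2 * (ennreal ((norm h)\<^sup>2) * 0) + 2 * 0)"
    by (intro tendsto_add ennreal_tendsto_cmult \<phi>(2,3)) auto
  ultimately have "dist_sq ?P (\<lambda>x. w (x + h)) w \<le> 0"
    by (intro LIMSEQ_le_const[of ?b]) auto
  then have "AE x in ?P. w (x + h) = w x"
    by (intro AE_eq_if_dist_sq_0 measurable_restrict_space1) auto
  then show ?thesis
    using S by (subst (asm) AE_restrict_space_iff) auto
qed

text \<open>For each small \<open>h\<close>, \<open>w\<close> agrees with its translate by
  \<open>h\<close> at almost every point. Fubini's theorem exchanges the quantifiers: some fixed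
  \<open>x\<close> has \<open>w (x + h) = w x\<close> for almost every \<open>h\<close>, that is,
  \<open>w\<close> is constant on a ball around \<open>x\<close>.\<close>

lemma AE_locally_constant:
  fixes \<Omega> :: "'a::euclidean_space set"
  assumes \<Omega>: "open \<Omega>" and approx: "approx_trace \<Omega> u G t" and G0: "AE x in lebesgue_on \<Omega>. G x = 0"
    and w: "w \<in> borel_measurable borel" "AE x in lborel. x \<in> \<Omega> \<longrightarrow> u x = w x"
    and x0: "x0 \<in> \<Omega>"
  shows "\<exists>\<rho>>0. \<exists>c. AE y in lborel. y \<in> ball x0 \<rho> \<longrightarrow> w y = c"
proof -
  obtain R where R: "R > 0" "ball x0 R \<subseteq> \<Omega>"
    using \<Omega> x0 by (meson open_contains_ball)
  \<comment> \<open>Half for the point and half for the shift, so that the segments stay in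
    \<open>ball x0 R\<close>.\<close>
  define r where "r = R / 2"
  have r: "r > 0" using R by (simp add: r_def)
  note [measurable] = w(1)
  have [measurable]: "ball a s \<in> sets borel" for a :: 'a and s
    by simp
  have "AE x in lborel. x \<in> ball x0 r \<longrightarrow> w (x + h) = w x" if h: "h \<in> ball 0 r" for h
  proof (rule AE_shift_invariant[OF \<Omega> approx G0 w])
    fix x and \<tau> :: real assume x: "x \<in> ball x0 r" and \<tau>: "\<tau> \<in> {0..1}"
    have "norm (\<tau> *\<^sub>R h) \<le> norm h"
      using \<tau> by (simp add: mult_left_le_one_le)
    then have "dist x0 (x + \<tau> *\<^sub>R h) < R"
      using x h dist_triangle[of x0 "x + \<tau> *\<^sub>R h" x] by (simp add: dist_norm r_def)
    then show "x + \<tau> *\<^sub>R h \<in> \<Omega>" using R(2) by auto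
  qed simp
  then have shift: "AE x in lborel. h \<in> ball 0 r \<longrightarrow> x \<in> ball x0 r \<longrightarrow> w (x + h) = w x" for h
    by (cases "h \<in> ball 0 r") auto
  have "AE h in lborel. AE x in lborel. h \<in> ball 0 r \<longrightarrow> x \<in> ball x0 r \<longrightarrow> w (x + h) = w x"
    by (rule AE_I2) (rule shift)
  then have "AE x in lborel. AE h in lborel. h \<in> ball 0 r \<longrightarrow> x \<in> ball x0 r \<longrightarrow> w (x + h) = w x"
    by (subst (asm) lborel_pair.AE_commute) measurable
  \<comment> \<open>The point is taken within \<open>r / 2\<close> of \<open>x0\<close>, so that its
    ball of radius \<open>r\<close> still contains \<open>ball x0 (r / 2)\<close>.\<close>
  then obtain x where x: "x \<in> ball x0 (r / 2)" "AE h in lborel. h \<in> ball 0 r \<longrightarrow> x \<in> ball x0 r \<longrightarrow> w (x + h) = w x"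
    by (rule AE_lborel_open_ex[of _ "ball x0 (r / 2)"]) (use r in auto)
  have "x \<in> ball x0 r" using x(1) r by auto
  with x(2) have "AE h in lborel. x + h \<in> ball x r \<longrightarrow> w (x + h) = w x"
    by (auto elim!: eventually_mono simp: dist_norm)
  then have "AE y in distr lborel borel ((+) x). y \<in> ball x r \<longrightarrow> w y = w x"
    by (subst AE_distr_iff) measurable
  then have "AE y in lborel. y \<in> ball x r \<longrightarrow> w y = w x"
    unfolding lborel_distr_plus .
  moreover have "ball x0 (r / 2) \<subseteq> ball x r"
    using x(1) by (intro subsetI) (auto simp: dist_commute intro: dist_triangle_half_l)
  ultimately have "AE y in lborel. y \<in> ball x0 (r / 2) \<longrightarrow> w y = w x"
    by (auto elim!: eventually_mono)
  then show ?thesis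
    using r by (intro exI[of _ "r / 2"]) auto
qed

text \<open>The local constants agree at nearby points, because two of the balls meet in a nonempty
  open set, which is not null. Connectedness then makes them one constant.\<close>

lemma approx_trace_zero_gradient_constant:
  fixes \<Omega> :: "'a::euclidean_space set"
  assumes \<Omega>: "open \<Omega>" "connected \<Omega>" and approx: "approx_trace \<Omega> u G t" and G0: "AE x in lebesgue_on \<Omega>. G x = 0"
  shows "\<exists>c. AE x in lebesgue_on \<Omega>. u x = c"
proof -
  obtain w where w: "w \<in> borel_measurable borel" "AE x in lborel. x \<in> \<Omega> \<longrightarrow> u x = w x"
    using AE_lebesgue_on_borel_version[OF _ approx_traceD(4)[OF approx]] \<Omega>(1) by auto
  have "\<forall>x\<in>\<Omega>. \<exists>\<rho> c. \<rho> > 0 \<and> (AE y in lborel. y \<in> ball x \<rho> \<longrightarrow> w y = c)"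
    using AE_locally_constant[OF \<Omega>(1) approx G0 w] by blast
  then obtain \<rho> c where \<rho>: "\<And>x. x \<in> \<Omega> \<Longrightarrow> \<rho> x > 0"
    and c: "\<And>x. x \<in> \<Omega> \<Longrightarrow> AE y in lborel. y \<in> ball x (\<rho> x) \<longrightarrow> w y = c x"
    by metis
  have loc: "c x = c y" if x: "x \<in> \<Omega>" and y: "y \<in> \<Omega>" "y \<in> ball x (\<rho> x)" for x y
  proof -
    have "AE z in lborel. z \<in> ball x (\<rho> x) \<inter> ball y (\<rho> y) \<longrightarrow> c x = c y"
      using c[OF x] c[OF y(1)] by eventually_elim auto
    moreover have "y \<in> ball x (\<rho> x) \<inter> ball y (\<rho> y)"
      using y \<rho> by auto
    ultimately obtain z where "z \<in> ball x (\<rho> x) \<inter> ball y (\<rho> y)"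
        "z \<in> ball x (\<rho> x) \<inter> ball y (\<rho> y) \<longrightarrow> c x = c y"
      using AE_lborel_open_ex[of "\<lambda>z. z \<in> ball x (\<rho> x) \<inter> ball y (\<rho> y) \<longrightarrow> c x = c y" "ball x (\<rho> x) \<inter> ball y (\<rho> y)"]
        open_Int[OF open_ball open_ball] by blast
    then show ?thesis by blast
  qed
  have const: "c x = c y" if "x \<in> \<Omega>" "y \<in> \<Omega>" for x y
  proof (rule connected_local_const[OF \<Omega>(2) that], intro ballI)
    fix a assume a: "a \<in> \<Omega>"
    show "\<forall>\<^sub>F b in at a within \<Omega>. c a = c b"
      unfolding eventually_at_topological
      using loc[OF a] \<rho>[OF a] by (intro exI[of _ "ball a (\<rho> a)"]) auto
  qed
  show ?thesis
  proof (cases "\<Omega> = {}")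
    case False
    then obtain x0 where x0: "x0 \<in> \<Omega>" by auto
    have "AE y in lborel. y \<in> \<Omega> \<longrightarrow> w y = c x0"
    proof (rule AE_lborel_locally)
      fix x assume x: "x \<in> \<Omega>"
      then show "\<exists>U. open U \<and> x \<in> U \<and> (AE y in lborel. y \<in> U \<longrightarrow> w y = c x0)"
        using c[OF x] \<rho>[OF x] const[OF x x0] by (intro exI[of _ "ball x (\<rho> x)"]) auto
    qed
    with w(2) have "AE y in lborel. y \<in> \<Omega> \<longrightarrow> u y = c x0"
      by eventually_elim auto
    then show ?thesis
      using \<Omega>(1) by (intro exI[of _ "c x0"] AE_lebesgue_onI) auto
  qed (auto simp: space_restrict_space intro!: AE_I2)
qed

section \<open>Comparison\<close>

lemma AE_surface_on_subset:
  fixes S T :: "'a::euclidean_space set"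
  assumes "S \<subseteq> T" "S \<in> sets (hausdorff_measure (DIM('a) - 1))" "closed T"
    and "AE x in surface_on T. P x"
  shows "AE x in surface_on S. P x"
proof -
  have "AE x in hausdorff_measure (DIM('a) - 1). x \<in> T \<longrightarrow> P x"
    using assms(4) closed_in_sets_hausdorff_measure[OF assms(3)] by (subst (asm) AE_restrict_space_iff) auto
  then have "AE x in hausdorff_measure (DIM('a) - 1). x \<in> S \<longrightarrow> P x"
    using assms(1) by (auto elim!: eventually_mono)
  then show ?thesis
    using assms(2) by (subst AE_restrict_space_iff) auto
qed

lemma AE_surface_on_Un:
  fixes S T :: "'a::euclidean_space set"
  assumes "S \<in> sets (hausdorff_measure (DIM('a) - 1))" "T \<in> sets (hausdorff_measure (DIM('a) - 1))"
    and "AE x in surface_on S. P x" "AE x in surface_on T. P x"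
  shows "AE x in surface_on (S \<union> T). P x"
proof -
  have "AE x in hausdorff_measure (DIM('a) - 1). x \<in> S \<longrightarrow> P x" "AE x in hausdorff_measure (DIM('a) - 1). x \<in> T \<longrightarrow> P x"
    using assms by (simp_all add: AE_restrict_space_iff)
  then have "AE x in hausdorff_measure (DIM('a) - 1). x \<in> S \<union> T \<longrightarrow> P x"
    by eventually_elim auto
  then show ?thesis
    using assms(1,2) by (subst AE_restrict_space_iff) auto
qed

lemma approx_trace_uminus:
  assumes "bounded_lipschitz_domain \<Omega>" "approx_trace \<Omega> u G t"
  shows "approx_trace \<Omega> (\<lambda>x. - u x) (\<lambda>x. - G x) (\<lambda>x. - t x)"
proof -
  have "approx_trace \<Omega> (\<lambda>x. 0) (\<lambda>x. 0) (\<lambda>x. 0)"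
    using assms(1) bounded_lipschitz_domainD[OF assms(1)]
    by (intro approx_trace_const finite_measure_lebesgue_on_bounded finite_measure_surface_on_frontier)
  from approx_trace_diff[OF this assms(2)] show ?thesis by simp
qed

lemma approx_trace_diff_const:
  assumes "bounded_lipschitz_domain \<Omega>" "approx_trace \<Omega> u G t"
  shows "approx_trace \<Omega> (\<lambda>x. u x - c) G (\<lambda>x. t x - c)"
proof -
  have "approx_trace \<Omega> (\<lambda>x. c) (\<lambda>x. 0) (\<lambda>x. c)"
    using assms(1) bounded_lipschitz_domainD[OF assms(1)]
    by (intro approx_trace_const finite_measure_lebesgue_on_bounded finite_measure_surface_on_frontier)
  from approx_trace_diff[OF assms(2) this] show ?thesis by simp
qed

text \<open>\<open>u\<close> is a constant \<open>c\<close>, and \<open>approx_trace_zero\<close>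
  applied to \<open>u - c\<close> shows that its trace is \<open>c\<close> too. On a set of positive
  surface measure this can agree with zero only if \<open>c = 0\<close>.\<close>

lemma approx_trace_vanishes:
  fixes \<Omega> :: "'a::euclidean_space set"
  assumes \<Omega>: "bounded_lipschitz_domain \<Omega>" and approx: "approx_trace \<Omega> u G t"
    and G0: "AE x in lebesgue_on \<Omega>. G x = 0"
    and S: "S \<subseteq> frontier \<Omega>" "S \<in> sets (hausdorff_measure (DIM('a) - 1))" "emeasure (hausdorff_measure (DIM('a) - 1)) S > 0"
    and t0: "AE x in surface_on S. t x = 0"
  shows "AE x in lebesgue_on \<Omega>. u x = 0"
proof -
  note dom = bounded_lipschitz_domainD[OF \<Omega>]
  obtain c where c: "AE x in lebesgue_on \<Omega>. u x = c"
    using approx_trace_zero_gradient_constant[OF dom(1,3) approx G0] by blast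
  have "AE x in lebesgue_on \<Omega>. u x - c = 0"
    using c by eventually_elim simp
  from approx_trace_zero(2)[OF \<Omega> approx_trace_diff_const[OF \<Omega> approx] this]
  have "AE x in surface_on S. t x - c = 0"
    using S(1,2) by (intro AE_surface_on_subset[of S "frontier \<Omega>"]) auto
  with t0 have "AE x in surface_on S. c = 0"
    by eventually_elim simp
  moreover have "ae_filter (surface_on S) \<noteq> bot"
    using S(2,3) by (simp add: ae_filter_eq_bot_iff emeasure_restrict_space)
  ultimately have "c = 0"
    by (metis eventually_const)
  with c show ?thesis by simp
qed

section \<open>The terms of the variational problems in terms of approximation triples\<close>

lemma dirichlet_form_approx_trace:
  assumes \<Omega>: "bounded_lipschitz_domain \<Omega>" and approx: "approx_trace \<Omega> u G t" "approx_trace \<Omega> v G' t'"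
  shows "dirichlet_form \<Omega> u v = (\<integral>x. G x \<bullet> G' x \<partial>lebesgue_on \<Omega>)"
  unfolding dirichlet_form_def
proof (rule integral_cong_AE)
  show "(\<lambda>x. weak_gradient \<Omega> u x \<bullet> weak_gradient \<Omega> v x) \<in> borel_measurable (lebesgue_on \<Omega>)"
    using approx_trace_imp_has_trace(1)[OF \<Omega> approx(1)] approx_trace_imp_has_trace(1)[OF \<Omega> approx(2)]
    by (intro borel_measurable_inner L2D(1) weak_gradient_in_L2)
  show "(\<lambda>x. G x \<bullet> G' x) \<in> borel_measurable (lebesgue_on \<Omega>)"
    using approx by (intro borel_measurable_inner approx_traceD)
  show "AE x in lebesgue_on \<Omega>. weak_gradient \<Omega> u x \<bullet> weak_gradient \<Omega> v x = G x \<bullet> G' x"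
    using approx_trace_imp_has_trace(2)[OF \<Omega> approx(1)] approx_trace_imp_has_trace(2)[OF \<Omega> approx(2)]
    by eventually_elim simp
qed

lemma load_functional_approx_trace:
  fixes \<Omega> :: "'a::euclidean_space set"
  assumes \<Omega>: "bounded_lipschitz_domain \<Omega>" and approx: "approx_trace \<Omega> v G t"
    and \<Gamma>: "\<Gamma> \<subseteq> frontier \<Omega>" "\<Gamma> \<in> sets (hausdorff_measure (DIM('a) - 1))" and q: "q \<in> borel_measurable (surface_on \<Gamma>)"
  shows "load_functional \<Omega> \<Gamma> g q v = (\<integral>x. g x * v x \<partial>lebesgue_on \<Omega>) - (\<integral>x. q x * t x \<partial>surface_on \<Gamma>)"
proof -
  have "(\<integral>x. q x * boundary_trace \<Omega> v x \<partial>surface_on \<Gamma>) = (\<integral>x. q x * t x \<partial>surface_on \<Gamma>)"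
  proof (rule integral_cong_AE)
    show "(\<lambda>x. q x * boundary_trace \<Omega> v x) \<in> borel_measurable (surface_on \<Gamma>)"
      using measurable_restrict_mono[OF approx_traceD(6)[OF boundary_trace_eq(1)[OF \<Omega> approx]] \<Gamma>(1)] q
      by (intro borel_measurable_times)
    show "(\<lambda>x. q x * t x) \<in> borel_measurable (surface_on \<Gamma>)"
      using measurable_restrict_mono[OF approx_traceD(6)[OF approx] \<Gamma>(1)] q by (intro borel_measurable_times)
    have "AE x in surface_on \<Gamma>. boundary_trace \<Omega> v x = t x"
      using boundary_trace_eq(2)[OF \<Omega> approx] \<Gamma>
      by (intro AE_surface_on_subset[of \<Gamma> "frontier \<Omega>"]) auto
    then show "AE x in surface_on \<Gamma>. q x * boundary_trace \<Omega> v x = q x * t x"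
      by eventually_elim simp
  qed
  then show ?thesis by (simp add: load_functional_def)
qed

text \<open>Removes the Clarke term wherever the trace of the test function is zero.\<close>

lemma clarke_derivative_0 [simp]: "clarke_derivative \<phi> r 0 = 0"
proof -
  have "nhds r \<times>\<^sub>F at_right (0::real) \<noteq> bot"
    by (simp add: prod_filter_eq_bot)
  then have "Limsup (nhds r \<times>\<^sub>F at_right (0::real)) (\<lambda>(y, \<tau>). ereal 0) = ereal 0"
    by (simp add: case_prod_unfold Limsup_const)
  then show ?thesis
    by (simp add: clarke_derivative_def zero_ereal_def)
qed

lemma equals_on_boundaryI:
  assumes \<Omega>: "bounded_lipschitz_domain \<Omega>" and approx: "approx_trace \<Omega> v G t"
    and "AE x in surface_on S. t x = c"
  shows "equals_on_boundary \<Omega> S v c"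
  using approx_trace_imp_has_trace(3)[OF \<Omega> approx] assms(3) unfolding equals_on_boundary_def by blast

text \<open>A function that is not integrable has integral 0, so the bound covers the Clarke term,
  whose measurability in \<open>x\<close> is not established.\<close>

lemma integral_nonpos_AE:
  fixes f :: "'a \<Rightarrow> real"
  assumes "AE x in M. f x \<le> 0"
  shows "(\<integral>x. f x \<partial>M) \<le> 0"
proof -
  have "0 \<le> (\<integral>x. - f x \<partial>M)"
    using assms by (intro integral_nonneg_AE) (auto elim!: eventually_mono)
  then show ?thesis by simp
qed

lemma AE_zero_if_L2_square_nonpos:
  assumes "f \<in> L2 M" "(\<integral>x. (norm (f x))\<^sup>2 \<partial>M) \<le> 0"
  shows "AE x in M. f x = 0"
proof -
  have "(\<integral>x. (norm (f x))\<^sup>2 \<partial>M) = 0"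
    using assms(2) by (intro antisym integral_nonneg_AE) auto
  then have "AE x in M. (norm (f x))\<^sup>2 = 0"
    using L2D(2)[OF assms(1)] by (subst integral_nonneg_eq_0_iff_AE[symmetric]) auto
  then show ?thesis by (auto elim!: eventually_mono)
qed

theorem theorem5:
  fixes \<Omega> \<Gamma>1 \<Gamma>2 \<Gamma>3 :: "'a::euclidean_space set"
    and j :: "'a \<Rightarrow> real \<Rightarrow> real"
    and g q u_alpha u_inf :: "'a \<Rightarrow> real"
    and b \<alpha> :: real
  assumes domain: "bounded_lipschitz_domain \<Omega>"
    and boundary: "frontier \<Omega> = \<Gamma>1 \<union> \<Gamma>2 \<union> \<Gamma>3"
    and disjoint: "\<Gamma>1 \<inter> \<Gamma>2 = {}" "\<Gamma>1 \<inter> \<Gamma>3 = {}" "\<Gamma>2 \<inter> \<Gamma>3 = {}"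
    and portions_measurable:
      "\<Gamma>1 \<in> sets (hausdorff_measure (DIM('a) - 1))"
      "\<Gamma>2 \<in> sets (hausdorff_measure (DIM('a) - 1))"
      "\<Gamma>3 \<in> sets (hausdorff_measure (DIM('a) - 1))"
    and portions_positive:
      "emeasure (hausdorff_measure (DIM('a) - 1)) \<Gamma>1 > 0"
      "emeasure (hausdorff_measure (DIM('a) - 1)) \<Gamma>2 > 0"
      "emeasure (hausdorff_measure (DIM('a) - 1)) \<Gamma>3 > 0"
    and j_measurable: "\<And>r. (\<lambda>x. j x r) \<in> borel_measurable (surface_on \<Gamma>3)"
    and j_lipschitz: "AE x in surface_on \<Gamma>3. locally_lipschitz (j x)"
    and j_growth: "\<exists>c0\<ge>0. \<exists>c1\<ge>0. AE x in surface_on \<Gamma>3.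
        \<forall>r. \<forall>\<zeta>\<in>clarke_subdifferential (j x) r. \<bar>\<zeta>\<bar> \<le> c0 + c1 * \<bar>r\<bar>"
    and j_sign: "AE x in surface_on \<Gamma>3. \<forall>r. clarke_derivative (j x) r (b - r) \<le> 0"
    and b_nonneg: "b \<ge> 0"
    and g_L2: "g \<in> L2 (lebesgue_on \<Omega>)"
    and g_nonpos: "AE x in lebesgue_on \<Omega>. g x \<le> 0"
    and q_L2: "q \<in> L2 (surface_on \<Gamma>2)"
    and q_nonneg: "AE x in surface_on \<Gamma>2. q x \<ge> 0"
    and alpha_pos: "\<alpha> > 0"
    and u_alpha_mem: "u_alpha \<in> V0_space \<Omega> \<Gamma>1"
    and u_alpha_solution: "\<And>v. v \<in> V0_space \<Omega> \<Gamma>1 \<Longrightarrow>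
        dirichlet_form \<Omega> u_alpha v
          + \<alpha> * (\<integral>x. clarke_derivative (j x) (boundary_trace \<Omega> u_alpha x) (boundary_trace \<Omega> v x)
              \<partial>surface_on \<Gamma>3)
        \<ge> load_functional \<Omega> \<Gamma>2 g q v"
    and u_inf_mem: "u_inf \<in> K_set \<Omega> \<Gamma>1 \<Gamma>3 b"
    and u_inf_solution: "\<And>v. v \<in> K0_space \<Omega> \<Gamma>1 \<Gamma>3 \<Longrightarrow>
        dirichlet_form \<Omega> u_inf v = load_functional \<Omega> \<Gamma>2 g q v"
  shows "(AE x in lebesgue_on \<Omega>. u_alpha x \<le> b) \<and> (AE x in lebesgue_on \<Omega>. u_alpha x \<le> u_inf x)"
proof -
  let ?M = "lebesgue_on \<Omega>"
  have \<Gamma>: "\<Gamma>1 \<subseteq> frontier \<Omega>" "\<Gamma>2 \<subseteq> frontier \<Omega>" "\<Gamma>3 \<subseteq> frontier \<Omega>"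
    using boundary by auto
  have to_part: "AE x in surface_on S. P x"
    if "AE x in surface_on (frontier \<Omega>). P x" "S \<in> {\<Gamma>1, \<Gamma>2, \<Gamma>3}" for S and P :: "'a \<Rightarrow> bool"
    using that \<Gamma> portions_measurable
    by (intro AE_surface_on_subset[of S "frontier \<Omega>"]) auto
  note q_meas = L2D(1)[OF q_L2]

  obtain t where t: "has_trace \<Omega> u_alpha t" and t_\<Gamma>1: "AE x in surface_on \<Gamma>1. t x = 0"
    using u_alpha_mem by (auto simp: V0_space_def equals_on_boundary_def)
  define G where "G = weak_gradient \<Omega> u_alpha"
  have approx_alpha: "approx_trace \<Omega> u_alpha G t"
    unfolding G_def using t by (rule has_trace_imp_approx_trace)
  have trace_alpha: "AE x in surface_on (frontier \<Omega>). boundary_trace \<Omega> u_alpha x = t x"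
    by (rule boundary_trace_eq(2)[OF domain approx_alpha])

  \<comment> \<open>\<open>p\<close>, \<open>P\<close>, \<open>s\<close> are the positive part of
    \<open>u_alpha - b\<close>, its gradient and its trace; the test function for the first claim is
    \<open>- p\<close>.\<close>
  define p where "p x = max 0 (u_alpha x - b)" for x
  define P where "P x = indicator {0<..} (u_alpha x - b) *\<^sub>R G x" for x
  define s where "s x = max 0 (t x - b)" for x
  have approx_p: "approx_trace \<Omega> p P s"
    unfolding p_def P_def s_def
    by (rule approx_trace_pos_part[OF approx_trace_diff_const[OF domain approx_alpha]])
  have s_\<Gamma>1: "AE x in surface_on \<Gamma>1. s x = 0"
    using t_\<Gamma>1 by eventually_elim (use b_nonneg in \<open>simp add: s_def\<close>)
  have P0: "AE x in ?M. P x = 0"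
  proof (rule AE_zero_if_L2_square_nonpos)
    show "P \<in> L2 ?M" using approx_p by (rule approx_traceD)
    note approx_v = approx_trace_uminus[OF domain approx_p]
    have "AE x in surface_on \<Gamma>1. - s x = 0"
      using s_\<Gamma>1 by eventually_elim simp
    then have "(\<lambda>x. - p x) \<in> V0_space \<Omega> \<Gamma>1"
      using approx_trace_imp_has_trace(1)[OF domain approx_v] equals_on_boundaryI[OF domain approx_v]
      by (simp add: V0_space_def)
    note ineq = u_alpha_solution[OF this]
    have "dirichlet_form \<Omega> u_alpha (\<lambda>x. - p x) = (\<integral>x. G x \<bullet> - P x \<partial>?M)"
      by (rule dirichlet_form_approx_trace[OF domain approx_alpha approx_v])
    \<comment> \<open>Where \<open>P\<close> is not zero it equals \<open>G\<close>, so the inner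
      product is the square of its norm.\<close>
    also have "\<dots> = - (\<integral>x. (norm (P x))\<^sup>2 \<partial>?M)"
      unfolding integral_minus[symmetric] by (intro Bochner_Integration.integral_cong)
        (auto simp: P_def indicator_def power2_norm_eq_inner)
    finally have form: "dirichlet_form \<Omega> u_alpha (\<lambda>x. - p x) = - (\<integral>x. (norm (P x))\<^sup>2 \<partial>?M)" .
    have "(\<integral>x. clarke_derivative (j x) (boundary_trace \<Omega> u_alpha x) (boundary_trace \<Omega> (\<lambda>x. - p x) x) \<partial>surface_on \<Gamma>3) \<le> 0"
    proof (rule integral_nonpos_AE)
      have "AE x in surface_on \<Gamma>3. boundary_trace \<Omega> u_alpha x = t x"
        "AE x in surface_on \<Gamma>3. boundary_trace \<Omega> (\<lambda>x. - p x) x = - s x"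
        using to_part[OF trace_alpha] to_part[OF boundary_trace_eq(2)[OF domain approx_v]] by auto
      with j_sign show "AE x in surface_on \<Gamma>3.
          clarke_derivative (j x) (boundary_trace \<Omega> u_alpha x) (boundary_trace \<Omega> (\<lambda>x. - p x) x) \<le> 0"
      proof eventually_elim
        case (elim x)
        show ?case
        \<comment> \<open>Above \<open>b\<close> the direction \<open>- s x\<close> is exactly
          \<open>b - t x\<close>, the one in \<open>j_sign\<close>; otherwise the direction is
          zero.\<close>
        proof (cases "t x \<le> b")
          case False
          then have "- s x = b - t x" by (simp add: s_def)
          then show ?thesis using elim by simp
        qed (use elim in \<open>simp add: s_def\<close>)
      qed
    qed
    moreover have "load_functional \<Omega> \<Gamma>2 g q (\<lambda>x. - p x) \<ge> 0"
    proof -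
      have "(\<integral>x. g x * - p x \<partial>?M) \<ge> 0"
        using g_nonpos by (intro integral_nonneg_AE) (auto elim!: eventually_mono simp: p_def mult_nonpos_nonneg)
      moreover have "(\<integral>x. q x * - s x \<partial>surface_on \<Gamma>2) \<le> 0"
        using q_nonneg by (intro integral_nonpos_AE) (auto elim!: eventually_mono simp: s_def)
      ultimately show ?thesis
        unfolding load_functional_approx_trace[OF domain approx_v \<Gamma>(2) portions_measurable(2) q_meas] by simp
    qed
    \<comment> \<open>The inequality now reads: minus the integral of the squared gradient, plus a
      nonpositive Clarke term, is at least a nonnegative load.\<close>
    ultimately show "(\<integral>x. (norm (P x))\<^sup>2 \<partial>?M) \<le> 0"
      using ineq alpha_pos unfolding form by (smt (verit) mult_nonneg_nonpos)
  qed
  have p0: "AE x in ?M. p x = 0"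
    by (rule approx_trace_vanishes[OF domain approx_p P0 \<Gamma>(1) portions_measurable(1) portions_positive(1) s_\<Gamma>1])
  then have a: "AE x in ?M. u_alpha x \<le> b"
    by eventually_elim (simp add: p_def max_def split: if_splits)
  \<comment> \<open>A bound in \<Omega> says nothing about boundary values by itself; it reaches
    them because \<open>p\<close> vanishes and closability makes its trace vanish.\<close>
  have "AE x in surface_on (frontier \<Omega>). s x = 0"
    by (rule approx_trace_zero(2)[OF domain approx_p p0])
  then have t_le: "AE x in surface_on (frontier \<Omega>). t x \<le> b"
    by eventually_elim (simp add: s_def max_def split: if_splits)

  obtain t1 t3 where t1: "has_trace \<Omega> u_inf t1" "AE x in surface_on \<Gamma>1. t1 x = 0"
    and t3: "has_trace \<Omega> u_inf t3" "AE x in surface_on \<Gamma>3. t3 x = b"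
    using u_inf_mem by (auto simp: K_set_def equals_on_boundary_def)
  define G' where "G' = weak_gradient \<Omega> u_inf"
  have approx_inf: "approx_trace \<Omega> u_inf G' t1" and approx_inf3: "approx_trace \<Omega> u_inf G' t3"
    unfolding G'_def using t1(1) t3(1) by (auto intro: has_trace_imp_approx_trace)
  \<comment> \<open>The two boundary conditions of \<open>K_set\<close> come with separate witnesses
    for the trace of \<open>u_inf\<close>; uniqueness merges them.\<close>
  have "AE x in surface_on (frontier \<Omega>). t1 x = t3 x"
    by (rule approx_trace_unique(2)[OF domain approx_inf approx_inf3]) simp
  then have "AE x in surface_on \<Gamma>3. t1 x = t3 x"
    by (rule to_part) simp
  with t3(2) have t1_\<Gamma>3: "AE x in surface_on \<Gamma>3. t1 x = b"
    by eventually_elim simp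

  define z where "z x = max 0 (u_alpha x - u_inf x)" for x
  define Z where "Z x = indicator {0<..} (u_alpha x - u_inf x) *\<^sub>R (G x - G' x)" for x
  define \<sigma> where "\<sigma> x = max 0 (t x - t1 x)" for x
  have approx_z: "approx_trace \<Omega> z Z \<sigma>"
    unfolding z_def Z_def \<sigma>_def by (rule approx_trace_pos_part[OF approx_trace_diff[OF approx_alpha approx_inf]])
  note approx_mz = approx_trace_uminus[OF domain approx_z]
  have \<sigma>_\<Gamma>1: "AE x in surface_on \<Gamma>1. \<sigma> x = 0"
    using t_\<Gamma>1 t1(2) by eventually_elim (simp add: \<sigma>_def)
  have "AE x in surface_on \<Gamma>3. t x \<le> b"
    using t_le by (rule to_part) simp
  \<comment> \<open>On \<open>\<Gamma>3\<close> the trace of \<open>u_inf\<close> is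
    \<open>b\<close> and that of \<open>u_alpha\<close> is at most \<open>b\<close>. This puts
    \<open>z\<close> into \<open>K0_space\<close> and also makes the Clarke term vanish for
    \<open>- z\<close>.\<close>
  with t1_\<Gamma>3 have \<sigma>_\<Gamma>3: "AE x in surface_on \<Gamma>3. \<sigma> x = 0"
    by eventually_elim (simp add: \<sigma>_def)
  have "z \<in> K0_space \<Omega> \<Gamma>1 \<Gamma>3"
    using approx_trace_imp_has_trace(1)[OF domain approx_z] equals_on_boundaryI[OF domain approx_z]
      AE_surface_on_Un[OF portions_measurable(1,3) \<sigma>_\<Gamma>1 \<sigma>_\<Gamma>3]
    by (simp add: K0_space_def)
  note eq = u_inf_solution[OF this]
  have "AE x in surface_on \<Gamma>1. - \<sigma> x = 0"
    using \<sigma>_\<Gamma>1 by eventually_elim simp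
  then have "(\<lambda>x. - z x) \<in> V0_space \<Omega> \<Gamma>1"
    using approx_trace_imp_has_trace(1)[OF domain approx_mz] equals_on_boundaryI[OF domain approx_mz]
    by (simp add: V0_space_def)
  note ineq = u_alpha_solution[OF this]
  have "(\<integral>x. clarke_derivative (j x) (boundary_trace \<Omega> u_alpha x) (boundary_trace \<Omega> (\<lambda>x. - z x) x) \<partial>surface_on \<Gamma>3) = 0"
  proof (rule integral_eq_zero_AE)
    have "AE x in surface_on \<Gamma>3. boundary_trace \<Omega> (\<lambda>x. - z x) x = - \<sigma> x"
      by (rule to_part[OF boundary_trace_eq(2)[OF domain approx_mz]]) simp
    with \<sigma>_\<Gamma>3 show "AE x in surface_on \<Gamma>3.
        clarke_derivative (j x) (boundary_trace \<Omega> u_alpha x) (boundary_trace \<Omega> (\<lambda>x. - z x) x) = 0"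
      by eventually_elim simp
  qed
  moreover have "load_functional \<Omega> \<Gamma>2 g q (\<lambda>x. - z x) = - load_functional \<Omega> \<Gamma>2 g q z"
    unfolding load_functional_approx_trace[OF domain approx_mz \<Gamma>(2) portions_measurable(2) q_meas]
      load_functional_approx_trace[OF domain approx_z \<Gamma>(2) portions_measurable(2) q_meas] by simp
  moreover have "dirichlet_form \<Omega> u_alpha (\<lambda>x. - z x) = - (\<integral>x. G x \<bullet> Z x \<partial>?M)"
    unfolding dirichlet_form_approx_trace[OF domain approx_alpha approx_mz] by simp
  \<comment> \<open>The inequality is tested with \<open>- z\<close> and the equation with
    \<open>z\<close>; since the load is odd, it cancels when the two are added.\<close>
  ultimately have "(\<integral>x. G x \<bullet> Z x \<partial>?M) - (\<integral>x. G' x \<bullet> Z x \<partial>?M) \<le> 0"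
    using ineq eq unfolding dirichlet_form_approx_trace[OF domain approx_inf approx_z] by simp
  also have "(\<integral>x. G x \<bullet> Z x \<partial>?M) - (\<integral>x. G' x \<bullet> Z x \<partial>?M) = (\<integral>x. G x \<bullet> Z x - G' x \<bullet> Z x \<partial>?M)"
    using approx_traceD(2)[OF approx_alpha] approx_traceD(2)[OF approx_inf] approx_traceD(2)[OF approx_z]
    by (intro Bochner_Integration.integral_diff[symmetric] L2_inner_integrable)
  \<comment> \<open>Where \<open>Z\<close> is not zero it equals \<open>G - G'\<close>.\<close>
  also have "\<dots> = (\<integral>x. (norm (Z x))\<^sup>2 \<partial>?M)"
    by (intro Bochner_Integration.integral_cong)
      (auto simp: Z_def indicator_def power2_norm_eq_inner inner_diff_left)
  finally have "AE x in ?M. Z x = 0"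
    by (intro AE_zero_if_L2_square_nonpos approx_traceD(2)[OF approx_z])
  then have "AE x in ?M. z x = 0"
    by (rule approx_trace_vanishes[OF domain approx_z _ \<Gamma>(1) portions_measurable(1) portions_positive(1) \<sigma>_\<Gamma>1])
  then have "AE x in ?M. u_alpha x \<le> u_inf x"
    by eventually_elim (simp add: z_def max_def split: if_splits)
  with a show ?thesis ..
qed

end
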